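(* There is a constant $K > 0$ such that the following holds. Let $u \in \mathcal{S}'(\mathbb{R})$ and assume that $$d_{1/2} u \in L^{1}_{od}(\mathbb{R}^2) + H^{-1/2}_{od}(\mathbb{R}^2).$$ Then $u - C_{u} \in L^2(\mathbb{R})$ for some constant $C_{u} \in \mathbb{C}$ depending on $u$, together with the estimate $$\| u - C_{u} \|_{L^2(\mathbb{R})} \leq K\, \| d_{1/2} u \|_{L^{1}_{od} + H^{-1/2}_{od}},$$ where $K$ is independent of $u$.
   Context: $\mathcal{S}(\mathbb{R}^m)$ is the Fréchet space of complex-valued Schwartz functions, $\mathcal{S}'(\mathbb{R}^m)$ its topological dual (tempered distributions), and $\langle\cdot,\cdot\rangle$ the bilinear pairing; functions are identified with distributions by integration. $\mathcal{S}_{od}(\mathbb{R}^{2})$ (off-diagonal Schwartz functions) is the set of $G \in \mathcal{S}(\mathbb{R}^{2})$, $G = G(x,y)$ with $x,y\in\mathbb{R}$, such that $G(x,y) = -G(y,x)$ for all $x,y$ and $\partial_x^{\alpha}\partial_y^{\beta} G(z,z) = 0$ for all $z \in \mathbb{R}$ and all $\alpha,\beta \in \mathbb{N}_0$; it carries the subspace topology of $\mathcal{S}(\mathbb{R}^{2})$, and $\mathcal{S}'_{od}(\mathbb{R}^{2})$ is its topological dual. For $G \in \mathcal{S}_{od}(\mathbb{R}^{2})$ set $\operatorname{div}_{1/2} G(x) := \int_{\mathbb{R}} \frac{2G(x,y)}{|x-y|^{1/2}} \frac{dy}{|x-y|}$; this defines a continuous linear map $\mathcal{S}_{od}(\mathbb{R}^{2})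 \to \mathcal{S}(\mathbb{R})$. For $u \in \mathcal{S}'(\mathbb{R})$ the distributional fractional gradient $d_{1/2}u \in \mathcal{S}'_{od}(\mathbb{R}^{2})$ is defined by $\langle d_{1/2} u, G\rangle := \langle u, \operatorname{div}_{1/2} G\rangle$ for $G \in \mathcal{S}_{od}(\mathbb{R}^{2})$. $L^1_{od}(\mathbb{R}^{2})$ is the space of measurable functions $F$ on $\mathbb{R}^2$ with $F(x,y) = -F(y,x)$ and $\|F\|_{L^1_{od}} := \int_{\mathbb{R}}\int_{\mathbb{R}} |F(x,y)| \frac{dx\,dy}{|x-y|} < \infty$; such an $F$ is identified with the element of $\mathcal{S}'_{od}(\mathbb{R}^{2})$ given by $\langle F, G\rangle := \int_{\mathbb{R}}\int_{\mathbb{R}} F(x,y) G(x,y) \frac{dx\,dy}{|x-y|}$. $H^{-1/2}_{od}(\mathbb{R}^2) := \{ U \in \mathcal{S}'_{od}(\mathbb{R}^2) : U = d_{1/2} v \text{ for some } v \in L^2(\mathbb{R})\}$, with norm $\|U\|_{H^{-1/2}_{od}} := \|v\|_{L^2}$ for $U = d_{1/2}v$, $v\in L^2(\mathbb{R})$ (such $v$ is unique). The sum $L^{1}_{od} + H^{-1/2}_{od}$ is taken inside $\mathcal{S}'_{od}(\mathbb{R}^2)$ and normed by $\|T\|_{L^{1}_{od} + H^{-1/2}_{od}} := \inf\{\|U\|_{L^1_{od}} + \|V\|_{H^{-1/2}_{od}} : T = U+V,\ U\in L^1_{od}(\mathbb{R}^2),\ V\in H^{-1/2}_{od}(\mathbb{R}^2)\}$.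 *)

theory Defs
  imports "HOL-Analysis.Analysis"
begin

text \<open>
  Schwartz functions on a Euclidean space, here used for \<open>real\<close> and \<open>real \<times> real\<close>.
  A list \<open>[b1, ..., bn]\<close> of basis vectors stands for the iterated partial derivative
  in the directions \<open>bn\<close> (first), ..., \<open>b1\<close> (last).
\<close>

definition partial_deriv ::
    "'a::euclidean_space \<Rightarrow> ('a \<Rightarrow> complex) \<Rightarrow> 'a \<Rightarrow> complex" where
  "partial_deriv b f x = frechet_derivative f (at x) b"

definition partial_derivs ::
    "'a::euclidean_space list \<Rightarrow> ('a \<Rightarrow> complex) \<Rightarrow> 'a \<Rightarrow> complex" where
  "partial_derivs bs f = foldr partial_deriv bs f"

definition smooth :: "('a::euclidean_space \<Rightarrow> complex) \<Rightarrow> bool" where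
  "smooth f \<longleftrightarrow> (\<forall>bs. set bs \<subseteq> Basis \<longrightarrow> (\<forall>x. partial_derivs bs f differentiable at x))"

definition schwartz :: "('a::euclidean_space \<Rightarrow> complex) set" where
  "schwartz = {f. smooth f \<and>
     (\<forall>k bs. set bs \<subseteq> Basis \<longrightarrow>
        bdd_above (range (\<lambda>x. (1 + norm x) ^ k * cmod (partial_derivs bs f x))))}"

definition schwartz_seminorm ::
    "nat \<Rightarrow> 'a::euclidean_space list \<Rightarrow> ('a \<Rightarrow> complex) \<Rightarrow> real" where
  "schwartz_seminorm k bs f = (SUP x. (1 + norm x) ^ k * cmod (partial_derivs bs f x))"

text \<open>The locally convex topology defined by the seminorms, with the seminorm balls as subbase.\<close>

definition schwartz_topology :: "('a::euclidean_space \<Rightarrow> complex) topology" where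
  "schwartz_topology = topology_generated_by
     {{g \<in> schwartz. schwartz_seminorm k bs (\<lambda>x. g x - f x) < e} | f k bs e.
        f \<in> schwartz \<and> set bs \<subseteq> Basis \<and> e > 0}"

text \<open>
  Functionals on a function space are taken to be \<open>undefined\<close> outside of it (\<open>extensional\<close>),
  so that equality of functionals is HOL equality.
\<close>

definition topological_dual ::
    "('a \<Rightarrow> complex) topology \<Rightarrow> (('a \<Rightarrow> complex) \<Rightarrow> complex) set" where
  "topological_dual X = {u \<in> extensional (topspace X).
     (\<forall>f\<in>topspace X. \<forall>g\<in>topspace X. u (\<lambda>x. f x + g x) = u f + u g) \<and>
     (\<forall>c. \<forall>f\<in>topspace X. u (\<lambda>x. c * f x) = c * u f) \<and>
     continuous_map X euclidean u}"

definition tempered_distributions :: "(('a::euclidean_space \<Rightarrow> complex) \<Rightarrow> complex) set" where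
  "tempered_distributions = topological_dual schwartz_topology"

definition distr_of :: "('a::euclidean_space \<Rightarrow> complex) \<Rightarrow> ('a \<Rightarrow> complex) \<Rightarrow> complex" where
  "distr_of f = (\<lambda>\<phi>\<in>schwartz. LINT x|lebesgue. f x * \<phi> x)"

definition L2 :: "('a::euclidean_space \<Rightarrow> complex) set" where
  "L2 = {f \<in> borel_measurable lebesgue. integrable lebesgue (\<lambda>x. (cmod (f x))\<^sup>2)}"

definition L2_norm :: "('a::euclidean_space \<Rightarrow> complex) \<Rightarrow> real" where
  "L2_norm f = sqrt (LINT x|lebesgue. (cmod (f x))\<^sup>2)"

definition schwartz_od :: "(real \<times> real \<Rightarrow> complex) set" where
  "schwartz_od = {G \<in> schwartz. (\<forall>x y. G (x, y) = - G (y, x)) \<and>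
     (\<forall>z \<alpha> \<beta>. partial_derivs (replicate \<alpha> (1, 0) @ replicate \<beta> (0, 1)) G (z, z) = 0)}"

definition schwartz_od_dual :: "((real \<times> real \<Rightarrow> complex) \<Rightarrow> complex) set" where
  "schwartz_od_dual = topological_dual (subtopology schwartz_topology schwartz_od)"

text \<open>
  Below, all integrands carrying a negative power of \<open>\<bar>x - y\<bar>\<close> have value \<open>0\<close> at \<open>x = y\<close>
  (division by zero), a null set.
\<close>

definition div_half :: "(real \<times> real \<Rightarrow> complex) \<Rightarrow> real \<Rightarrow> complex" where
  "div_half G x = (LINT y|lebesgue.
     2 * G (x, y) / of_real (\<bar>x - y\<bar> powr (1/2)) / of_real \<bar>x - y\<bar>)"

definition d_half ::
    "((real \<Rightarrow> complex) \<Rightarrow> complex) \<Rightarrow> (real \<times> real \<Rightarrow> complex) \<Rightarrow> complex" where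
  "d_half u = (\<lambda>G\<in>schwartz_od. u (div_half G))"

definition L1_od :: "(real \<times> real \<Rightarrow> complex) set" where
  "L1_od = {F \<in> borel_measurable lebesgue. (\<forall>x y. F (x, y) = - F (y, x)) \<and>
     integrable lebesgue (\<lambda>(x, y). cmod (F (x, y)) / \<bar>x - y\<bar>)}"

definition L1_od_norm :: "(real \<times> real \<Rightarrow> complex) \<Rightarrow> real" where
  "L1_od_norm F = (LINT (x, y)|lebesgue. cmod (F (x, y)) / \<bar>x - y\<bar>)"

definition distr_od_of ::
    "(real \<times> real \<Rightarrow> complex) \<Rightarrow> (real \<times> real \<Rightarrow> complex) \<Rightarrow> complex" where
  "distr_od_of F = (\<lambda>G\<in>schwartz_od.
     LINT (x, y)|lebesgue. F (x, y) * G (x, y) / of_real \<bar>x - y\<bar>)"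

definition H_od :: "((real \<times> real \<Rightarrow> complex) \<Rightarrow> complex) set" where
  "H_od = {U \<in> schwartz_od_dual. \<exists>v\<in>L2. U = d_half (distr_of v)}"

text \<open>The description is proper: \<open>v\<close> is determined by \<open>U\<close> up to a null set.\<close>

definition H_od_norm :: "((real \<times> real \<Rightarrow> complex) \<Rightarrow> complex) \<Rightarrow> real" where
  "H_od_norm U = (THE r. \<exists>v\<in>L2. U = d_half (distr_of v) \<and> r = L2_norm v)"

definition L1_H_decomp ::
    "((real \<times> real \<Rightarrow> complex) \<Rightarrow> complex) \<Rightarrow> (real \<times> real \<Rightarrow> complex) \<Rightarrow>
     ((real \<times> real \<Rightarrow> complex) \<Rightarrow> complex) \<Rightarrow> bool" where
  "L1_H_decomp T F V \<longleftrightarrow> F \<in> L1_od \<and> V \<in> H_od \<and>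
     T = (\<lambda>G\<in>schwartz_od. distr_od_of F G + V G)"

definition L1_plus_H_od :: "((real \<times> real \<Rightarrow> complex) \<Rightarrow> complex) set" where
  "L1_plus_H_od = {T \<in> schwartz_od_dual. \<exists>F V. L1_H_decomp T F V}"

definition L1_plus_H_od_norm :: "((real \<times> real \<Rightarrow> complex) \<Rightarrow> complex) \<Rightarrow> real" where
  "L1_plus_H_od_norm T = Inf {L1_od_norm F + H_od_norm V | F V. L1_H_decomp T F V}"

lemma partial_derivs_zero: "partial_derivs bs (\<lambda>x. 0) = (\<lambda>x. 0)"
  by (induction bs) (auto simp: partial_derivs_def partial_deriv_def)

lemma topspace_schwartz_topology [simp]:
  "topspace (schwartz_topology :: ('a::euclidean_space \<Rightarrow> complex) topology) = schwartz"
proof -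
  have "f \<in> topspace schwartz_topology" if "f \<in> schwartz" for f :: "'a \<Rightarrow> complex"
  proof -
    have "f \<in> {g \<in> schwartz. schwartz_seminorm 0 [] (\<lambda>x. g x - f x) < 1}"
      using that by (simp add: schwartz_seminorm_def partial_derivs_zero)
    then show ?thesis
      unfolding schwartz_topology_def topology_generated_by_topspace
      using that
      by (intro UnionI[of "{g \<in> schwartz. schwartz_seminorm 0 [] (\<lambda>x. g x - f x) < 1}"] CollectI
            exI[of _ f] exI[of _ "0::nat"] exI[of _ "[]::'a list"] exI[of _ "1::real"]) simp_all
  qed
  then show ?thesis
    unfolding schwartz_topology_def topology_generated_by_topspace by auto
qed

lemma topspace_schwartz_od [simp]:
  "topspace (subtopology schwartz_topology schwartz_od) = schwartz_od"
  by (auto simp: schwartz_od_def)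

end

theory Submission
  imports Defs "HOL-Probability.Sinc_Integral"
begin

text \<open>
  Write \<open>d_half u = F + d_half v\<close> with \<open>F \<in> L1_od\<close> and \<open>v \<in> L2\<close>. The distribution \<open>w = u - v\<close> then has
  \<open>d_half w = F\<close>, which says that \<open>w x - w y = \<bar>x - y\<bar> powr (1/2) * F (x, y)\<close> off the diagonal. Since
  \<open>F\<close> is integrable against \<open>dx dy / \<bar>x - y\<bar>\<close>, the claim is the Sobolev embedding of the homogeneous
  space of order 1/2 over \<open>L1\<close> into \<open>L2\<close>, modulo constants, for a \<open>w\<close> that is only a distribution.

  Two test functions \<open>\<phi>\<close>, \<open>\<psi>\<close> with \<open>\<phi>\<close> living to the left of \<open>\<psi>\<close> give the off-diagonal Schwartz
  function \<open>(\<phi> x * \<psi> y - \<psi> x * \<phi> y) * \<bar>x - y\<bar> powr (3/2)\<close>, whose divergence is a combination of \<open>\<phi>\<close>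
  and \<open>\<psi>\<close>. Pairing with it (\<open>gradient_in_L1_representation\<close>) yields the identity on which everything
  rests:
  \<open>w \<phi> * \<integral>\<psi> - w \<psi> * \<integral>\<phi> = \<integral>\<integral> F (x, y) * \<bar>x - y\<bar> powr (1/2) * \<phi> x * \<psi> y\<close>,
  with \<open>F\<close> antisymmetrized. This pairing identity is the assumption of the locale \<open>gradient_pairing\<close>.

  For a dyadic interval of length \<open>2 powi k\<close> let its coefficient be the value of \<open>w\<close> on a bump of the same
  width placed ten lengths further to the right. The bumps of an interval and of its dyadic parent are
  separated at a distance comparable to their widths, so by the pairing identity the two coefficients differ by at most a
  constant times \<open>2 powi k\<close> to the power -1/2, times the mass of \<open>\<bar>F\<bar> / \<bar>x - y\<bar>\<close> in a box of that scale
  (\<open>coeff_diff_le\<close>). The boxes are pairwise disjoint (\<open>whitney_box_unique\<close>), and the \<open>L2\<close> norm of an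
  indicator function of a dyadic interval is its length to the power 1/2. Hence the changes of the dyadic
  step functions \<open>approx k\<close> from scale to scale are absolutely summable in \<open>L2\<close>, with sum at most a
  constant times the norm of \<open>F\<close> (\<open>total_jump_square_le\<close>). So \<open>approx k\<close> tends to a function
  \<open>limit_fun\<close> at fine scales, to a constant \<open>limit_const\<close> at coarse scales, and the difference of the
  two limits is in \<open>L2\<close>.

  That \<open>w\<close> is given by \<open>limit_fun\<close> also follows from the pairing identity: to the left of a bump \<open>\<psi>\<close> the distribution \<open>w\<close>
  is the function \<open>x \<mapsto> w \<psi> + \<integral> F (x, y) * \<bar>x - y\<bar> powr (1/2) * \<psi> y dy\<close>. For the bump of the interval
  of length \<open>2 powi k\<close> around \<open>x\<close> the integral is at most a constant times
  \<open>sqrt (2 powi k) * \<integral> \<bar>F (x, y)\<bar> / \<bar>x - y\<bar> dy\<close>, which vanishes at fine scales for almost every \<open>x\<close>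
  (\<open>left_density_bump_AE_eq_limit_fun\<close>).

  The identity \<open>u = v + limit_fun\<close> passes from test functions to Schwartz functions by density
  (\<open>test_functions_dense\<close>). Applied to \<open>F = 0\<close>, the same estimate shows that \<open>d_half\<close> is injective on \<open>L2\<close>, so that the
  norm on \<open>H_od\<close> is the \<open>L2\<close> norm (\<open>H_od_norm_d_half\<close>). Finally a function in \<open>L2\<close> plus a constant
  determines both (\<open>L2_plus_const_unique\<close>), so all decompositions of \<open>d_half u\<close> lead to the same function
  and the estimate holds for the infimum.
\<close>

section \<open>Smooth functions\<close>

lemma partial_derivs_Nil [simp]: "partial_derivs [] f = f"
  by (simp add: partial_derivs_def)

lemma partial_derivs_Cons: "partial_derivs (b # bs) f = partial_deriv b (partial_derivs bs f)"
  by (simp add: partial_derivs_def)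

lemma partial_derivs_append:
  "partial_derivs (bs @ cs) f = partial_derivs bs (partial_derivs cs f)"
  by (simp add: partial_derivs_def)

text \<open>
  Smoothness is a statement about all iterated derivatives at once. It is established by exhibiting a
  set of functions that contains the given one and is stable under partial derivatives; products,
  quotients, affine substitutions and flat functions below differ only in that set.
\<close>
lemma smooth_coinduct:
  assumes "f \<in> X"
    and "\<And>g x. g \<in> X \<Longrightarrow> g differentiable at x"
    and "\<And>g b. g \<in> X \<Longrightarrow> b \<in> Basis \<Longrightarrow> partial_deriv b g \<in> X"
  shows "smooth f"
proof -
  have "partial_derivs bs f \<in> X" if "set bs \<subseteq> Basis" for bs
    using that by (induction bs) (auto simp: partial_derivs_Cons assms)
  then show ?thesis
    using assms(2) by (auto simp: smooth_def)
qed

lemma smooth_imp_differentiable: "smooth f \<Longrightarrow> f differentiable at x"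
  unfolding smooth_def by (metis empty_subsetI list.set(1) partial_derivs_Nil)

lemma smooth_imp_continuous: "smooth f \<Longrightarrow> continuous_on A f"
  by (meson continuous_at_imp_continuous_on differentiable_imp_continuous_within
      smooth_imp_differentiable)

lemma smooth_partial_derivs:
  assumes "smooth f" "set bs \<subseteq> Basis" shows "smooth (partial_derivs bs f)"
  unfolding smooth_def
proof (intro allI impI)
  fix cs :: "'a list" and x assume "set cs \<subseteq> Basis"
  then have "set (cs @ bs) \<subseteq> Basis" using assms by auto
  then show "partial_derivs cs (partial_derivs bs f) differentiable at x"
    using assms unfolding smooth_def partial_derivs_append[symmetric] by blast
qed

lemma smooth_partial_deriv: "smooth f \<Longrightarrow> b \<in> Basis \<Longrightarrow> smooth (partial_deriv b f)"
  using smooth_partial_derivs[of f "[b]"] by (simp add: partial_derivs_Cons)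

lemma has_derivative_partial_deriv:
  "(f has_derivative f') (at x) \<Longrightarrow> partial_deriv b f x = f' b"
  unfolding partial_deriv_def by (metis frechet_derivative_at)

lemma smooth_has_derivative:
  "smooth f \<Longrightarrow> (f has_derivative frechet_derivative f (at x)) (at x)"
  using frechet_derivative_works smooth_imp_differentiable by blast

lemma partial_deriv_add:
  assumes "f differentiable at x" "g differentiable at x"
  shows "partial_deriv b (\<lambda>x. f x + g x) x = partial_deriv b f x + partial_deriv b g x"
proof -
  have "((\<lambda>x. f x + g x) has_derivative
      (\<lambda>h. frechet_derivative f (at x) h + frechet_derivative g (at x) h)) (at x)"
    using assms by (intro has_derivative_add) (auto simp: frechet_derivative_works[symmetric])
  from has_derivative_partial_deriv[OF this] show ?thesis
    by (simp add: partial_deriv_def)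
qed

lemma partial_deriv_mult:
  assumes "f differentiable at x" "g differentiable at x"
  shows "partial_deriv b (\<lambda>x. f x * g x) x = partial_deriv b f x * g x + f x * partial_deriv b g x"
proof -
  have "((\<lambda>x. f x * g x) has_derivative
      (\<lambda>h. f x * frechet_derivative g (at x) h + frechet_derivative f (at x) h * g x)) (at x)"
    using assms by (intro has_derivative_mult) (auto simp: frechet_derivative_works[symmetric])
  from has_derivative_partial_deriv[OF this] show ?thesis
    by (simp add: partial_deriv_def algebra_simps)
qed

lemma partial_deriv_const [simp]: "partial_deriv b (\<lambda>x. c) = (\<lambda>x. 0)"
  by (auto simp: partial_deriv_def)

lemma smooth_const: "smooth (\<lambda>x. c)"
  by (rule smooth_coinduct[of _ "{\<lambda>x. c |c. True}"]) auto

lemma smooth_add: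
  fixes f g :: "'a::euclidean_space \<Rightarrow> complex"
  assumes "smooth f" "smooth g" shows "smooth (\<lambda>x. f x + g x)"
proof (rule smooth_coinduct[of _ "{\<lambda>x. f x + g x |f g. smooth f \<and> smooth g}"])
  fix h :: "'a \<Rightarrow> complex" and b :: 'a
  assume "h \<in> {\<lambda>x. f x + g x |f g. smooth f \<and> smooth g}" and b: "b \<in> Basis"
  then obtain f g where fg: "smooth f" "smooth g" and h: "h = (\<lambda>x. f x + g x)" by blast
  have "partial_deriv b h = (\<lambda>x. partial_deriv b f x + partial_deriv b g x)"
    unfolding h using fg by (intro ext partial_deriv_add smooth_imp_differentiable)
  then show "partial_deriv b h \<in> {\<lambda>x. f x + g x |f g. smooth f \<and> smooth g}"
    using fg b smooth_partial_deriv by blast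
next
  show "(\<lambda>x. f x + g x) \<in> {\<lambda>x. f x + g x |f g. smooth f \<and> smooth g}"
    using assms by blast
  show "h differentiable at x" if "h \<in> {\<lambda>x. f x + g x |f g. smooth f \<and> smooth g}"
    for h :: "'a \<Rightarrow> complex" and x
    using that smooth_imp_differentiable differentiable_add by fastforce
qed

text \<open>
  By the Leibniz rule products alone are not stable under differentiation, but their finite sums are.
\<close>
inductive_set product_sums :: "('a::euclidean_space \<Rightarrow> complex) set" where
  prod: "smooth f \<Longrightarrow> smooth g \<Longrightarrow> (\<lambda>x. f x * g x) \<in> product_sums"
| sum: "f \<in> product_sums \<Longrightarrow> g \<in> product_sums \<Longrightarrow> (\<lambda>x. f x + g x) \<in> product_sums"

lemma smooth_mult:
  fixes f g :: "'a::euclidean_space \<Rightarrow> complex"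
  assumes "smooth f" "smooth g" shows "smooth (\<lambda>x. f x * g x)"
proof (rule smooth_coinduct[of _ product_sums])
  show d: "h differentiable at x" if "h \<in> product_sums" for h :: "'a \<Rightarrow> complex" and x
    using that
    by induction (simp_all add: differentiable_add differentiable_mult smooth_imp_differentiable)
  show "partial_deriv b h \<in> product_sums"
    if "h \<in> product_sums" "b \<in> Basis" for h :: "'a \<Rightarrow> complex" and b
    using that(1)
  proof induction
    case (prod f g)
    have "partial_deriv b (\<lambda>x. f x * g x) = (\<lambda>x. partial_deriv b f x * g x + f x * partial_deriv b g x)"
      using prod by (intro ext partial_deriv_mult smooth_imp_differentiable)
    then show ?case
      using prod that(2) by (auto intro!: product_sums.intros smooth_partial_deriv)
  next
    case (sum f g)
    have "partial_deriv b (\<lambda>x. f x + g x) = (\<lambda>x. partial_deriv b f x + partial_deriv b g x)"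
      using sum d by (intro ext partial_deriv_add)
    then show ?case
      using sum by (auto intro!: product_sums.intros)
  qed
  show "(\<lambda>x. f x * g x) \<in> product_sums"
    using assms by (rule product_sums.prod)
qed

lemma smooth_cmult: "smooth f \<Longrightarrow> smooth (\<lambda>x. c * f x)"
  by (intro smooth_mult smooth_const)

lemma smooth_uminus: "smooth f \<Longrightarrow> smooth (\<lambda>x. - f x)"
  using smooth_cmult[of f "-1"] by simp

lemma smooth_diff: "smooth f \<Longrightarrow> smooth g \<Longrightarrow> smooth (\<lambda>x. f x - g x)"
  using smooth_add[OF _ smooth_uminus, of f g] by simp

lemma smooth_real_has_vector_derivative:
  fixes f :: "real \<Rightarrow> complex"
  assumes "smooth f"
  shows "(f has_vector_derivative partial_deriv 1 f x) (at x)"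
proof -
  have "(f has_derivative frechet_derivative f (at x)) (at x)"
    using assms by (rule smooth_has_derivative)
  moreover have "frechet_derivative f (at x) = (\<lambda>h. h *\<^sub>R partial_deriv 1 f x)"
  proof
    fix h :: real
    have "frechet_derivative f (at x) (h *\<^sub>R 1) = h *\<^sub>R frechet_derivative f (at x) 1"
      by (intro linear_cmul linear_frechet_derivative smooth_imp_differentiable assms)
    then show "frechet_derivative f (at x) h = h *\<^sub>R partial_deriv 1 f x"
      by (simp add: partial_deriv_def)
  qed
  ultimately show ?thesis by (simp add: has_vector_derivative_def)
qed

lemma partial_deriv_real:
  fixes f :: "real \<Rightarrow> complex"
  assumes "(f has_vector_derivative f') (at x)"
  shows "partial_deriv 1 f x = f'"
  using has_derivative_partial_deriv[OF assms[unfolded has_vector_derivative_def], of 1] by simp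

lemma smooth_real_coinduct:
  fixes f :: "real \<Rightarrow> complex"
  assumes "f \<in> X"
    and "\<And>g. g \<in> X \<Longrightarrow> \<exists>g'\<in>X. \<forall>x. (g has_vector_derivative g' x) (at x)"
  shows "smooth f"
proof (rule smooth_coinduct[OF assms(1)])
  fix g :: "real \<Rightarrow> complex" and b :: real
  assume g: "g \<in> X"
  then obtain g' where g': "g' \<in> X" "\<And>x. (g has_vector_derivative g' x) (at x)"
    using assms(2) by blast
  show "g differentiable at x" for x
    using g'(2) by (meson differentiableI_vector)
  have "partial_deriv 1 g = g'"
    using g'(2) partial_deriv_real by blast
  then show "partial_deriv b g \<in> X" if "b \<in> Basis"
    using that g' by simp
qed

lemma smooth_affine:
  fixes f :: "real \<Rightarrow> complex" and v :: "'a::euclidean_space"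
  assumes "smooth f"
  shows "smooth (\<lambda>z. f (v \<bullet> z + d))"
proof -
  let ?X = "{\<lambda>z::'a. of_real c * f (v \<bullet> z + d) | c f. smooth f}"
  have der: "((\<lambda>z. of_real c * f (v \<bullet> z + d)) has_derivative
      (\<lambda>h. of_real (c * (v \<bullet> h)) * partial_deriv 1 f (v \<bullet> z + d))) (at z)"
    if "smooth f" for f and z :: 'a and c
  proof -
    have "((\<lambda>z. f (v \<bullet> z + d)) has_derivative
        (\<lambda>h. (v \<bullet> h) *\<^sub>R partial_deriv 1 f (v \<bullet> z + d))) (at z)"
      using smooth_real_has_vector_derivative[OF that, of "v \<bullet> z + d"]
      unfolding has_vector_derivative_def
      by (rule has_derivative_compose[rotated]) (auto intro!: derivative_eq_intros)
    from has_derivative_mult_right[OF this, of "of_real c"] show ?thesis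
      by (simp add: scaleR_conv_of_real mult.assoc)
  qed
  show ?thesis
  proof (rule smooth_coinduct[of _ ?X])
    show "(\<lambda>z. f (v \<bullet> z + d)) \<in> ?X"
      using assms by (intro CollectI exI[of _ 1] exI[of _ f]) auto
    show "g differentiable at x" if "g \<in> ?X" for g x
      using that der unfolding differentiable_def by blast
    show "partial_deriv b g \<in> ?X" if "g \<in> ?X" "b \<in> Basis" for g b
    proof -
      from that obtain c f where g: "g = (\<lambda>z. of_real c * f (v \<bullet> z + d))" and f: "smooth f"
        by blast
      have "partial_deriv b g = (\<lambda>z. of_real (c * (v \<bullet> b)) * partial_deriv 1 f (v \<bullet> z + d))"
        unfolding g using has_derivative_partial_deriv[OF der[OF f]] by (intro ext) simp
      then show ?thesis
        using smooth_partial_deriv[OF f, of 1]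
        by (intro CollectI exI[of _ "c * (v \<bullet> b)"] exI[of _ "partial_deriv 1 f"]) auto
    qed
  qed
qed

lemma smooth_affine_real:
  fixes f :: "real \<Rightarrow> complex"
  shows "smooth f \<Longrightarrow> smooth (\<lambda>x::real. f (c * x + d))"
  using smooth_affine[of f c d] by (simp add: inner_real_def)

text \<open>
  The quotients \<open>a / g ^ n\<close>, with a free exponent, are stable: the derivative of \<open>a / g ^ n\<close> is
  \<open>(a' * g - n * a * g') / g ^ (n + 1)\<close>.
\<close>
lemma smooth_divide:
  fixes f g :: "real \<Rightarrow> complex"
  assumes f: "smooth f" and g: "smooth g" and nz: "\<And>x. g x \<noteq> 0"
  shows "smooth (\<lambda>x. f x / g x)"
proof (rule smooth_real_coinduct[of _ "{\<lambda>x. a x / g x ^ n | a n. smooth a}"])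
  show "(\<lambda>x. f x / g x) \<in> {\<lambda>x. a x / g x ^ n | a n. smooth a}"
    using f by (intro CollectI exI[of _ f] exI[of _ 1]) auto
  fix h assume "h \<in> {\<lambda>x. a x / g x ^ n | a n. smooth a}"
  then obtain a n where h: "h = (\<lambda>x. a x / g x ^ n)" and a: "smooth a" by blast
  let ?b = "\<lambda>x. partial_deriv 1 a x * g x - of_nat n * (a x * partial_deriv 1 g x)"
  have "smooth ?b"
    by (intro smooth_diff smooth_cmult smooth_mult smooth_partial_deriv a g) auto
  moreover have "(h has_vector_derivative ?b x / g x ^ Suc n) (at x)" for x
  proof -
    have da: "(a has_derivative (\<lambda>h. h *\<^sub>R partial_deriv 1 a x)) (at x)"
      using smooth_real_has_vector_derivative[OF a] by (simp add: has_vector_derivative_def)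
    have dg: "(g has_derivative (\<lambda>h. h *\<^sub>R partial_deriv 1 g x)) (at x)"
      using smooth_real_has_vector_derivative[OF g] by (simp add: has_vector_derivative_def)
    show ?thesis
      unfolding h has_vector_derivative_def
      apply (rule derivative_eq_intros da dg refl)+
       apply (use nz in simp)
      apply (rule ext)
      apply (cases n)
       apply (use nz in \<open>simp_all add: field_simps scaleR_conv_of_real\<close>)
      done
  qed
  ultimately show "\<exists>g'\<in>{\<lambda>x. a x / g x ^ n | a n. smooth a}.
      \<forall>x. (h has_vector_derivative g' x) (at x)"
    by (intro bexI[of _ "\<lambda>x. ?b x / g x ^ Suc n"] CollectI exI[of _ ?b] exI[of _ "Suc n"] conjI
        refl allI)
qed

lemma smooth_ident: "smooth (\<lambda>t::real. complex_of_real t)"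
proof (rule smooth_real_coinduct[of _ "{\<lambda>t. complex_of_real (c * t + d) | c d. True}"])
  show "(\<lambda>t. complex_of_real t) \<in> {\<lambda>t. complex_of_real (c * t + d) | c d. True}"
    by (intro CollectI exI[of _ 1] exI[of _ 0]) auto
  fix g assume "g \<in> {\<lambda>t. complex_of_real (c * t + d) | c d. True}"
  then obtain c d where g: "g = (\<lambda>t. complex_of_real (c * t + d))" by blast
  have "(g has_vector_derivative complex_of_real (0 * x + c)) (at x)" for x
    unfolding g has_vector_derivative_def
    by (auto intro!: derivative_eq_intros simp: scaleR_conv_of_real)
  then show "\<exists>g'\<in>{\<lambda>t. complex_of_real (c * t + d) | c d. True}. \<forall>x. (g has_vector_derivative g' x) (at x)"
    by (intro bexI[of _ "\<lambda>x. complex_of_real (0 * x + c)"]) blast+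
qed

section \<open>Flat functions, cutoffs and test functions\<close>
definition flat :: "real \<Rightarrow> real" where
  "flat t = (if t > 0 then exp (- (1 / t)) else 0)"

lemma flat_bounds: "0 \<le> flat t" "flat t \<le> 1"
  by (auto simp: flat_def)

lemma flat_measurable [measurable]: "flat \<in> borel_measurable borel"
  unfolding flat_def by measurable

lemma tendsto_poly_div_exp: "((\<lambda>s::real. poly p s * exp (- s)) \<longlongrightarrow> 0) at_top"
proof -
  have "((\<lambda>s::real. \<Sum>i\<le>degree p. coeff p i * (s ^ i / exp s)) \<longlongrightarrow> (\<Sum>i\<le>degree p. coeff p i * 0)) at_top"
    by (intro tendsto_intros tendsto_power_div_exp_0)
  then show ?thesis
    by (simp add: poly_altdef sum_distrib_right exp_minus divide_inverse mult.assoc)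
qed

text \<open>
  The functions that are \<open>p (1 / t) * exp (- (1 / t))\<close> on the right half-line, for a polynomial \<open>p\<close>, and
  \<open>0\<close> on the left one are stable under differentiation; at \<open>0\<close> the exponential beats every polynomial.
\<close>
lemma smooth_flat: "smooth (\<lambda>t. complex_of_real (flat t))"
proof -
  define h where "h p t = (if t > 0 then poly p (1 / t) * exp (- (1 / t)) else 0)"
    for p and t :: real
  define p' where "p' p = pCons 0 (pCons 0 (p - pderiv p))" for p :: "real poly"
  have der: "(h p has_real_derivative h (p' p) t) (at t)" for p t
  proof -
    consider "t > 0" | "t < 0" | "t = 0" by linarith
    then show ?thesis
    proof cases
      case 1
      have "((\<lambda>t. poly p (1 / t) * exp (- (1 / t))) has_real_derivative h (p' p) t) (at t)"
        using 1 by (auto intro!: derivative_eq_intros simp: h_def p'_def field_simps power2_eq_square)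
      then show ?thesis
        by (rule has_field_derivative_transform_within_open[of _ _ _ "{0<..}"])
          (use 1 in \<open>auto simp: h_def\<close>)
    next
      case 2
      have "((\<lambda>t. 0) has_real_derivative h (p' p) t) (at t)"
        using 2 by (simp add: h_def)
      then show ?thesis
        by (rule has_field_derivative_transform_within_open[of _ _ _ "{..<0}"])
          (use 2 in \<open>auto simp: h_def\<close>)
    next
      case 3
      have "((\<lambda>s. poly (pCons 0 p) (inverse s) * exp (- inverse s)) \<longlongrightarrow> 0) (at_right (0::real))"
        using tendsto_poly_div_exp filterlim_inverse_at_top_right by (rule filterlim_compose)
      moreover have "eventually (\<lambda>s. poly (pCons 0 p) (inverse s) * exp (- inverse s) = (h p s - h p 0) / s)
          (at_right 0)"
        by (intro eventually_at_rightI[of 0 1]) (auto simp: h_def field_simps)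
      ultimately have "((\<lambda>s. (h p s - h p 0) / s) \<longlongrightarrow> 0) (at_right 0)"
        by (rule Lim_transform_eventually)
      moreover have "((\<lambda>s. (h p s - h p 0) / s) \<longlongrightarrow> 0) (at_left 0)"
        by (rule Lim_transform_eventually[OF tendsto_const], rule eventually_at_leftI[of "-1" 0])
          (auto simp: h_def)
      ultimately show ?thesis
        unfolding 3 DERIV_def by (auto simp: filterlim_split_at h_def)
    qed
  qed
  show ?thesis
  proof (rule smooth_real_coinduct[of _ "{\<lambda>t. complex_of_real (h p t) | p. True}"])
    show "(\<lambda>t. complex_of_real (flat t)) \<in> {\<lambda>t. complex_of_real (h p t) | p. True}"
      by (intro CollectI exI[of _ 1]) (auto simp: h_def flat_def)
    fix g assume "g \<in> {\<lambda>t. complex_of_real (h p t) | p. True}"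
    then obtain p where g: "g = (\<lambda>t. complex_of_real (h p t))" by blast
    have "(g has_vector_derivative complex_of_real (h (p' p) t)) (at t)" for t
      unfolding g using der
      by (intro bounded_linear.has_vector_derivative[OF bounded_linear_of_real])
        (auto simp: has_real_derivative_iff_has_vector_derivative)
    then show "\<exists>g'\<in>{\<lambda>t. complex_of_real (h p t) | p. True}. \<forall>x. (g has_vector_derivative g' x) (at x)"
      by (intro bexI[of _ "\<lambda>t. complex_of_real (h (p' p) t)"]) blast+
  qed
qed

definition smooth_step :: "real \<Rightarrow> real" where
  "smooth_step t = flat t / (flat t + flat (1 - t))"

lemma smooth_smooth_step: "smooth (\<lambda>t. complex_of_real (smooth_step t))"
proof -
  have "smooth (\<lambda>t. complex_of_real (flat (1 - t)))"
    using smooth_affine_real[OF smooth_flat, of "-1" 1] by simp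
  moreover have "flat t + flat (1 - t) \<noteq> 0" for t
  proof -
    have "t > 0 \<or> 1 - t > 0" by linarith
    then have "0 < flat t + flat (1 - t)"
      by (auto simp: flat_def intro: add_pos_pos)
    then show ?thesis by simp
  qed
  then have "complex_of_real (flat t) + complex_of_real (flat (1 - t)) \<noteq> 0" for t
    by (metis of_real_add of_real_eq_0_iff)
  ultimately have "smooth (\<lambda>t. complex_of_real (flat t) /
      (complex_of_real (flat t) + complex_of_real (flat (1 - t))))"
    by (intro smooth_divide smooth_add smooth_flat)
  then show ?thesis
    by (simp add: smooth_step_def)
qed

lemma smooth_step_eq_0: "t \<le> 0 \<Longrightarrow> smooth_step t = 0"
  and smooth_step_eq_1: "t \<ge> 1 \<Longrightarrow> smooth_step t = 1"
  and smooth_step_nonneg: "0 \<le> smooth_step t"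
  and smooth_step_le_1: "smooth_step t \<le> 1"
  by (auto simp: smooth_step_def flat_def divide_le_eq_1 add_nonneg_eq_0_iff add_pos_pos)

text \<open>
  A power of \<open>t\<close> becomes smooth on the whole line once it is multiplied by a smooth function vanishing near
  \<open>0\<close> and on the left; the derivative of \<open>a t * t powr s\<close> is \<open>(a' t * t + s * a t) * t powr (s - 1)\<close>, which
  is of the same form.
\<close>
lemma smooth_cutoff_powr:
  fixes a :: "real \<Rightarrow> complex"
  assumes "smooth a" "\<And>t. t < \<delta> \<Longrightarrow> a t = 0" "\<delta> > 0"
  shows "smooth (\<lambda>t. a t * of_real (t powr s))"
proof -
  let ?X = "{\<lambda>t. a t * complex_of_real (t powr s) | a s. smooth a \<and> (\<forall>t<\<delta>. a t = 0)}"
  show ?thesis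
  proof (rule smooth_real_coinduct[of _ ?X])
    show "(\<lambda>t. a t * of_real (t powr s)) \<in> ?X" using assms by blast
    fix g assume "g \<in> ?X"
    then obtain a s where g: "g = (\<lambda>t. a t * complex_of_real (t powr s))"
      and a: "smooth a" and a0: "\<And>t. t < \<delta> \<Longrightarrow> a t = 0" by blast
    define b where "b t = partial_deriv 1 a t * of_real t + of_real s * a t" for t
    have "smooth b"
      unfolding b_def by (intro smooth_add smooth_mult smooth_ident smooth_const smooth_partial_deriv a) simp
    moreover have b0: "b t = 0" if "t < \<delta>" for t
    proof -
      have "(a has_vector_derivative 0) (at t)"
        by (rule has_vector_derivative_transform_within_open[of "\<lambda>_. 0" _ _ "{..<\<delta>}"])
          (use that a0 in auto)
      then show ?thesis
        using a0[OF that] partial_deriv_real by (simp add: b_def)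
    qed
    moreover have "(g has_vector_derivative b t * of_real (t powr (s - 1))) (at t)" for t
    proof (cases "t < \<delta>")
      case True
      have "(g has_vector_derivative 0) (at t)"
        by (rule has_vector_derivative_transform_within_open[of "\<lambda>_. 0" _ _ "{..<\<delta>}"])
          (use True a0 g in auto)
      then show ?thesis using b0[OF True] by simp
    next
      case False
      then have t: "t > 0" using assms by simp
      have "((\<lambda>t. complex_of_real (t powr s)) has_vector_derivative of_real (s * t powr (s - 1))) (at t)"
        using has_real_derivative_powr[OF t, of s]
        by (intro bounded_linear.has_vector_derivative[OF bounded_linear_of_real])
          (auto simp: has_real_derivative_iff_has_vector_derivative)
      from has_vector_derivative_mult[OF smooth_real_has_vector_derivative[OF a] this]
      have "(g has_vector_derivative a t * of_real (s * t powr (s - 1)) +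
          partial_deriv 1 a t * complex_of_real (t powr s)) (at t)"
        unfolding g .
      moreover have "t powr s = t * t powr (s - 1)"
        using t by (simp add: powr_diff)
      ultimately show ?thesis
        by (simp add: b_def algebra_simps)
    qed
    ultimately show "\<exists>g'\<in>?X. \<forall>x. (g has_vector_derivative g' x) (at x)"
      by (intro bexI[of _ "\<lambda>t. b t * of_real (t powr (s - 1))"] CollectI exI[of _ b]
          exI[of _ "s - 1"]) auto
  qed
qed

lemma partial_derivs_eq_0_open:
  assumes "open U" "\<And>x. x \<in> U \<Longrightarrow> f x = 0" "x \<in> U"
  shows "partial_derivs bs f x = 0"
  using assms(3)
proof (induction bs arbitrary: x)
  case (Cons b bs)
  have "(partial_derivs bs f has_derivative (\<lambda>h. 0)) (at x)"
    by (rule has_derivative_transform_within_open[of "\<lambda>_. 0" _ _ _ U]) (use Cons assms in auto)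
  then show ?case
    using has_derivative_partial_deriv by (simp add: partial_derivs_Cons)
qed (use assms in auto)

lemma schwartz_if_compact_support:
  fixes f :: "'a::euclidean_space \<Rightarrow> complex"
  assumes f: "smooth f" and K: "compact K" and f0: "\<And>x. x \<notin> K \<Longrightarrow> f x = 0"
  shows "f \<in> schwartz"
proof -
  have "bdd_above (range (\<lambda>x. (1 + norm x) ^ k * cmod (partial_derivs bs f x)))"
    if bs: "set bs \<subseteq> Basis" for k bs
  proof -
    have "continuous_on K (\<lambda>x. (1 + norm x) ^ k * cmod (partial_derivs bs f x))"
      by (intro continuous_intros smooth_imp_continuous smooth_partial_derivs f bs)
    then have "compact ((\<lambda>x. (1 + norm x) ^ k * cmod (partial_derivs bs f x)) ` K)"
      using K compact_continuous_image by blast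
    then have "bdd_above ((\<lambda>x. (1 + norm x) ^ k * cmod (partial_derivs bs f x)) ` K)"
      by (intro bounded_imp_bdd_above compact_imp_bounded)
    then obtain B where B: "\<And>x. x \<in> K \<Longrightarrow> (1 + norm x) ^ k * cmod (partial_derivs bs f x) \<le> B"
      by (auto simp: bdd_above_def)
    have "partial_derivs bs f x = 0" if "x \<notin> K" for x
      by (rule partial_derivs_eq_0_open[of "- K"]) (use that f0 K compact_imp_closed in auto)
    then have "(1 + norm x) ^ k * cmod (partial_derivs bs f x) \<le> max B 0" for x
      using B[of x] by (cases "x \<in> K") auto
    then show ?thesis by (auto simp: bdd_above_def)
  qed
  then show ?thesis using f by (auto simp: schwartz_def)
qed

definition test_functions :: "(real \<Rightarrow> complex) set" where
  "test_functions = {\<phi>. smooth \<phi> \<and> (\<exists>R. \<forall>x. \<bar>x\<bar> > R \<longrightarrow> \<phi> x = 0)}"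

lemma test_functions_subset_schwartz: "test_functions \<subseteq> schwartz"
proof
  fix \<phi> assume "\<phi> \<in> test_functions"
  then obtain R where "smooth \<phi>" "\<And>x. \<bar>x\<bar> > R \<Longrightarrow> \<phi> x = 0"
    by (auto simp: test_functions_def)
  then show "\<phi> \<in> schwartz"
    by (intro schwartz_if_compact_support[of _ "{-R..R}"]) auto
qed

text \<open>
  This is the supply of elements of \<open>schwartz_od\<close>. The separation of \<open>\<phi>\<close> and \<open>\<psi>\<close> makes the function
  vanish in the strip \<open>\<bar>x - y\<bar> < r - q\<close> about the diagonal, hence with all derivatives, and there is
  no singularity of \<open>\<bar>x - y\<bar> powr (3/2)\<close> to be seen. This exponent is the one that cancels the weight in
  \<open>div_half\<close>.
\<close>
lemma off_diagonal_test_function: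
  assumes \<phi>: "\<phi> \<in> test_functions" and \<psi>: "\<psi> \<in> test_functions"
    and \<phi>0: "\<And>x. x > q \<Longrightarrow> \<phi> x = 0" and \<psi>0: "\<And>x. x < r \<Longrightarrow> \<psi> x = 0" and "q < r"
  shows "(\<lambda>(x, y). (\<phi> x * \<psi> y - \<psi> x * \<phi> y) * of_real (\<bar>x - y\<bar> powr (3/2))) \<in> schwartz_od"
    (is "?G \<in> _")
proof -
  define \<delta> where "\<delta> = r - q"
  have \<delta>: "\<delta> > 0" using \<open>q < r\<close> by (simp add: \<delta>_def)
  \<comment> \<open>\<open>m\<close> is the power \<open>3/2\<close> for \<open>t \<ge> \<delta>\<close> and is cut off smoothly between \<open>\<delta> / 2\<close> and \<open>\<delta>\<close>.\<close>
  define m where "m t = complex_of_real (smooth_step (2 / \<delta> * t + (- 1))) * of_real (t powr (3/2))" for t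
  have "smooth m"
    unfolding m_def
  proof (rule smooth_cutoff_powr[where \<delta> = "\<delta> / 2"])
    show "smooth (\<lambda>t. complex_of_real (smooth_step (2 / \<delta> * t + (- 1))))"
      by (rule smooth_affine_real[OF smooth_smooth_step])
    show "complex_of_real (smooth_step (2 / \<delta> * t + (- 1))) = 0" if "t < \<delta> / 2" for t
    proof -
      have "2 / \<delta> * t + (- 1) \<le> 0" using that \<delta> by (simp add: field_simps)
      then show ?thesis by (simp add: smooth_step_eq_0)
    qed
  qed (use \<delta> in auto)
  have m: "m t = of_real (\<bar>t\<bar> powr (3/2))" if "t \<ge> \<delta>" for t
  proof -
    have "2 / \<delta> * t + (- 1) \<ge> 1" "t > 0" using that \<delta> by (auto simp: field_simps)
    then show ?thesis by (simp add: m_def smooth_step_eq_1)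
  qed
  have far: "y - x \<ge> \<delta>" if "\<phi> x * \<psi> y \<noteq> 0" for x y
    using that \<phi>0[of x] \<psi>0[of y] unfolding \<delta>_def by fastforce
  have smooth_\<phi>\<psi>: "smooth \<phi>" "smooth \<psi>"
    using \<phi> \<psi> by (auto simp: test_functions_def)
  define G where "G z = \<phi> ((1, 0) \<bullet> z + 0) * \<psi> ((0, 1) \<bullet> z + 0) * m ((-1, 1) \<bullet> z + 0) -
      \<psi> ((1, 0) \<bullet> z + 0) * \<phi> ((0, 1) \<bullet> z + 0) * m ((1, -1) \<bullet> z + 0)" for z :: "real \<times> real"
  have "smooth G"
    unfolding G_def by (intro smooth_diff smooth_mult smooth_affine smooth_\<phi>\<psi> \<open>smooth m\<close>)
  have G_eq: "G = ?G"
  proof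
    fix z :: "real \<times> real"
    obtain x y where z: "z = (x, y)" by force
    have "\<phi> x * \<psi> y * m (y - x) = \<phi> x * \<psi> y * of_real (\<bar>x - y\<bar> powr (3/2))"
      using m[of "y - x"] far[of x y] by (auto simp: abs_minus_commute)
    moreover have "\<psi> x * \<phi> y * m (x - y) = \<psi> x * \<phi> y * of_real (\<bar>x - y\<bar> powr (3/2))"
      using m[of "x - y"] far[of y x] by (auto simp: mult.commute)
    ultimately show "G z = ?G z"
      by (auto simp: G_def z algebra_simps)
  qed
  obtain R1 R2 where R: "\<And>x. \<bar>x\<bar> > R1 \<Longrightarrow> \<phi> x = 0" "\<And>x. \<bar>x\<bar> > R2 \<Longrightarrow> \<psi> x = 0"
    using \<phi> \<psi> by (auto simp: test_functions_def)
  define R where "R = max R1 R2"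
  have "?G \<in> schwartz"
    unfolding G_eq[symmetric]
  proof (rule schwartz_if_compact_support[OF \<open>smooth G\<close>])
    show "compact ({-R..R} \<times> {-R..R})" by (intro compact_Times) auto
    fix z assume "z \<notin> {-R..R} \<times> {-R..R}"
    then have "R < \<bar>fst z\<bar> \<or> R < \<bar>snd z\<bar>"
      by (cases z) auto
    then show "G z = 0"
      using R by (auto simp: G_eq R_def split_beta)
  qed
  moreover have "partial_derivs bs ?G (z, z) = 0" for bs z
  proof (rule partial_derivs_eq_0_open)
    show "open {p. \<bar>fst p - snd p\<bar> < \<delta>}"
      by (intro open_Collect_less continuous_intros)
    show "?G p = 0" if "p \<in> {p. \<bar>fst p - snd p\<bar> < \<delta>}" for p
    proof -
      obtain x y where p: "p = (x, y)" by force
      have "\<phi> x * \<psi> y = 0" "\<phi> y * \<psi> x = 0"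
        using that far[of x y] far[of y x] unfolding p by force+
      then show ?thesis by (auto simp: p mult.commute)
    qed
  qed (use \<delta> in auto)
  ultimately show ?thesis
    by (auto simp: schwartz_od_def abs_minus_commute algebra_simps)
qed

section \<open>The fundamental lemma of the calculus of variations\<close>

text \<open>
  The half-lines generate the Borel sets and are stable under intersection, so the integral of \<open>h\<close> over
  every Borel set vanishes.
\<close>
lemma AE_eq_0_if_integral_lessThan_eq_0:
  fixes h :: "real \<Rightarrow> complex"
  assumes h: "integrable lborel h"
    and eq0: "\<And>c. (LINT x|lborel. indicator {..<c} x *\<^sub>R h x) = 0"
  shows "AE x in lborel. h x = 0"
proof (rule sigma_finite_measure.density_unique_banach[OF sigma_finite_lborel h, of "\<lambda>_. 0", simplified])
  have hA: "set_integrable lborel A h" if "A \<in> sets borel" for A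
    using integrable_mult_indicator[OF _ h, of A] that by (simp add: set_integrable_def)
  fix A :: "real set" assume "A \<in> sets borel"
  then have "A \<in> sigma_sets UNIV (range lessThan)"
    by (simp add: borel_Iio)
  have "Int_stable (range (lessThan :: real \<Rightarrow> _))" "range lessThan \<subseteq> Pow (UNIV :: real set)"
    by (auto simp: Int_stable_def greaterThan_Int_greaterThan)
  then show "(LINT x:A|lborel. h x) = 0"
    using \<open>A \<in> sigma_sets UNIV (range lessThan)\<close>
  proof (induction rule: sigma_sets_induct_disjoint)
    case (basic A)
    then show ?case using eq0 by (auto simp: set_lebesgue_integral_def)
  next
    case (compl A)
    then have A: "A \<in> sets borel" by (simp add: borel_Iio)
    have "(\<lambda>n. LINT x:{..<real n}|lborel. h x) \<longlonglongrightarrow> (LINT x:UNIV|lborel. h x)"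
      unfolding set_lebesgue_integral_def
    proof (rule integral_dominated_convergence[where w = "\<lambda>x. norm (h x)"])
      show "AE x in lborel. (\<lambda>n. indicator {..<real n} x *\<^sub>R h x) \<longlonglongrightarrow> indicator UNIV x *\<^sub>R h x"
      proof (rule AE_I2, rule tendsto_eventually)
        fix x :: real
        show "\<forall>\<^sub>F n in sequentially. indicator {..<real n} x *\<^sub>R h x = indicator UNIV x *\<^sub>R h x"
          using eventually_gt_at_top[of "nat \<lceil>x\<rceil>"]
          by eventually_elim (auto simp: indicator_def, linarith)
      qed
    qed (use h in \<open>auto simp: indicator_def\<close>)
    then have UNIV: "(LINT x:UNIV|lborel. h x) = 0"
      using eq0 LIMSEQ_unique[OF _ tendsto_const] by (simp add: set_lebesgue_integral_def)
    have "(LINT x:A \<union> (UNIV - A)|lborel. h x) = (LINT x:A|lborel. h x) + (LINT x:UNIV - A|lborel. h x)"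
      by (rule set_integral_Un) (use A hA in auto)
    then show ?case using compl UNIV by simp
  next
    case (union A)
    then have A: "A i \<in> sets borel" for i by (auto simp: borel_Iio)
    have "(LINT x:(\<Union>i. A i)|lborel. h x) = (\<Sum>i. LINT x:A i|lborel. h x)"
      using A hA union by (intro lebesgue_integral_countable_add) (auto simp: disjoint_family_on_def)
    then show ?case
      using union by simp
  qed (simp add: set_lebesgue_integral_def)
qed

lemma test_function_smooth: "\<phi> \<in> test_functions \<Longrightarrow> smooth \<phi>"
  by (simp add: test_functions_def)

lemma test_function_measurable [measurable_dest]:
  "\<phi> \<in> test_functions \<Longrightarrow> \<phi> \<in> borel_measurable borel"
  by (intro borel_measurable_continuous_onI smooth_imp_continuous test_function_smooth)

lemma test_function_bounded:
  assumes "\<phi> \<in> test_functions"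
  obtains B R where "B > 0" "\<And>x. cmod (\<phi> x) \<le> B" "R > 0" "\<And>x. \<bar>x\<bar> > R \<Longrightarrow> \<phi> x = 0"
proof -
  from assms obtain R where R: "\<And>x. \<bar>x\<bar> > R \<Longrightarrow> \<phi> x = 0" by (auto simp: test_functions_def)
  from assms have "\<phi> \<in> schwartz" using test_functions_subset_schwartz by blast
  then have "bdd_above (range (\<lambda>x. (1 + norm x) ^ 0 * cmod (partial_derivs [] \<phi> x)))"
    unfolding schwartz_def by (auto dest!: spec[of _ "0::nat"] spec[of _ "[]"])
  then obtain B where B: "\<And>x. cmod (\<phi> x) \<le> B"
    by (auto simp: bdd_above_def)
  show thesis
    by (rule that[of "max B 1" "max R 1"]) (use B R in \<open>auto simp: le_max_iff_disj\<close>)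
qed

lemma bounded_support_integrable:
  fixes \<phi> :: "real \<Rightarrow> complex"
  assumes [measurable]: "\<phi> \<in> borel_measurable borel"
    and B: "\<And>x. cmod (\<phi> x) \<le> B" and R: "\<And>x. \<bar>x\<bar> > R \<Longrightarrow> \<phi> x = 0"
  shows "integrable lborel \<phi>"
proof (rule Bochner_Integration.integrable_bound)
  have "integrable lborel (indicator {-R..R} :: real \<Rightarrow> real)"
    by (intro integrable_real_indicator) (auto simp: emeasure_lborel_Icc_eq)
  then show "integrable lborel (\<lambda>x. B * indicator {-R..R} x)"
    by (rule integrable_mult_right)
  show "AE x in lborel. cmod (\<phi> x) \<le> norm (B * indicator {-R..R} x)"
    using B R by (auto simp: indicator_def abs_le_iff intro: order_trans[OF B abs_ge_self])
qed simp

lemma test_function_integrable: "\<phi> \<in> test_functions \<Longrightarrow> integrable lborel \<phi>"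
  by (metis bounded_support_integrable test_function_bounded test_function_measurable)

lemma test_functions_mult:
  "\<phi> \<in> test_functions \<Longrightarrow> smooth \<theta> \<Longrightarrow> (\<lambda>x. \<theta> x * \<phi> x) \<in> test_functions"
  by (auto simp: test_functions_def intro: smooth_mult)

lemma test_functions_add:
  assumes "\<phi> \<in> test_functions" "\<psi> \<in> test_functions"
  shows "(\<lambda>x. \<phi> x + \<psi> x) \<in> test_functions"
proof -
  obtain R1 R2 where "\<And>x. \<bar>x\<bar> > R1 \<Longrightarrow> \<phi> x = 0" "\<And>x. \<bar>x\<bar> > R2 \<Longrightarrow> \<psi> x = 0"
    using assms by (auto simp: test_functions_def)
  then have "\<forall>x. \<bar>x\<bar> > max R1 R2 \<longrightarrow> \<phi> x + \<psi> x = 0" by auto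
  moreover have "smooth (\<lambda>x. \<phi> x + \<psi> x)"
    using assms by (auto simp: test_functions_def intro: smooth_add)
  ultimately show ?thesis
    unfolding test_functions_def by blast
qed

lemma test_functions_cmult: "\<phi> \<in> test_functions \<Longrightarrow> (\<lambda>x. c * \<phi> x) \<in> test_functions"
  by (intro test_functions_mult smooth_const)

lemma test_function_mult_integrable:
  assumes \<phi>: "\<phi> \<in> test_functions" and h: "\<And>a b. set_integrable lborel {a..b} h"
  shows "integrable lborel (\<lambda>x. \<phi> x * h x)"
proof -
  obtain B R where B: "\<And>x. cmod (\<phi> x) \<le> B" and R: "\<And>x. \<bar>x\<bar> > R \<Longrightarrow> \<phi> x = 0"
    using test_function_bounded[OF \<phi>] by metis
  have [measurable]: "\<phi> \<in> borel_measurable borel" using \<phi> by (rule test_function_measurable)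
  have h': "integrable lborel (\<lambda>x. indicator {-R..R} x *\<^sub>R h x)"
    using h by (simp add: set_integrable_def)
  have [measurable]: "(\<lambda>x. indicator {-R..R} x *\<^sub>R h x) \<in> borel_measurable lborel"
    using h' by (rule borel_measurable_integrable)
  have "integrable lborel (\<lambda>x. \<phi> x * (indicator {-R..R} x *\<^sub>R h x))"
  proof (rule Bochner_Integration.integrable_bound)
    show "integrable lborel (\<lambda>x. B * norm (indicator {-R..R} x *\<^sub>R h x))"
      by (intro integrable_mult_right integrable_norm h')
    show "AE x in lborel. norm (\<phi> x * (indicator {-R..R} x *\<^sub>R h x)) \<le> norm (B * norm (indicator {-R..R} x *\<^sub>R h x))"
      using B by (intro AE_I2) (auto simp: norm_mult abs_mult indicator_def intro!: mult_right_mono order_trans[OF B abs_ge_self])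
  qed measurable
  moreover have "(\<lambda>x. \<phi> x * (indicator {-R..R} x *\<^sub>R h x)) = (\<lambda>x. \<phi> x * h x)"
    using R by (fastforce simp: indicator_def)
  ultimately show ?thesis by simp
qed

text \<open>
  The indicator function of an open interval is a bounded pointwise limit of test functions supported in it.
\<close>
lemma integral_eq_0_on_interval:
  fixes h :: "real \<Rightarrow> complex"
  assumes h: "set_integrable lborel {a..b} h"
    and eq0: "\<And>\<phi>. \<phi> \<in> test_functions \<Longrightarrow> (\<And>x. x \<notin> {a<..<b} \<Longrightarrow> \<phi> x = 0) \<Longrightarrow> (LINT x|lborel. \<phi> x * h x) = 0"
  shows "(LINT x|lborel. indicator {a<..<b} x *\<^sub>R h x) = 0"
proof -
  define \<eta> where "\<eta> n x = smooth_step (real n * x + (- real n * a)) * smooth_step (- real n * x + real n * b)"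
    for n x
  have \<eta>0: "\<eta> n x = 0" if "x \<notin> {a<..<b}" for n x
  proof -
    have "real n * x \<le> real n * a \<or> real n * b \<le> real n * x"
      using that by (auto simp: not_less intro: mult_left_mono)
    then show ?thesis by (auto simp: \<eta>_def smooth_step_eq_0)
  qed
  have \<eta>1: "\<bar>\<eta> n x\<bar> \<le> 1" for n x
    unfolding \<eta>_def abs_mult
    by (intro mult_le_one) (auto simp: smooth_step_nonneg smooth_step_le_1)
  have \<eta>_smooth: "smooth (\<lambda>x. complex_of_real (\<eta> n x))" for n
    unfolding \<eta>_def of_real_mult
    by (intro smooth_mult smooth_affine_real smooth_smooth_step)
  have \<eta>: "(\<lambda>x. complex_of_real (\<eta> n x)) \<in> test_functions" for n
    unfolding test_functions_def
    by (intro CollectI conjI \<eta>_smooth exI[of _ "max \<bar>a\<bar> \<bar>b\<bar>"]) (auto intro!: \<eta>0)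
  have [measurable]: "\<eta> n \<in> borel_measurable borel" for n
    using measurable_compose[OF test_function_measurable[OF \<eta>, of n] borel_measurable_Re] by simp
  have meas: "(\<lambda>x. indicator {a..b} x *\<^sub>R h x) \<in> borel_measurable borel"
    using h by (auto simp: set_integrable_def dest: borel_measurable_integrable)
  have lim: "(\<lambda>n. LINT x|lborel. \<eta> n x *\<^sub>R (indicator {a..b} x *\<^sub>R h x))
      \<longlonglongrightarrow> (LINT x|lborel. indicator {a<..<b} x *\<^sub>R (indicator {a..b} x *\<^sub>R h x))"
  proof (rule integral_dominated_convergence[where w = "\<lambda>x. norm (indicator {a..b} x *\<^sub>R h x)"])
    show "integrable lborel (\<lambda>x. norm (indicator {a..b} x *\<^sub>R h x))"
      using h by (intro integrable_norm) (simp add: set_integrable_def)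
    show "AE x in lborel. (\<lambda>n. \<eta> n x *\<^sub>R (indicator {a..b} x *\<^sub>R h x))
        \<longlonglongrightarrow> indicator {a<..<b} x *\<^sub>R (indicator {a..b} x *\<^sub>R h x)"
    proof (rule AE_I2, rule tendsto_eventually)
      fix x
      show "\<forall>\<^sub>F n in sequentially. \<eta> n x *\<^sub>R (indicator {a..b} x *\<^sub>R h x) =
          indicator {a<..<b} x *\<^sub>R (indicator {a..b} x *\<^sub>R h x)"
      proof (cases "x \<in> {a<..<b}")
        case True
        show ?thesis
          using eventually_gt_at_top[of "nat \<lceil>1 / (x - a)\<rceil> + nat \<lceil>1 / (b - x)\<rceil>"]
        proof eventually_elim
          case (elim n)
          then have "1 / (x - a) \<le> real n" "1 / (b - x) \<le> real n" by linarith+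
          then have "1 \<le> real n * (x - a)" "1 \<le> real n * (b - x)"
            using True by (auto simp: field_simps)
          then have "\<eta> n x = 1" unfolding \<eta>_def
            by (subst (1 2) smooth_step_eq_1) (auto simp: algebra_simps)
          then show ?case using True by simp
        qed
      qed (simp add: \<eta>0)
    qed
    show "AE x in lborel. norm (\<eta> n x *\<^sub>R (indicator {a..b} x *\<^sub>R h x)) \<le> norm (indicator {a..b} x *\<^sub>R h x)" for n
      using \<eta>1[of n] by (auto simp: indicator_def abs_mult intro!: mult_left_le_one_le)
  qed (use meas in measurable)
  have "(LINT x|lborel. \<eta> n x *\<^sub>R (indicator {a..b} x *\<^sub>R h x)) = 0" for n
  proof -
    have "(LINT x|lborel. \<eta> n x *\<^sub>R (indicator {a..b} x *\<^sub>R h x)) = (LINT x|lborel. complex_of_real (\<eta> n x) * h x)"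
    proof (rule Bochner_Integration.integral_cong[OF refl])
      fix x
      show "\<eta> n x *\<^sub>R (indicator {a..b} x *\<^sub>R h x) = complex_of_real (\<eta> n x) * h x"
        using \<eta>0[of x n] by (cases "x \<in> {a<..<b}") (auto simp: indicator_def scaleR_conv_of_real)
    qed
    then show ?thesis using eq0[OF \<eta>] \<eta>0 by simp
  qed
  with lim have "(LINT x|lborel. indicator {a<..<b} x *\<^sub>R (indicator {a..b} x *\<^sub>R h x)) = 0"
    using LIMSEQ_unique[OF _ tendsto_const] by simp
  moreover have "(\<lambda>x. indicator {a<..<b} x *\<^sub>R (indicator {a..b} x *\<^sub>R h x)) = (\<lambda>x. indicator {a<..<b} x *\<^sub>R h x)"
    by (auto simp: indicator_def)
  ultimately show ?thesis by simp
qed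

text \<open>
  The one-sided form is what the pairing identity calls for, since it only sees test functions to the left of
  a given bump. The functions \<open>\<phi>\<close> have to stop at a positive distance from \<open>r\<close>.
\<close>
lemma fundamental_lemma_left_of:
  fixes h :: "real \<Rightarrow> complex"
  assumes h: "\<And>a b. b < r \<Longrightarrow> set_integrable lborel {a..b} h"
    and eq0: "\<And>\<phi> q. \<phi> \<in> test_functions \<Longrightarrow> q < r \<Longrightarrow> (\<And>x. x > q \<Longrightarrow> \<phi> x = 0) \<Longrightarrow>
      (LINT x|lborel. \<phi> x * h x) = 0"
  shows "AE x in lborel. x < r \<longrightarrow> h x = 0"
proof -
  have int0: "(LINT x|lborel. indicator {a<..<b} x *\<^sub>R h x) = 0" if "b < r" for a b
    using that by (intro integral_eq_0_on_interval h eq0[of _ b]) auto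
  have "AE x in lborel. indicator {a<..<b} x *\<^sub>R h x = 0" if "b < r" for a b
  proof (rule AE_eq_0_if_integral_lessThan_eq_0)
    have "set_integrable lborel {a<..<b} h"
      by (rule set_integrable_subset[OF h[OF that, of a]]) auto
    then show "integrable lborel (\<lambda>x. indicator {a<..<b} x *\<^sub>R h x)"
      by (simp add: set_integrable_def)
    fix c
    have "indicator {..<c} x *\<^sub>R indicator {a<..<b} x *\<^sub>R h x = indicator {a<..<min b c} x *\<^sub>R h x" for x
      by (auto simp: indicator_def)
    then have "(LINT x|lborel. indicator {..<c} x *\<^sub>R indicator {a<..<b} x *\<^sub>R h x) =
        (LINT x|lborel. indicator {a<..<min b c} x *\<^sub>R h x)"
      by presburger
    then show "(LINT x|lborel. indicator {..<c} x *\<^sub>R indicator {a<..<b} x *\<^sub>R h x) = 0"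
      using int0[of "min b c" a] that by simp
  qed
  then have "AE x in lborel. \<forall>n::nat. indicator {- real n<..<r - 1 / real (Suc n)} x *\<^sub>R h x = 0"
    by (subst AE_all_countable) auto
  then show ?thesis
  proof eventually_elim
    case (elim x)
    show ?case
    proof
      assume "x < r"
      obtain n1 :: nat where n1: "\<bar>x\<bar> < real n1" using reals_Archimedean2 by blast
      obtain n2 :: nat where n2: "1 / real (Suc n2) < r - x" using \<open>x < r\<close> nat_approx_posE[of "r - x"] by auto
      define n where "n = max n1 n2"
      have "1 / real (Suc n) \<le> 1 / real (Suc n2)" by (simp add: n_def frac_le)
      then have "x \<in> {- real n<..<r - 1 / real (Suc n)}" using n1 n2 by (auto simp: n_def)
      then show "h x = 0" using elim[rule_format, of n] by simp
    qed
  qed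
qed

lemma fundamental_lemma:
  fixes h :: "real \<Rightarrow> complex"
  assumes "\<And>a b. set_integrable lborel {a..b} h"
    and "\<And>\<phi>. \<phi> \<in> test_functions \<Longrightarrow> (LINT x|lborel. \<phi> x * h x) = 0"
  shows "AE x in lborel. h x = 0"
proof -
  have "AE x in lborel. \<forall>n::nat. x < real n \<longrightarrow> h x = 0"
    by (subst AE_all_countable) (intro allI fundamental_lemma_left_of assms)
  then show ?thesis
    by eventually_elim (use reals_Archimedean2 in blast)
qed

section \<open>Bumps attached to dyadic intervals\<close>

text \<open>
  The support [10, 11] is chosen with two aims. Seen from the dyadic interval [0, 1) to which the bump
  belongs it is far to the right, and it is narrow: points of the bump of an interval of length \<open>l\<close> and
  of the bump of its parent, which sits at a multiple of \<open>2 * l\<close> plus [20, 22] \<open>* l\<close>, have distances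
  between \<open>8 * l\<close> and \<open>13 * l\<close>. This range lies within one dyadic octave, so the distance determines
  the scale.
\<close>
definition mother_bump :: "real \<Rightarrow> real" where
  "mother_bump x = flat (x - 10) * flat (11 - x) / (LINT x|lborel. flat (x - 10) * flat (11 - x))"

definition bump :: "int \<Rightarrow> int \<Rightarrow> real \<Rightarrow> real" where
  "bump k j x = mother_bump (x / 2 powi k - of_int j) / 2 powi k"

definition bump_bound :: real where
  "bump_bound = 1 / (LINT x|lborel. flat (x - 10) * flat (11 - x))"

lemma flat_product_integrable: "integrable lborel (\<lambda>x. flat (x - 10) * flat (11 - x))"
proof (rule Bochner_Integration.integrable_bound)
  show "integrable lborel (indicator {10..11} :: real \<Rightarrow> real)" by simp
  show "AE x in lborel. norm (flat (x - 10) * flat (11 - x)) \<le> norm (indicator {10..11} x :: real)"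
    by (auto simp: indicator_def flat_def mult_le_one)
qed simp

lemma flat_product_integral_pos: "0 < (LINT x|lborel. flat (x - 10) * flat (11 - x))"
proof -
  have "(LINT x|lborel. flat (x - 10) * flat (11 - x)) \<noteq> 0"
  proof
    assume "(LINT x|lborel. flat (x - 10) * flat (11 - x)) = 0"
    then have "AE x in lborel. flat (x - 10) * flat (11 - x) = 0"
      using integral_nonneg_eq_0_iff_AE[OF flat_product_integrable] flat_bounds by simp
    then have "AE x in lborel. x \<notin> {10<..<11::real}"
      by eventually_elim (auto simp: flat_def)
    then have "emeasure lborel {10<..<11::real} = 0"
      by (subst (asm) AE_iff_null_sets[symmetric]) (auto simp: null_sets_def)
    then show False by simp
  qed
  moreover have "0 \<le> (LINT x|lborel. flat (x - 10) * flat (11 - x))"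
    by (intro integral_nonneg_AE) (simp add: flat_bounds)
  ultimately show ?thesis by linarith
qed

lemma bump_bound_pos: "bump_bound > 0"
  using flat_product_integral_pos by (simp add: bump_bound_def)

lemma mother_bump_bounds: "0 \<le> mother_bump x" "mother_bump x \<le> bump_bound"
  using flat_product_integral_pos flat_bounds[of "x - 10"] flat_bounds[of "11 - x"]
  by (auto simp: mother_bump_def bump_bound_def mult_le_one intro!: divide_right_mono)

lemma mother_bump_eq_0: "x \<notin> {10<..<11} \<Longrightarrow> mother_bump x = 0"
  by (auto simp: mother_bump_def flat_def)

lemma bump_nonneg: "0 \<le> bump k j x"
  by (simp add: bump_def mother_bump_bounds)

lemma bump_le: "bump k j x \<le> bump_bound / 2 powi k"
  by (simp add: bump_def mother_bump_bounds divide_right_mono)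

lemma bump_eq_0:
  "x \<notin> {2 powi k * (of_int j + 10)<..<2 powi k * (of_int j + 11)} \<Longrightarrow> bump k j x = 0"
proof -
  assume x: "x \<notin> {2 powi k * (of_int j + 10)<..<2 powi k * (of_int j + 11)}"
  have "(0::real) < 2 powi k" by simp
  then have "x / 2 powi k - of_int j \<notin> {10<..<11}"
    using x by (auto simp: field_simps)
  then show ?thesis by (simp add: bump_def mother_bump_eq_0)
qed

lemma bump_measurable [measurable]: "bump k j \<in> borel_measurable borel"
  unfolding bump_def mother_bump_def by measurable

lemma bump_test_function: "(\<lambda>x. complex_of_real (bump k j x)) \<in> test_functions"
proof -
  have "smooth (\<lambda>x. complex_of_real (mother_bump x))"
  proof -
    have "smooth (\<lambda>x. complex_of_real bump_bound *
        (complex_of_real (flat (1 * x + (- 10))) * complex_of_real (flat ((- 1) * x + 11))))"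
      by (intro smooth_cmult smooth_mult smooth_affine_real smooth_flat)
    then show ?thesis
      by (simp add: mother_bump_def bump_bound_def)
  qed
  from smooth_affine_real[OF this, of "1 / 2 powi k" "- of_int j"]
  have "smooth (\<lambda>x. complex_of_real (1 / 2 powi k) * complex_of_real (mother_bump (1 / 2 powi k * x + (- of_int j))))"
    by (rule smooth_cmult)
  then have "smooth (\<lambda>x. complex_of_real (bump k j x))"
    by (simp add: bump_def)
  moreover have "bump k j x = 0" if "\<bar>x\<bar> > \<bar>2 powi k * (of_int j + 10)\<bar> + \<bar>2 powi k * (of_int j + 11)\<bar>" for x
    using that by (intro bump_eq_0) auto
  ultimately show ?thesis by (auto simp: test_functions_def)
qed

lemma bump_integral: "(LINT x|lborel. complex_of_real (bump k j x)) = 1"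
proof -
  have "(LINT x|lborel. mother_bump x) = 1"
    using flat_product_integral_pos by (simp add: mother_bump_def)
  moreover have "(LINT x|lborel. bump k j x) = (LINT x|lborel. mother_bump x)"
    using lborel_integral_real_affine[of "1 / 2 powi k" mother_bump "- of_int j"]
    by (simp add: bump_def)
  ultimately show ?thesis by simp
qed

section \<open>Sums of step functions in L2\<close>
lemma powr_3_2: "0 \<le> (x::real) \<Longrightarrow> x powr (3/2) = x * sqrt x"
proof -
  assume "0 \<le> x"
  have "x powr (3/2) = x powr (1 + 1/2)" by simp
  also have "\<dots> = x powr 1 * x powr (1/2)" by (rule powr_add)
  finally show ?thesis using \<open>0 \<le> x\<close> by (simp add: powr_half_sqrt)
qed

lemma sum_le_nn_integral_count_space:
  assumes "finite A" shows "sum f A \<le> (\<integral>\<^sup>+x. f x \<partial>count_space UNIV)"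
proof -
  have "sum f A = (\<integral>\<^sup>+x. f x \<partial>count_space A)"
    using assms by (simp add: nn_integral_count_space_finite)
  also have "\<dots> = (\<integral>\<^sup>+x. f x * indicator A x \<partial>count_space UNIV)"
    by (simp add: nn_integral_count_space_indicator)
  also have "\<dots> \<le> (\<integral>\<^sup>+x. f x \<partial>count_space UNIV)"
    by (intro nn_integral_mono) (auto simp: indicator_def)
  finally show ?thesis .
qed

lemma borel_measurable_nn_integral_count_space:
  fixes f :: "'a \<Rightarrow> 'i::countable \<Rightarrow> ennreal"
  assumes "\<And>i. (\<lambda>x. f x i) \<in> borel_measurable M"
  shows "(\<lambda>x. \<integral>\<^sup>+i. f x i \<partial>count_space UNIV) \<in> borel_measurable M"
proof -
  interpret sigma_finite_measure "count_space (UNIV :: 'i set)"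
    by (rule sigma_finite_measure_count_space)
  show ?thesis
  proof (rule borel_measurable_nn_integral)
    show "case_prod f \<in> borel_measurable (M \<Otimes>\<^sub>M count_space UNIV)"
      unfolding case_prod_beta
      by (rule measurable_compose_countable[where g = snd and f = "\<lambda>i x. f (fst x) i"]) (use assms in auto)
  qed
qed

text \<open>
  This is the triangle inequality in \<open>L2\<close> for a countable sum of multiples of indicator functions. Expanding
  the square leaves the measures of \<open>I p \<inter> I q\<close>, and the smaller of two numbers \<open>s p * s p\<close> and \<open>s q * s q\<close>
  is at most \<open>s p * s q\<close>.
\<close>
lemma nn_integral_square_step_sum_le:
  fixes a :: "'i::countable \<Rightarrow> ennreal" and s :: "'i \<Rightarrow> real"
  assumes I [measurable]: "\<And>p. I p \<in> sets M"
    and s: "\<And>p. emeasure M (I p) \<le> ennreal (s p * s p)" "\<And>p. 0 \<le> s p"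
  shows "(\<integral>\<^sup>+x. (\<integral>\<^sup>+p. a p * indicator (I p) x \<partial>count_space UNIV) *
      (\<integral>\<^sup>+p. a p * indicator (I p) x \<partial>count_space UNIV) \<partial>M)
    \<le> (\<integral>\<^sup>+p. a p * ennreal (s p) \<partial>count_space UNIV) * (\<integral>\<^sup>+p. a p * ennreal (s p) \<partial>count_space UNIV)"
proof -
  have square: "(\<integral>\<^sup>+p. f p \<partial>count_space UNIV) * (\<integral>\<^sup>+p. f p \<partial>count_space UNIV) =
      (\<integral>\<^sup>+pq. f (fst pq) * f (snd pq) \<partial>count_space UNIV)" for f :: "'i \<Rightarrow> ennreal"
  proof -
    have "(\<integral>\<^sup>+pq. f (fst pq) * f (snd pq) \<partial>count_space UNIV) =
        (\<integral>\<^sup>+p. \<integral>\<^sup>+q. f p * f q \<partial>count_space UNIV \<partial>count_space UNIV)"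
      using nn_integral_fst_count_space[of "\<lambda>pq. f (fst pq) * f (snd pq)"] by simp
    then show ?thesis by (simp add: nn_integral_cmult nn_integral_multc)
  qed
  have meas: "emeasure M (I p \<inter> I q) \<le> ennreal (s p) * ennreal (s q)" for p q
  proof -
    have "emeasure M (I p \<inter> I q) \<le> emeasure M (I p)" "emeasure M (I p \<inter> I q) \<le> emeasure M (I q)"
      by (intro emeasure_mono; simp)+
    then have "emeasure M (I p \<inter> I q) \<le> ennreal (min (s p * s p) (s q * s q))"
      using s(1)[of p] s(1)[of q] by (auto simp: min_def intro: order_trans)
    also have "min (s p * s p) (s q * s q) \<le> s p * s q"
      using s(2)[of p] s(2)[of q] mult_left_mono[of "s p" "s q" "s p"] mult_right_mono[of "s q" "s p" "s q"]
      by (cases "s p \<le> s q") (auto simp: min_le_iff_disj)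
    finally show ?thesis
      using s by (simp add: ennreal_mult ennreal_leI)
  qed
  have "(\<integral>\<^sup>+x. (\<integral>\<^sup>+p. a p * indicator (I p) x \<partial>count_space UNIV) *
      (\<integral>\<^sup>+p. a p * indicator (I p) x \<partial>count_space UNIV) \<partial>M) =
      (\<integral>\<^sup>+x. \<integral>\<^sup>+pq. a (fst pq) * indicator (I (fst pq)) x * (a (snd pq) * indicator (I (snd pq)) x) \<partial>count_space UNIV \<partial>M)"
    unfolding square ..
  also have "\<dots> = (\<integral>\<^sup>+pq. \<integral>\<^sup>+x. a (fst pq) * indicator (I (fst pq)) x * (a (snd pq) * indicator (I (snd pq)) x) \<partial>M \<partial>count_space UNIV)"
    by (rule nn_integral_count_space_nn_integral) auto
  also have "\<dots> = (\<integral>\<^sup>+pq. a (fst pq) * a (snd pq) * emeasure M (I (fst pq) \<inter> I (snd pq)) \<partial>count_space UNIV)"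
  proof (rule nn_integral_cong)
    fix pq :: "'i \<times> 'i"
    have "(\<integral>\<^sup>+x. a (fst pq) * indicator (I (fst pq)) x * (a (snd pq) * indicator (I (snd pq)) x) \<partial>M) =
        (\<integral>\<^sup>+x. a (fst pq) * a (snd pq) * indicator (I (fst pq) \<inter> I (snd pq)) x \<partial>M)"
      by (intro nn_integral_cong) (auto simp: indicator_def)
    then show "(\<integral>\<^sup>+x. a (fst pq) * indicator (I (fst pq)) x * (a (snd pq) * indicator (I (snd pq)) x) \<partial>M) =
        a (fst pq) * a (snd pq) * emeasure M (I (fst pq) \<inter> I (snd pq))"
      by (simp add: nn_integral_cmult_indicator)
  qed
  also have "\<dots> \<le> (\<integral>\<^sup>+pq. a (fst pq) * ennreal (s (fst pq)) * (a (snd pq) * ennreal (s (snd pq))) \<partial>count_space UNIV)"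
  proof (rule nn_integral_mono)
    fix pq :: "'i \<times> 'i"
    have "a (fst pq) * a (snd pq) * emeasure M (I (fst pq) \<inter> I (snd pq)) \<le>
        a (fst pq) * a (snd pq) * (ennreal (s (fst pq)) * ennreal (s (snd pq)))"
      by (intro mult_left_mono meas) auto
    then show "a (fst pq) * a (snd pq) * emeasure M (I (fst pq) \<inter> I (snd pq)) \<le>
        a (fst pq) * ennreal (s (fst pq)) * (a (snd pq) * ennreal (s (snd pq)))"
      by (simp add: mult_ac)
  qed
  also have "\<dots> = (\<integral>\<^sup>+p. a p * ennreal (s p) \<partial>count_space UNIV) * (\<integral>\<^sup>+p. a p * ennreal (s p) \<partial>count_space UNIV)"
    unfolding square ..
  finally show ?thesis .
qed

lemma borel_measurable_pair_fst_snd [measurable]: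
  "fst \<in> borel_measurable (borel :: (real \<times> real) measure)"
  "snd \<in> borel_measurable (borel :: (real \<times> real) measure)"
  by (auto intro!: borel_measurable_continuous_onI continuous_intros)

section \<open>Integral kernels of finite weighted mass\<close>
locale weighted_kernel =
  fixes H :: "real \<times> real \<Rightarrow> complex"
  assumes H_measurable [measurable]: "H \<in> borel_measurable borel"
    and H_integrable: "integrable lborel (\<lambda>z. cmod (H z) / \<bar>fst z - snd z\<bar>)"
begin

text \<open>
  In terms of the difference quotient \<open>H\<close> of order 1/2, the integrable quantity is \<open>weight\<close>, whereas \<open>pair_kernel\<close> is
  the difference of the underlying function between the two points.
\<close>
definition weight :: "real \<times> real \<Rightarrow> real" where
  "weight z = cmod (H z) / \<bar>fst z - snd z\<bar>"

definition pair_kernel :: "real \<times> real \<Rightarrow> complex" where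
  "pair_kernel z = H z * of_real (sqrt \<bar>fst z - snd z\<bar>)"

definition mass :: "(real \<times> real) set \<Rightarrow> real" where
  "mass Q = (LINT z|lborel. indicator Q z * weight z)"

lemma weight_nonneg [simp]: "0 \<le> weight z"
  by (simp add: weight_def)

lemma weight_measurable [measurable]: "weight \<in> borel_measurable borel"
  unfolding weight_def by measurable

lemma pair_kernel_measurable [measurable]: "pair_kernel \<in> borel_measurable borel"
  unfolding pair_kernel_def by measurable

lemma weight_integrable: "integrable lborel weight"
  using H_integrable by (simp add: weight_def[abs_def])

lemma indicator_weight_integrable:
  "Q \<in> sets borel \<Longrightarrow> integrable lborel (\<lambda>z. indicator Q z * weight z)"
  using integrable_mult_indicator[OF _ weight_integrable, of Q] by simp

lemma mass_nonneg: "0 \<le> mass Q"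
  unfolding mass_def by (intro integral_nonneg_AE) auto

lemma mass_le: "Q \<in> sets borel \<Longrightarrow> mass Q \<le> mass UNIV"
  unfolding mass_def by (intro integral_mono indicator_weight_integrable) (auto simp: indicator_def)

lemma cmod_kernel: "cmod (pair_kernel z) = weight z * (\<bar>fst z - snd z\<bar> * sqrt \<bar>fst z - snd z\<bar>)"
  by (cases "fst z = snd z") (auto simp: pair_kernel_def weight_def norm_mult)

lemma cmod_kernel_le:
  assumes "\<bar>fst z - snd z\<bar> \<le> L"
  shows "cmod (pair_kernel z) \<le> weight z * (L * sqrt L)"
  unfolding cmod_kernel using assms
  by (intro mult_left_mono mult_mono) auto

text \<open>
  Where \<open>\<bar>x - y\<bar> \<le> L\<close>, the kernel exceeds the weight by at most the factor \<open>L * sqrt L\<close>.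
\<close>
lemma kernel_pairing:
  assumes [measurable]: "a \<in> borel_measurable borel" "b \<in> borel_measurable borel"
    and Q: "Q \<in> sets borel" and "0 \<le> L" and L: "\<And>x y. a x * b y \<noteq> 0 \<Longrightarrow> (x, y) \<in> Q \<and> \<bar>x - y\<bar> \<le> L"
    and P: "\<And>x y. cmod (a x * b y) \<le> P"
  shows "integrable lborel (\<lambda>z. pair_kernel z * (a (fst z) * b (snd z)))"
    and "cmod (LINT z|lborel. pair_kernel z * (a (fst z) * b (snd z))) \<le> P * (L * sqrt L) * mass Q"
proof -
  have bound: "cmod (pair_kernel z * (a (fst z) * b (snd z))) \<le> P * (L * sqrt L) * (indicator Q z * weight z)" for z
  proof (cases "a (fst z) * b (snd z) = 0")
    case True
    have "0 \<le> P" using P[of 0 0] norm_ge_zero order_trans by blast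
    then have "0 \<le> P * (L * sqrt L) * (indicator Q z * weight z)" using \<open>0 \<le> L\<close> by simp
    then show ?thesis unfolding True by simp
  next
    case False
    then have z: "z \<in> Q" "\<bar>fst z - snd z\<bar> \<le> L" using L[of "fst z" "snd z"] by auto
    have "cmod (pair_kernel z * (a (fst z) * b (snd z))) \<le> weight z * (L * sqrt L) * P"
      unfolding norm_mult[of "pair_kernel z"]
      using z cmod_kernel_le P by (intro mult_mono) auto
    then show ?thesis using z by (simp add: mult_ac)
  qed
  have int: "integrable lborel (\<lambda>z. P * (L * sqrt L) * (indicator Q z * weight z))"
    by (intro integrable_mult_right indicator_weight_integrable Q)
  show int': "integrable lborel (\<lambda>z. pair_kernel z * (a (fst z) * b (snd z)))"
  proof (rule Bochner_Integration.integrable_bound[OF int])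
    show "(\<lambda>z. pair_kernel z * (a (fst z) * b (snd z))) \<in> borel_measurable lborel"
      by measurable
    show "AE z in lborel. cmod (pair_kernel z * (a (fst z) * b (snd z))) \<le> norm (P * (L * sqrt L) * (indicator Q z * weight z))"
      using bound by (intro AE_I2) (metis abs_ge_self order_trans real_norm_def)
  qed
  show "cmod (LINT z|lborel. pair_kernel z * (a (fst z) * b (snd z))) \<le> P * (L * sqrt L) * mass Q"
    using Bochner_Integration.integral_norm_bound_integral[OF int' int] bound by (simp add: mass_def)
qed

lemma kernel_slice_integrable:
  assumes \<psi>: "\<psi> \<in> test_functions" and [measurable]: "a \<in> borel_measurable borel"
    and B: "\<And>x. cmod (a x) \<le> B" and R: "\<And>x. \<bar>x\<bar> > R \<Longrightarrow> a x = 0"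
  shows "integrable lborel (\<lambda>z. pair_kernel z * (a (fst z) * \<psi> (snd z)))"
proof -
  have [measurable]: "\<psi> \<in> borel_measurable borel" using \<psi> by (rule test_function_measurable)
  obtain B' R' where B': "B' > 0" "\<And>x. cmod (\<psi> x) \<le> B'" and R': "R' > 0" "\<And>x. \<bar>x\<bar> > R' \<Longrightarrow> \<psi> x = 0"
    using test_function_bounded[OF \<psi>] by metis
  show ?thesis
  proof (rule kernel_pairing(1)[where Q = UNIV and L = "\<bar>R\<bar> + R'" and P = "B * B'"])
    show "(x, y) \<in> UNIV \<and> \<bar>x - y\<bar> \<le> \<bar>R\<bar> + R'" if "a x * \<psi> y \<noteq> 0" for x y
      using that R[of x] R'(2)[of y] by force
    show "cmod (a x * \<psi> y) \<le> B * B'" for x y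
      unfolding norm_mult using B B' norm_ge_zero order_trans by (intro mult_mono) blast+
  qed (use R' in auto)
qed

end

section \<open>Dyadic coefficients\<close>

text \<open>
  The assumption \<open>pairing\<close> expresses that \<open>w x - w y\<close> equals \<open>pair_kernel (x, y)\<close> off the
  diagonal, tested against products. Only test functions in a fixed order on the line occur, with \<open>\<phi>\<close> on
  the left.
\<close>
locale gradient_pairing = weighted_kernel +
  fixes w :: "(real \<Rightarrow> complex) \<Rightarrow> complex"
  assumes pairing: "\<And>\<phi> \<psi> q r. \<phi> \<in> test_functions \<Longrightarrow> \<psi> \<in> test_functions \<Longrightarrow>
      (\<And>x. x > q \<Longrightarrow> \<phi> x = 0) \<Longrightarrow> (\<And>x. x < r \<Longrightarrow> \<psi> x = 0) \<Longrightarrow> q < r \<Longrightarrow>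
      w \<phi> * (LINT x|lborel. \<psi> x) - w \<psi> * (LINT x|lborel. \<phi> x) =
      (LINT z|lborel. pair_kernel z * (\<phi> (fst z) * \<psi> (snd z)))"
begin

definition coeff :: "int \<Rightarrow> int \<Rightarrow> complex" where
  "coeff k j = w (\<lambda>x. complex_of_real (bump k j x))"

text \<open>
  The box contains all \<open>(x, y)\<close> with \<open>x\<close> in the bump of the interval \<open>(k, j)\<close> and \<open>y\<close> in the bump of
  its parent. The second pair of inequalities asks that the distance of the two points is in the octave starting
  at \<open>8 * 2 powi k\<close>. The name recalls that such boxes are as large as they are far from the diagonal.
\<close>
definition whitney_box :: "int \<Rightarrow> int \<Rightarrow> (real \<times> real) set" where
  "whitney_box k j = {z. 2 powi k * (of_int j + 10) \<le> fst z \<and> fst z < 2 powi k * (of_int j + 11) \<and>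
     8 * 2 powi k \<le> snd z - fst z \<and> snd z - fst z < 16 * 2 powi k}"

lemma whitney_box_borel [measurable]: "whitney_box k j \<in> sets borel"
proof -
  have "{z \<in> space (borel :: (real \<times> real) measure). 2 powi k * (of_int j + 10) \<le> fst z \<and> fst z < 2 powi k * (of_int j + 11) \<and>
     8 * 2 powi k \<le> snd z - fst z \<and> snd z - fst z < 16 * 2 powi k} \<in> sets borel"
    by measurable
  then show ?thesis by (simp add: whitney_box_def)
qed

text \<open>
  The octave of \<open>y - x\<close> determines \<open>k\<close>, and then the position of \<open>x\<close> determines \<open>j\<close>.
\<close>
lemma whitney_box_unique:
  assumes "z \<in> whitney_box k j" "z \<in> whitney_box k' j'" shows "k = k' \<and> j = j'"
proof -
  have less: False if z: "z \<in> whitney_box k j" "z \<in> whitney_box k' j'" and "k < k'" for k j k' j'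
  proof -
    have "16 * 2 powi k = 8 * (2::real) powi (k + 1)" by (simp add: power_int_add)
    also have "\<dots> \<le> 8 * 2 powi k'" using \<open>k < k'\<close> by (intro mult_left_mono power_int_increasing) auto
    finally show False using z by (simp add: whitney_box_def)
  qed
  have k: "k = k'" using less[OF assms] less[OF assms(2,1)] by (cases k k' rule: linorder_cases) auto
  have pos: "(0::real) < 2 powi k" by simp
  have "j' = j"
  proof -
    have "2 powi k * (real_of_int j + 10) < 2 powi k * (of_int j' + 11)"
      "2 powi k * (real_of_int j' + 10) < 2 powi k * (of_int j + 11)"
      using assms unfolding k whitney_box_def by (simp_all only: mem_Collect_eq) linarith+
    then have "real_of_int j + 10 < of_int j' + 11" "real_of_int j' + 10 < of_int j + 11"
      using pos mult_less_cancel_left_pos by blast+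
    then show ?thesis by linarith
  qed
  then show ?thesis using k by simp
qed

text \<open>
  The pairing identity for the two bumps. Their product is at most the square of \<open>bump_bound\<close> over
  \<open>2 * l * l\<close> with \<open>l = 2 powi k\<close>, and on the box the kernel is at most
  \<open>16 * l * sqrt (16 * l) = 64 * l * sqrt l\<close> times the weight. The index \<open>i\<close> may be the parent of \<open>j\<close>
  or, for odd \<open>j\<close>, the right neighbour of the parent; the second case connects the two sides of the origin, which have no
  common dyadic ancestor.
\<close>
lemma coeff_diff_le:
  assumes "j - 1 \<le> 2 * i" "2 * i \<le> j + 1"
  shows "cmod (coeff k j - coeff (k + 1) i) \<le> 32 * bump_bound\<^sup>2 / sqrt (2 powi k) * mass (whitney_box k j)"
proof -
  define l :: real where "l = 2 powi k"
  have l: "l > 0" by (simp add: l_def)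
  have l2: "2 powi (k + 1) = 2 * l" by (simp add: l_def power_int_add)
  have ij: "real_of_int j - 1 \<le> 2 * of_int i" "2 * real_of_int i \<le> of_int j + 1"
    using assms by linarith+
  let ?a = "\<lambda>x. complex_of_real (bump k j x)" and ?b = "\<lambda>x. complex_of_real (bump (k + 1) i x)"
  have a: "x \<in> {l * (of_int j + 10)<..<l * (of_int j + 11)}" if "bump k j x \<noteq> 0" for x
    using bump_eq_0[of x k j] that unfolding l_def by blast
  have b: "x \<in> {2 * l * (of_int i + 10)<..<2 * l * (of_int i + 11)}" if "bump (k + 1) i x \<noteq> 0" for x
    using bump_eq_0[of x "k + 1" i] that unfolding l2 by blast
  have lij: "l * real_of_int j - l \<le> 2 * (l * of_int i)" "2 * (l * of_int i) \<le> l * of_int j + l"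
    using mult_left_mono[OF ij(1), of l] mult_left_mono[OF ij(2), of l] l by (auto simp: algebra_simps)
  have "coeff k j - coeff (k + 1) i = w ?a * (LINT x|lborel. ?b x) - w ?b * (LINT x|lborel. ?a x)"
    unfolding coeff_def bump_integral by simp
  also have "\<dots> = (LINT z|lborel. pair_kernel z * (?a (fst z) * ?b (snd z)))"
  proof (rule pairing[where q = "l * (of_int j + 11)" and r = "2 * l * (of_int i + 10)"])
    show "l * (of_int j + 11) < 2 * l * (of_int i + 10)"
      using lij l by (simp add: algebra_simps)
    show "?a x = 0" if "l * (of_int j + 11) < x" for x using a[of x] that by force
    show "?b x = 0" if "x < 2 * l * (of_int i + 10)" for x using b[of x] that by force
  qed (rule bump_test_function)+
  also have "cmod \<dots> \<le> bump_bound / l * (bump_bound / (2 * l)) * (16 * l * sqrt (16 * l)) * mass (whitney_box k j)"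
  proof (rule kernel_pairing(2))
    show "cmod (?a x * ?b y) \<le> bump_bound / l * (bump_bound / (2 * l))" for x y
      using bump_le[of k j x] bump_le[of "k + 1" i y] bump_nonneg[of k j x] bump_nonneg[of "k + 1" i y]
      unfolding l2 l_def[symmetric] norm_mult by (intro mult_mono) (use bump_bound_pos l in auto)
    show "(x, y) \<in> whitney_box k j \<and> \<bar>x - y\<bar> \<le> 16 * l" if "?a x * ?b y \<noteq> 0" for x y
      using that a[of x] b[of y] lij l unfolding whitney_box_def l_def[symmetric] by (auto simp: algebra_simps)
  qed (use l in auto)
  also have "bump_bound / l * (bump_bound / (2 * l)) * (16 * l * sqrt (16 * l)) = 32 * bump_bound\<^sup>2 / sqrt l"
    using l real_sqrt_mult_self[of l] by (simp add: real_sqrt_mult field_simps power2_eq_square)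
  finally show ?thesis by (simp add: l_def)
qed

text \<open>
  A pair \<open>(k, j)\<close> stands for the dyadic interval \<open>cell (k, j)\<close>, whose parent is \<open>(k + 1, j div 2)\<close>.
\<close>
definition jump :: "int \<times> int \<Rightarrow> real" where
  "jump p = cmod (coeff (fst p) (snd p) - coeff (fst p + 1) (snd p div 2))"

definition cell :: "int \<times> int \<Rightarrow> real set" where
  "cell p = {x. \<lfloor>x / 2 powi fst p\<rfloor> = snd p}"

definition total_jump :: "real \<Rightarrow> ennreal" where
  "total_jump x = (\<integral>\<^sup>+p. ennreal (jump p) * indicator (cell p) x \<partial>count_space UNIV)"

lemma cell_eq: "cell (k, j) = {2 powi k * of_int j..<2 powi k * (of_int j + 1)}"
proof -
  have "(0::real) < 2 powi k" by simp
  then show ?thesis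
    by (auto simp: cell_def floor_eq_iff field_simps)
qed

lemma total_jump_measurable [measurable]: "total_jump \<in> borel_measurable borel"
proof -
  have [measurable]: "cell p \<in> sets borel" for p by (cases p) (simp add: cell_eq)
  show ?thesis
    unfolding total_jump_def[abs_def] by (intro borel_measurable_nn_integral_count_space) measurable
qed

lemma emeasure_density_weight:
  assumes [measurable]: "Q \<in> sets borel"
  shows "emeasure (density lborel (\<lambda>z. ennreal (weight z))) Q = ennreal (mass Q)"
proof -
  have "emeasure (density lborel (\<lambda>z. ennreal (weight z))) Q = (\<integral>\<^sup>+z. ennreal (weight z) * indicator Q z \<partial>lborel)"
    by (rule emeasure_density) auto
  also have "\<dots> = (\<integral>\<^sup>+z. ennreal (indicator Q z * weight z) \<partial>lborel)"
    by (intro nn_integral_cong) (auto simp: indicator_def)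
  also have "\<dots> = ennreal (mass Q)"
    unfolding mass_def by (intro nn_integral_eq_integral indicator_weight_integrable) auto
  finally show ?thesis .
qed

text \<open>
  Since the boxes are disjoint, the masses in \<open>coeff_diff_le\<close> add up to at most the total mass.
\<close>
lemma sum_jump_le:
  "(\<integral>\<^sup>+p. ennreal (jump p) * ennreal (sqrt (2 powi fst p)) \<partial>count_space UNIV)
    \<le> ennreal (32 * bump_bound\<^sup>2 * mass UNIV)"
proof -
  let ?\<mu> = "density lborel (\<lambda>z. ennreal (weight z))"
  let ?box = "\<lambda>p. whitney_box (fst p) (snd p)"
  have "(\<integral>\<^sup>+p. ennreal (jump p) * ennreal (sqrt (2 powi fst p)) \<partial>count_space UNIV) \<le>
      (\<integral>\<^sup>+p. ennreal (32 * bump_bound\<^sup>2) * emeasure ?\<mu> (?box p) \<partial>count_space UNIV)"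
  proof (rule nn_integral_mono)
    fix p :: "int \<times> int"
    have "jump p \<le> 32 * bump_bound\<^sup>2 / sqrt (2 powi fst p) * mass (?box p)"
      unfolding jump_def by (rule coeff_diff_le) presburger+
    then have "jump p * sqrt (2 powi fst p) \<le> 32 * bump_bound\<^sup>2 / sqrt (2 powi fst p) * mass (?box p) * sqrt (2 powi fst p)"
      by (intro mult_right_mono) auto
    then have "jump p * sqrt (2 powi fst p) \<le> 32 * bump_bound\<^sup>2 * mass (?box p)"
      by (simp add: field_simps)
    then have "ennreal (jump p * sqrt (2 powi fst p)) \<le> ennreal (32 * bump_bound\<^sup>2 * mass (?box p))"
      by (rule ennreal_leI)
    then show "ennreal (jump p) * ennreal (sqrt (2 powi fst p)) \<le> ennreal (32 * bump_bound\<^sup>2) * emeasure ?\<mu> (?box p)"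
      by (simp add: emeasure_density_weight ennreal_mult' jump_def mass_nonneg)
  qed
  also have "\<dots> = ennreal (32 * bump_bound\<^sup>2) * (\<integral>\<^sup>+p. emeasure ?\<mu> (?box p) \<partial>count_space UNIV)"
    by (simp add: nn_integral_cmult)
  also have "(\<integral>\<^sup>+p. emeasure ?\<mu> (?box p) \<partial>count_space UNIV) = emeasure ?\<mu> (\<Union>p. ?box p)"
  proof (rule emeasure_UN_countable[symmetric])
    have "p = q" if "z \<in> ?box p" "z \<in> ?box q" for p q z
      using whitney_box_unique[OF that] by (simp add: prod_eq_iff)
    then show "disjoint_family_on ?box UNIV"
      unfolding disjoint_family_on_def by blast
  qed auto
  also have "\<dots> \<le> emeasure ?\<mu> UNIV"
    by (intro emeasure_mono) auto
  also have "\<dots> = ennreal (mass UNIV)"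
    by (simp add: emeasure_density_weight)
  finally show ?thesis
    by (simp add: ennreal_mult' mult_left_mono mass_nonneg)
qed

lemma total_jump_square_le:
  "(\<integral>\<^sup>+x. total_jump x * total_jump x \<partial>lborel) \<le> ennreal ((32 * bump_bound\<^sup>2 * mass UNIV)\<^sup>2)"
proof -
  have "(\<integral>\<^sup>+x. total_jump x * total_jump x \<partial>lborel) \<le>
      (\<integral>\<^sup>+p. ennreal (jump p) * ennreal (sqrt (2 powi fst p)) \<partial>count_space UNIV) *
      (\<integral>\<^sup>+p. ennreal (jump p) * ennreal (sqrt (2 powi fst p)) \<partial>count_space UNIV)"
    unfolding total_jump_def
  proof (rule nn_integral_square_step_sum_le)
    fix p :: "int \<times> int"
    obtain k j where p: "p = (k, j)" by force
    show "cell p \<in> sets lborel" by (simp add: p cell_eq)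
    show "emeasure lborel (cell p) \<le> ennreal (sqrt (2 powi fst p) * sqrt (2 powi fst p))"
      unfolding p cell_eq by (subst emeasure_lborel_Ico) (auto simp: algebra_simps)
  qed simp
  also have "\<dots> \<le> ennreal (32 * bump_bound\<^sup>2 * mass UNIV) * ennreal (32 * bump_bound\<^sup>2 * mass UNIV)"
    by (intro mult_mono sum_jump_le) auto
  also have "\<dots> = ennreal ((32 * bump_bound\<^sup>2 * mass UNIV)\<^sup>2)"
    unfolding power2_eq_square[of "32 * bump_bound\<^sup>2 * mass UNIV"]
    by (rule ennreal_mult[symmetric]) (simp_all add: mass_nonneg)
  finally show ?thesis .
qed

end

section \<open>Limits at fine and coarse scales\<close>
context gradient_pairing begin

definition approx :: "int \<Rightarrow> real \<Rightarrow> complex" where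
  "approx k x = coeff k \<lfloor>x / 2 powi k\<rfloor>"

lemma approx_measurable [measurable]: "approx k \<in> borel_measurable borel"
  unfolding approx_def by measurable

lemma cmod_approx_diff: "cmod (approx k x - approx (k + 1) x) = jump (k, \<lfloor>x / 2 powi k\<rfloor>)"
proof -
  have "x / 2 powi (k + 1) = x / 2 powi k / real_of_int 2"
    by (simp add: power_int_add)
  then have "\<lfloor>x / 2 powi (k + 1)\<rfloor> = \<lfloor>x / 2 powi k\<rfloor> div 2"
    using floor_divide_real_eq_div[of 2 "x / 2 powi k"] by presburger
  then show ?thesis
    unfolding approx_def jump_def fst_conv snd_conv by simp
qed

text \<open>
  At a given point the scales \<open>k\<close> in \<open>F\<close> contribute one cell each, and \<open>total_jump\<close> sums over all cells
  that contain the point.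
\<close>
lemma sum_approx_diff_le:
  assumes "finite F"
  shows "ennreal (\<Sum>k\<in>F. cmod (approx k x - approx (k + 1) x)) \<le> total_jump x"
proof -
  let ?p = "\<lambda>k. (k, \<lfloor>x / 2 powi k\<rfloor>)"
  have "ennreal (\<Sum>k\<in>F. cmod (approx k x - approx (k + 1) x)) = (\<Sum>k\<in>F. ennreal (jump (?p k)) * indicator (cell (?p k)) x)"
    unfolding cmod_approx_diff by (subst sum_ennreal[symmetric]) (auto simp: jump_def cell_def)
  also have "\<dots> = (\<Sum>p\<in>?p ` F. ennreal (jump p) * indicator (cell p) x)"
    by (subst sum.reindex) (auto simp: inj_on_def)
  also have "\<dots> \<le> total_jump x"
    unfolding total_jump_def using assms by (intro sum_le_nn_integral_count_space) simp
  finally show ?thesis .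
qed

lemma approx_diff_le:
  assumes "k \<le> m"
  shows "ennreal (cmod (approx k x - approx m x)) \<le> total_jump x"
proof -
  have "cmod (approx k x - approx m x) \<le> (\<Sum>i\<in>{k..<m}. cmod (approx i x - approx (i + 1) x))"
    using assms
  proof (induction m rule: int_ge_induct)
    case (step m)
    have "cmod (approx k x - approx (m + 1) x) \<le> cmod (approx k x - approx m x) + cmod (approx m x - approx (m + 1) x)"
      using norm_triangle_ineq[of "approx k x - approx m x" "approx m x - approx (m + 1) x"] by simp
    also have "\<dots> \<le> (\<Sum>i\<in>{k..<m}. cmod (approx i x - approx (i + 1) x)) + cmod (approx m x - approx (m + 1) x)"
      using step by simp
    also have "\<dots> = (\<Sum>i\<in>insert m {k..<m}. cmod (approx i x - approx (i + 1) x))"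
      by (subst sum.insert) auto
    also have "insert m {k..<m} = {k..<m + 1}" using step by auto
    finally show ?case .
  qed simp
  then show ?thesis
    using sum_approx_diff_le[of "{k..<m}" x] ennreal_leI order_trans by blast
qed

definition limit_const :: complex where
  "limit_const = lim (\<lambda>n. coeff (int n) 0)"

text \<open>
  Every point lies in one of the cells with \<open>j = 0\<close> or \<open>j = -1\<close> once the scale is coarse enough. Both
  coefficients are compared with the coefficient of \<open>j = 0\<close> at the next scale, and the errors decay
  geometrically.
\<close>
lemma coeff_tendsto:
  "(\<lambda>n. coeff (int n) 0) \<longlonglongrightarrow> limit_const" "(\<lambda>n. coeff (int n) (- 1)) \<longlonglongrightarrow> limit_const"
proof -
  let ?b = "\<lambda>n. 32 * bump_bound\<^sup>2 * mass UNIV * (1 / sqrt 2) ^ n"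
  have bound: "cmod (coeff (int n) j - coeff (int n + 1) 0) \<le> ?b n" if "j \<in> {0, -1}" for n j
  proof -
    have "cmod (coeff (int n) j - coeff (int n + 1) 0) \<le> 32 * bump_bound\<^sup>2 / sqrt (2 powi int n) * mass (whitney_box (int n) j)"
      by (rule coeff_diff_le) (use that in auto)
    also have "\<dots> \<le> 32 * bump_bound\<^sup>2 / sqrt (2 powi int n) * mass UNIV"
      by (intro mult_left_mono mass_le) auto
    also have "\<dots> = ?b n"
      by (simp add: real_sqrt_power power_one_over field_simps)
    finally show ?thesis .
  qed
  have "summable ?b"
    by (intro summable_mult summable_geometric) (simp add: real_less_rsqrt)
  then have b0: "?b \<longlonglongrightarrow> 0" by (rule summable_LIMSEQ_zero)
  have "summable (\<lambda>n. coeff (int (Suc n)) 0 - coeff (int n) 0)"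
  proof (rule summable_comparison_test'[OF \<open>summable ?b\<close>])
    show "norm (coeff (int (Suc n)) 0 - coeff (int n) 0) \<le> ?b n" for n
      using bound[of 0 n] by (simp add: norm_minus_commute add.commute)
  qed
  then have "convergent (\<lambda>n. \<Sum>i<n. coeff (int (Suc i)) 0 - coeff (int i) 0)"
    by (simp add: summable_iff_convergent)
  then have "convergent (\<lambda>n. coeff (int n) 0 - coeff (int 0) 0)"
    by (subst (asm) sum_lessThan_telescope)
  then have "convergent (\<lambda>n. coeff (int n) 0)"
    by (simp add: convergent_diff_const_right_iff)
  then show *: "(\<lambda>n. coeff (int n) 0) \<longlonglongrightarrow> limit_const"
    unfolding limit_const_def by (simp add: convergent_LIMSEQ_iff)
  then have "(\<lambda>n. coeff (int n + 1) 0) \<longlonglongrightarrow> limit_const"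
    using LIMSEQ_Suc[OF *] by (simp add: add.commute)
  moreover have "(\<lambda>n. coeff (int n) (- 1) - coeff (int n + 1) 0) \<longlonglongrightarrow> 0"
    by (rule Lim_null_comparison[OF _ b0]) (use bound[of "-1"] in auto)
  ultimately show "(\<lambda>n. coeff (int n) (- 1)) \<longlonglongrightarrow> limit_const"
    using tendsto_add by fastforce
qed

lemma approx_tendsto_limit_const: "(\<lambda>n. approx (int n) x) \<longlonglongrightarrow> limit_const"
proof -
  have lim: "(\<lambda>n. cmod (coeff (int n) 0 - limit_const) + cmod (coeff (int n) (- 1) - limit_const)) \<longlonglongrightarrow> 0"
    using tendsto_add[OF tendsto_norm_zero tendsto_norm_zero, OF LIM_zero LIM_zero, OF coeff_tendsto]
    by simp
  obtain n0 :: nat where n0: "\<bar>x\<bar> < real n0" using reals_Archimedean2 by blast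
  have "\<forall>\<^sub>F n in sequentially. norm (approx (int n) x - limit_const) \<le>
      cmod (coeff (int n) 0 - limit_const) + cmod (coeff (int n) (- 1) - limit_const)"
    using eventually_ge_at_top[of n0]
  proof eventually_elim
    case (elim n)
    have "real n < 2 ^ n" by (rule of_nat_less_two_power)
    then have x: "\<bar>x\<bar> < 2 ^ n" using n0 elim by linarith
    then have "-1 \<le> x / 2 ^ n" "x / 2 ^ n < 1" by (auto simp: field_simps)
    then have "\<lfloor>x / 2 ^ n\<rfloor> = 0 \<or> \<lfloor>x / 2 ^ n\<rfloor> = - 1" by linarith
    then show ?case by (auto simp: approx_def)
  qed
  then have "(\<lambda>n. approx (int n) x - limit_const) \<longlonglongrightarrow> 0"
    using lim by (rule Lim_null_comparison)
  then show ?thesis by (rule LIM_zero_cancel)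
qed

definition limit_fun :: "real \<Rightarrow> complex" where
  "limit_fun x = lim (\<lambda>n. approx (- int n) x)"

lemma limit_fun_measurable [measurable]: "limit_fun \<in> borel_measurable borel"
  unfolding limit_fun_def by (rule borel_measurable_lim_metric) measurable

text \<open>
  A finite \<open>total_jump\<close> makes the telescoping series of the approximations absolutely convergent.
\<close>
lemma approx_tendsto_limit_fun:
  assumes "total_jump x < \<infinity>"
  shows "(\<lambda>n. approx (- int n) x) \<longlonglongrightarrow> limit_fun x"
proof -
  let ?d = "\<lambda>n. approx (- int (Suc n)) x - approx (- int n) x"
  have "summable (\<lambda>n. cmod (?d n))"
  proof (rule summableI_nonneg_bounded)
    fix n
    have "(\<Sum>i<n. cmod (?d i)) = (\<Sum>k\<in>(\<lambda>i. - int (Suc i)) ` {..<n}. cmod (approx k x - approx (k + 1) x))"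
      by (subst sum.reindex) (auto simp: inj_on_def)
    then have "ennreal (\<Sum>i<n. cmod (?d i)) \<le> total_jump x"
      using sum_approx_diff_le[of "(\<lambda>i. - int (Suc i)) ` {..<n}" x] by simp
    then show "(\<Sum>i<n. cmod (?d i)) \<le> enn2real (total_jump x)"
      using assms by (cases "total_jump x") (auto simp: ennreal_le_iff sum_nonneg)
  qed auto
  then have "summable ?d" by (rule summable_norm_cancel)
  then have "convergent (\<lambda>n. \<Sum>i<n. ?d i)"
    by (simp add: summable_iff_convergent)
  then have "convergent (\<lambda>n. approx (- int n) x - approx (- int 0) x)"
    by (subst (asm) sum_lessThan_telescope)
  then have "convergent (\<lambda>n. approx (- int n) x)"
    by (simp add: convergent_diff_const_right_iff)
  then show ?thesis
    unfolding limit_fun_def by (simp add: convergent_LIMSEQ_iff)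
qed

lemma limit_fun_diff_le:
  assumes "total_jump x < \<infinity>"
  shows "ennreal (cmod (limit_fun x - limit_const)) \<le> total_jump x"
proof (rule Lim_bounded[of _ _ 0])
  show "(\<lambda>n. ennreal (cmod (approx (- int n) x - approx (int n) x))) \<longlonglongrightarrow> ennreal (cmod (limit_fun x - limit_const))"
    by (intro tendsto_ennrealI tendsto_norm tendsto_diff approx_tendsto_limit_fun
        approx_tendsto_limit_const assms)
  show "\<forall>n\<ge>0. ennreal (cmod (approx (- int n) x - approx (int n) x)) \<le> total_jump x"
    by (auto intro!: approx_diff_le)
qed

lemma AE_total_jump_finite: "AE x in lborel. total_jump x < \<infinity>"
proof -
  have "(\<integral>\<^sup>+x. total_jump x * total_jump x \<partial>lborel) \<noteq> \<infinity>"
    using total_jump_square_le by (auto simp: top_unique)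
  then have "AE x in lborel. total_jump x * total_jump x \<noteq> \<infinity>"
    by (intro nn_integral_PInf_AE) auto
  then show ?thesis
    by eventually_elim (auto simp: less_top ennreal_mult_eq_top_iff)
qed

lemma limit_fun_L2:
  shows "integrable lborel (\<lambda>x. (cmod (limit_fun x - limit_const))\<^sup>2)"
    and "(LINT x|lborel. (cmod (limit_fun x - limit_const))\<^sup>2) \<le> (32 * bump_bound\<^sup>2 * mass UNIV)\<^sup>2"
proof -
  have "(\<integral>\<^sup>+x. ennreal ((cmod (limit_fun x - limit_const))\<^sup>2) \<partial>lborel) \<le> (\<integral>\<^sup>+x. total_jump x * total_jump x \<partial>lborel)"
  proof (rule nn_integral_mono_AE)
    show "AE x in lborel. ennreal ((cmod (limit_fun x - limit_const))\<^sup>2) \<le> total_jump x * total_jump x"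
      using AE_total_jump_finite
    proof eventually_elim
      case (elim x)
      then show ?case
        using mult_mono[OF limit_fun_diff_le limit_fun_diff_le, of x x]
        by (simp add: power2_eq_square ennreal_mult)
    qed
  qed
  then have le: "(\<integral>\<^sup>+x. ennreal ((cmod (limit_fun x - limit_const))\<^sup>2) \<partial>lborel) \<le> ennreal ((32 * bump_bound\<^sup>2 * mass UNIV)\<^sup>2)"
    using total_jump_square_le by (rule order_trans)
  then show int: "integrable lborel (\<lambda>x. (cmod (limit_fun x - limit_const))\<^sup>2)"
    using le_less_trans[OF le ennreal_less_top] by (intro integrableI_nonneg) auto
  show "(LINT x|lborel. (cmod (limit_fun x - limit_const))\<^sup>2) \<le> (32 * bump_bound\<^sup>2 * mass UNIV)\<^sup>2"
    using le by (subst (asm) nn_integral_eq_integral[OF int]) (auto simp: ennreal_le_iff)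
qed

section \<open>The distribution as a function\<close>

text \<open>
  By the pairing identity this function represents \<open>w\<close> to the left of the support of \<open>\<psi>\<close>, for a \<open>\<psi>\<close>
  of integral 1.
\<close>
definition left_density :: "(real \<Rightarrow> complex) \<Rightarrow> real \<Rightarrow> complex" where
  "left_density \<psi> x = w \<psi> + (LINT y|lborel. pair_kernel (x, y) * \<psi> y)"

lemma left_density_set_integrable:
  assumes \<psi>: "\<psi> \<in> test_functions"
  shows "set_integrable lborel {a..b} (left_density \<psi>)"
proof -
  let ?i = "\<lambda>x. indicator {a..b} x :: complex"
  have "integrable (lborel \<Otimes>\<^sub>M lborel) (\<lambda>z. pair_kernel z * (?i (fst z) * \<psi> (snd z)))"
    unfolding lborel_prod
    by (rule kernel_slice_integrable[OF \<psi>, where B = 1 and R = "max \<bar>a\<bar> \<bar>b\<bar>"]) (auto simp: indicator_def)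
  from lborel_pair.integrable_fst'[OF this]
  have "integrable lborel (\<lambda>x. LINT y|lborel. ?i x * (pair_kernel (x, y) * \<psi> y))"
    by (simp add: mult_ac)
  then have "integrable lborel (\<lambda>x. ?i x * (LINT y|lborel. pair_kernel (x, y) * \<psi> y))"
    by simp
  moreover have "integrable lborel (\<lambda>x. ?i x * w \<psi>)"
    by (intro integrable_mult_left bounded_support_integrable[where B = 1 and R = "max \<bar>a\<bar> \<bar>b\<bar>"])
      (auto simp: indicator_def)
  ultimately have "integrable lborel (\<lambda>x. ?i x * w \<psi> + ?i x * (LINT y|lborel. pair_kernel (x, y) * \<psi> y))"
    by (rule Bochner_Integration.integrable_add[rotated])
  moreover have "(\<lambda>x. ?i x * w \<psi> + ?i x * (LINT y|lborel. pair_kernel (x, y) * \<psi> y)) =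
      (\<lambda>x. indicator {a..b} x *\<^sub>R left_density \<psi> x)"
    by (auto simp: left_density_def indicator_def)
  ultimately show ?thesis
    by (simp add: set_integrable_def)
qed

lemma w_eq_left_density:
  assumes \<phi>: "\<phi> \<in> test_functions" and \<psi>: "\<psi> \<in> test_functions"
    and "\<And>x. x > q \<Longrightarrow> \<phi> x = 0" "\<And>x. x < r \<Longrightarrow> \<psi> x = 0" "q < r"
    and \<psi>1: "(LINT x|lborel. \<psi> x) = 1"
  shows "w \<phi> = (LINT x|lborel. \<phi> x * left_density \<psi> x)"
proof -
  obtain B R where B: "\<And>x. cmod (\<phi> x) \<le> B" and R: "\<And>x. \<bar>x\<bar> > R \<Longrightarrow> \<phi> x = 0"
    using test_function_bounded[OF \<phi>] by metis
  have int: "integrable (lborel \<Otimes>\<^sub>M lborel) (\<lambda>z. pair_kernel z * (\<phi> (fst z) * \<psi> (snd z)))"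
    unfolding lborel_prod using \<phi> by (intro kernel_slice_integrable[OF \<psi> _ B R] test_function_measurable)
  have eq: "(LINT y|lborel. pair_kernel (x, y) * (\<phi> x * \<psi> y)) = \<phi> x * (LINT y|lborel. pair_kernel (x, y) * \<psi> y)" for x
  proof -
    have "(LINT y|lborel. pair_kernel (x, y) * (\<phi> x * \<psi> y)) = (LINT y|lborel. \<phi> x * (pair_kernel (x, y) * \<psi> y))"
      by (simp add: mult_ac)
    then show ?thesis by simp
  qed
  have "w \<phi> - w \<psi> * (LINT x|lborel. \<phi> x) = (LINT z|lborel. pair_kernel z * (\<phi> (fst z) * \<psi> (snd z)))"
    using pairing[OF assms(1-5)] \<psi>1 by simp
  also have "\<dots> = (LINT x|lborel. \<phi> x * (LINT y|lborel. pair_kernel (x, y) * \<psi> y))"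
    using lborel_pair.integral_fst'[OF int] by (simp add: lborel_prod eq)
  finally have "w \<phi> = (LINT x|lborel. \<phi> x * (LINT y|lborel. pair_kernel (x, y) * \<psi> y)) + (LINT x|lborel. \<phi> x * w \<psi>)"
    by (simp add: algebra_simps)
  also have "\<dots> = (LINT x|lborel. \<phi> x * left_density \<psi> x)"
    using lborel_pair.integrable_fst'[OF int] test_function_integrable[OF \<phi>]
    by (subst Bochner_Integration.integral_add[symmetric]) (auto simp: eq left_density_def algebra_simps)
  finally show ?thesis .
qed

text \<open>
  To the left of both supports the two densities represent the same distribution.
\<close>
lemma left_density_AE_unique:
  assumes \<psi>: "\<psi> \<in> test_functions" "\<And>x. x < r \<Longrightarrow> \<psi> x = 0" "(LINT x|lborel. \<psi> x) = 1"
    and \<psi>': "\<psi>' \<in> test_functions" "\<And>x. x < r \<Longrightarrow> \<psi>' x = 0" "(LINT x|lborel. \<psi>' x) = 1"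
  shows "AE x in lborel. x < r \<longrightarrow> left_density \<psi> x = left_density \<psi>' x"
proof -
  have "AE x in lborel. x < r \<longrightarrow> left_density \<psi> x - left_density \<psi>' x = 0"
  proof (rule fundamental_lemma_left_of)
    show "set_integrable lborel {a..b} (\<lambda>x. left_density \<psi> x - left_density \<psi>' x)" for a b
      by (intro set_integral_diff(1) left_density_set_integrable \<psi> \<psi>')
    fix \<phi> q assume \<phi>: "\<phi> \<in> test_functions" "q < r" "\<And>x. x > q \<Longrightarrow> \<phi> x = 0"
    have "(LINT x|lborel. \<phi> x * (left_density \<psi> x - left_density \<psi>' x)) = (LINT x|lborel. \<phi> x * left_density \<psi> x) - (LINT x|lborel. \<phi> x * left_density \<psi>' x)"
      unfolding right_diff_distrib
      by (intro Bochner_Integration.integral_diff test_function_mult_integrable left_density_set_integrable \<phi> \<psi> \<psi>')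
    also have "\<dots> = w \<phi> - w \<phi>"
      using w_eq_left_density[OF \<phi>(1) \<psi>(1) \<phi>(3) \<psi>(2) \<phi>(2) \<psi>(3)] w_eq_left_density[OF \<phi>(1) \<psi>'(1) \<phi>(3) \<psi>'(2) \<phi>(2) \<psi>'(3)]
      by simp
    finally show "(LINT x|lborel. \<phi> x * (left_density \<psi> x - left_density \<psi>' x)) = 0" by simp
  qed
  then show ?thesis by simp
qed

text \<open>
  The point \<open>x\<close> and the bump of its own cell are at most \<open>11 * 2 powi k\<close> apart. The looser bound
  \<open>16 * 2 powi k\<close> has an exact square root.
\<close>
lemma left_density_bump_diff_le:
  fixes x :: real
  assumes int: "integrable lborel (\<lambda>y. weight (x, y))" and j: "j = \<lfloor>x / 2 powi k\<rfloor>"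
  shows "cmod (left_density (\<lambda>y. complex_of_real (bump k j y)) x - approx k x)
    \<le> 64 * bump_bound * sqrt (2 powi k) * (LINT y|lborel. weight (x, y))"
proof -
  define l :: real where "l = 2 powi k"
  have l: "l > 0" by (simp add: l_def)
  have "x \<in> cell (k, j)" by (simp add: cell_def j)
  then have x: "l * of_int j \<le> x" "x < l * (of_int j + 1)"
    unfolding cell_eq l_def by auto
  have bound: "cmod (pair_kernel (x, y) * complex_of_real (bump k j y)) \<le> 64 * bump_bound * sqrt l * weight (x, y)" for y
  proof (cases "bump k j y = 0")
    case False
    then have y: "l * (of_int j + 10) < y" "y < l * (of_int j + 11)"
      using bump_eq_0[of y k j] unfolding l_def by auto
    have "\<bar>fst (x, y) - snd (x, y)\<bar> \<le> 16 * l"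
      using x y l by (auto simp: algebra_simps)
    then have "cmod (pair_kernel (x, y)) \<le> weight (x, y) * (16 * l * sqrt (16 * l))"
      by (rule cmod_kernel_le)
    then have "cmod (pair_kernel (x, y) * complex_of_real (bump k j y)) \<le> weight (x, y) * (16 * l * sqrt (16 * l)) * (bump_bound / l)"
      unfolding norm_mult using bump_le[of k j y] bump_nonneg[of k j y] l
      by (intro mult_mono) (auto simp: l_def)
    also have "\<dots> = 64 * bump_bound * sqrt l * weight (x, y)"
      using l by (simp add: real_sqrt_mult)
    finally show ?thesis .
  qed (use bump_bound_pos l in auto)
  have int': "integrable lborel (\<lambda>y. 64 * bump_bound * sqrt l * weight (x, y))"
    by (intro integrable_mult_right int)
  have "integrable lborel (\<lambda>y. pair_kernel (x, y) * complex_of_real (bump k j y))"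
    by (rule Bochner_Integration.integrable_bound[OF int'])
      (use bound in \<open>auto intro: order_trans[OF bound abs_ge_self]\<close>)
  from Bochner_Integration.integral_norm_bound_integral[OF this int' bound]
  have "cmod (LINT y|lborel. pair_kernel (x, y) * complex_of_real (bump k j y)) \<le> 64 * bump_bound * sqrt l * (LINT y|lborel. weight (x, y))"
    by simp
  then show ?thesis
    by (simp add: left_density_def approx_def coeff_def j l_def)
qed

text \<open>
  Almost everywhere the density of one fixed bump agrees with the densities of all bumps further to the right
  of \<open>x\<close>, in particular with those of the shrinking cells that contain \<open>x\<close>; these differ from
  \<open>approx\<close> by an error that tends to \<open>0\<close>. Taking \<open>n\<close> large covers any bounded set.
\<close>
lemma left_density_bump_AE_eq_limit_fun:
  "AE x in lborel. x < 10 * 2 ^ n \<longrightarrow> left_density (\<lambda>y. complex_of_real (bump (int n) 0 y)) x = limit_fun x"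
proof -
  let ?b = "\<lambda>k j y. complex_of_real (bump k j y)"
  have "AE x in lborel. x < min (10 * 2 ^ n) (2 powi k * (of_int j + 10)) \<longrightarrow> left_density (?b (int n) 0) x = left_density (?b k j) x" for k j
  proof (rule left_density_AE_unique)
    show "?b (int n) 0 x = 0" if "x < min (10 * 2 ^ n) (2 powi k * (of_int j + 10))" for x
      using that bump_eq_0[of x "int n" 0] by (auto simp: mult.commute)
    show "?b k j x = 0" if "x < min (10 * 2 ^ n) (2 powi k * (of_int j + 10))" for x
      using that bump_eq_0[of x k j] by auto
  qed (rule bump_test_function bump_integral)+
  then have "AE x in lborel. \<forall>k j. x < min (10 * 2 ^ n) (2 powi k * (of_int j + 10)) \<longrightarrow> left_density (?b (int n) 0) x = left_density (?b k j) x"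
    by (simp add: AE_all_countable)
  moreover have "AE x in lborel. integrable lborel (\<lambda>y. weight (x, y))"
    using weight_integrable unfolding lborel_prod[symmetric] by (rule lborel_pair.AE_integrable_fst')
  ultimately show ?thesis
    using AE_total_jump_finite
  proof eventually_elim
    case (elim x)
    show ?case
    proof
      assume x: "x < 10 * 2 ^ n"
      let ?c = "64 * bump_bound * (LINT y|lborel. weight (x, y))"
      have le: "norm (left_density (?b (int n) 0) x - approx (- int m) x) \<le> ?c * (1 / sqrt 2) ^ m" for m
      proof -
        define k where "k = - int m"
        define j where "j = \<lfloor>x / 2 powi k\<rfloor>"
        have "x \<in> cell (k, j)" by (simp add: cell_def j_def)
        moreover have "(0::real) < 2 powi k" by simp
        ultimately have "x < 2 powi k * (of_int j + 10)"
          unfolding cell_eq by (auto simp: algebra_simps)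
        then have "left_density (?b (int n) 0) x = left_density (?b k j) x"
          using elim(1) x by auto
        then have "norm (left_density (?b (int n) 0) x - approx k x) \<le> 64 * bump_bound * sqrt (2 powi k) * (LINT y|lborel. weight (x, y))"
          using left_density_bump_diff_le[OF elim(2) j_def] by simp
        moreover have "sqrt (2 powi k) = (1 / sqrt 2) ^ m"
          by (simp add: k_def power_int_minus real_sqrt_inverse real_sqrt_power real_sqrt_divide power_one_over inverse_eq_divide)
        ultimately show ?thesis by (simp add: k_def mult_ac)
      qed
      have "(\<lambda>m. (1 / sqrt 2) ^ m) \<longlonglongrightarrow> (0 :: real)"
        by (rule LIMSEQ_realpow_zero) (auto simp: real_less_rsqrt)
      then have "(\<lambda>m. ?c * (1 / sqrt 2) ^ m) \<longlonglongrightarrow> 0"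
        by (rule tendsto_mult_right_zero)
      with always_eventually[OF allI[OF le]]
      have "(\<lambda>m. left_density (?b (int n) 0) x - approx (- int m) x) \<longlonglongrightarrow> 0"
        by (rule Lim_null_comparison)
      from tendsto_diff[OF tendsto_const[of "left_density (?b (int n) 0) x"] this]
      have "(\<lambda>m. approx (- int m) x) \<longlonglongrightarrow> left_density (?b (int n) 0) x" by simp
      then show "left_density (?b (int n) 0) x = limit_fun x"
        using approx_tendsto_limit_fun[OF elim(3)] LIMSEQ_unique by blast
    qed
  qed
qed

lemma w_eq_limit_fun:
  assumes \<phi>: "\<phi> \<in> test_functions"
  shows "w \<phi> = (LINT x|lborel. \<phi> x * limit_fun x)"
proof -
  obtain B R where R: "R > 0" "\<And>x. \<bar>x\<bar> > R \<Longrightarrow> \<phi> x = 0"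
    using test_function_bounded[OF \<phi>] by metis
  obtain n :: nat where "R < real n" using reals_Archimedean2 by blast
  also have "real n < 2 ^ n" by (rule of_nat_less_two_power)
  finally have n: "R < 10 * 2 ^ n" using R by simp
  let ?\<psi> = "\<lambda>y. complex_of_real (bump (int n) 0 y)"
  have [measurable]: "\<phi> \<in> borel_measurable borel" using \<phi> by (rule test_function_measurable)
  have int: "integrable lborel (\<lambda>x. \<phi> x * left_density ?\<psi> x)"
    by (intro test_function_mult_integrable \<phi> left_density_set_integrable bump_test_function)
  have "w \<phi> = (LINT x|lborel. \<phi> x * left_density ?\<psi> x)"
  proof (rule w_eq_left_density[OF \<phi> bump_test_function _ _ n bump_integral])
    show "?\<psi> x = 0" if "x < 10 * 2 ^ n" for x
      using that bump_eq_0[of x "int n" 0] by (auto simp: mult.commute)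
  qed (use R in auto)
  also have "\<dots> = (LINT x|lborel. \<phi> x * limit_fun x)"
  proof (rule integral_cong_AE)
    show "AE x in lborel. \<phi> x * left_density ?\<psi> x = \<phi> x * limit_fun x"
      using left_density_bump_AE_eq_limit_fun[of n]
    proof eventually_elim
      case (elim x)
      then show ?case using R(2)[of x] n by (cases "x < 10 * 2 ^ n") auto
    qed
  qed (use int in \<open>auto dest: borel_measurable_integrable\<close>)
  finally show ?thesis .
qed

lemma w_representation:
  obtains f C where "f \<in> borel_measurable borel" "integrable lborel (\<lambda>x. (cmod (f x))\<^sup>2)"
    "(LINT x|lborel. (cmod (f x))\<^sup>2) \<le> (32 * bump_bound\<^sup>2 * mass UNIV)\<^sup>2"
    "\<And>\<phi>. \<phi> \<in> test_functions \<Longrightarrow> w \<phi> = (LINT x|lborel. \<phi> x * (f x + C))"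
  by (rule that[of "\<lambda>x. limit_fun x - limit_const" limit_const])
    (use limit_fun_L2 w_eq_limit_fun in auto)

end

section \<open>From off-diagonal test functions to the pairing identity\<close>
lemma borel_representative_complex:
  fixes F :: "'a::euclidean_space \<Rightarrow> complex"
  assumes "F \<in> borel_measurable lebesgue"
  obtains F' where "F' \<in> borel_measurable borel" "AE x in lborel. F x = F' x"
proof -
  have "(\<lambda>x. Re (F x)) \<in> borel_measurable lebesgue" "(\<lambda>x. Im (F x)) \<in> borel_measurable lebesgue"
    using assms by measurable
  then obtain R I where R: "R \<in> borel_measurable lborel" "AE x in lborel. Re (F x) = R x"
    and I: "I \<in> borel_measurable lborel" "AE x in lborel. Im (F x) = I x"
    using completion_ex_borel_measurable_real[where M = lborel] by metis
  show thesis
  proof (rule that[of "\<lambda>x. Complex (R x) (I x)"])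
    show "(\<lambda>x. Complex (R x) (I x)) \<in> borel_measurable borel"
      using R(1) I(1) by (simp add: borel_measurable_complex_iff)
    show "AE x in lborel. F x = Complex (R x) (I x)"
      using R(2) I(2) by eventually_elim (simp add: complex_eq_iff)
  qed
qed

lemma integral_lebesgue_cong_AE:
  fixes f :: "'a::euclidean_space \<Rightarrow> 'b::{banach, second_countable_topology}"
  assumes "f \<in> borel_measurable lebesgue" "g \<in> borel_measurable borel" "AE x in lborel. f x = g x"
  shows "(LINT x|lebesgue. f x) = (LINT x|lborel. g x)"
    and "integrable lebesgue f \<longleftrightarrow> integrable lborel g"
proof -
  have g: "g \<in> borel_measurable lborel" "g \<in> borel_measurable lebesgue"
    using assms(2) by (auto intro: measurable_completion)
  have ae: "AE x in lebesgue. f x = g x" using assms(3) by (rule AE_completion)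
  show "(LINT x|lebesgue. f x) = (LINT x|lborel. g x)"
    using integral_cong_AE[OF assms(1) g(2) ae] integral_completion[OF g(1)] by simp
  show "integrable lebesgue f \<longleftrightarrow> integrable lborel g"
    using integrable_cong_AE[OF assms(1) g(2) ae] integrable_completion[OF g(1)] by simp
qed

lemma lborel_swap:
  fixes f :: "real \<times> real \<Rightarrow> 'b::{banach, second_countable_topology}"
  shows "f \<in> borel_measurable borel \<Longrightarrow> (LINT z|lborel. f (snd z, fst z)) = (LINT z|lborel. f z)"
    and "integrable lborel (\<lambda>z. f (snd z, fst z)) \<longleftrightarrow> integrable lborel f"
  using lborel_pair.integral_product_swap[of f] lborel_pair.integrable_product_swap_iff[of f]
  by (simp_all add: lborel_prod case_prod_beta')

lemma od_test_function_quotient: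
  fixes c :: complex
  shows "c * of_real (\<bar>x - y\<bar> powr (3/2)) / of_real \<bar>x - y\<bar> = c * of_real (sqrt \<bar>x - y\<bar>)"
  by (cases "x = y") (auto simp: powr_3_2)

text \<open>
  The power \<open>3/2\<close> cancels the weight under the integral. The two sides also agree at \<open>x = y\<close>, where the
  left integrand is \<open>0\<close> because of the division by zero and the right one because of antisymmetry.
\<close>
lemma div_half_off_diagonal:
  assumes \<phi>: "\<phi> \<in> test_functions" and \<psi>: "\<psi> \<in> test_functions"
  shows "div_half (\<lambda>(x, y). (\<phi> x * \<psi> y - \<psi> x * \<phi> y) * of_real (\<bar>x - y\<bar> powr (3/2))) =
    (\<lambda>x. 2 * (LINT y|lborel. \<psi> y) * \<phi> x + (- 2) * (LINT y|lborel. \<phi> y) * \<psi> x)"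
proof
  fix x
  have [measurable]: "\<phi> \<in> borel_measurable borel" "\<psi> \<in> borel_measurable borel"
    using \<phi> \<psi> by (auto intro: test_function_measurable)
  have eq: "2 * ((\<phi> x * \<psi> y - \<psi> x * \<phi> y) * complex_of_real (\<bar>x - y\<bar> powr (3/2))) / of_real (\<bar>x - y\<bar> powr (1/2)) / of_real \<bar>x - y\<bar>
      = 2 * (\<phi> x * \<psi> y - \<psi> x * \<phi> y)" for y
  proof (cases "x = y")
    case False
    then have "\<bar>x - y\<bar> powr (3/2) = \<bar>x - y\<bar> powr (1/2) * \<bar>x - y\<bar>"
      by (simp add: powr_3_2 powr_half_sqrt)
    moreover have "\<bar>x - y\<bar> powr (1/2) \<noteq> 0" "\<bar>x - y\<bar> \<noteq> 0" using False by auto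
    ultimately show ?thesis
      by (simp add: divide_simps)
  qed simp
  have "div_half (\<lambda>(x, y). (\<phi> x * \<psi> y - \<psi> x * \<phi> y) * of_real (\<bar>x - y\<bar> powr (3/2))) x =
      (LINT y|lebesgue. 2 * (\<phi> x * \<psi> y - \<psi> x * \<phi> y))"
    unfolding div_half_def case_prod_conv eq ..
  also have "\<dots> = (LINT y|lborel. 2 * (\<phi> x * \<psi> y - \<psi> x * \<phi> y))"
    by (intro integral_completion) measurable
  also have "\<dots> = 2 * (\<phi> x * (LINT y|lborel. \<psi> y) - \<psi> x * (LINT y|lborel. \<phi> y))"
    using test_function_integrable[OF \<phi>] test_function_integrable[OF \<psi>] by simp
  finally show "div_half (\<lambda>(x, y). (\<phi> x * \<psi> y - \<psi> x * \<phi> y) * of_real (\<bar>x - y\<bar> powr (3/2))) x =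
      2 * (LINT y|lborel. \<psi> y) * \<phi> x + (- 2) * (LINT y|lborel. \<phi> y) * \<psi> x"
    by (simp add: algebra_simps)
qed

text \<open>
  A Borel function that represents \<open>F\<close> need be antisymmetric only almost everywhere, so it is replaced by
  its antisymmetric part. This does not increase the norm, and by exchanging the variables it turns
  the two terms \<open>\<phi> x * \<psi> y\<close> and \<open>\<psi> x * \<phi> y\<close> into twice the first one.
\<close>
lemma antisymmetrized_kernel:
  assumes F': "weighted_kernel F'"
  defines "H \<equiv> \<lambda>z. (F' z - F' (snd z, fst z)) / 2"
  shows "weighted_kernel H"
    and "(LINT z|lborel. cmod (H z) / \<bar>fst z - snd z\<bar>) \<le> (LINT z|lborel. cmod (F' z) / \<bar>fst z - snd z\<bar>)"
    and "\<phi> \<in> test_functions \<Longrightarrow> \<psi> \<in> test_functions \<Longrightarrow>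
      (LINT z|lborel. F' z * of_real (sqrt \<bar>fst z - snd z\<bar>) * (\<phi> (fst z) * \<psi> (snd z) - \<psi> (fst z) * \<phi> (snd z))) =
      2 * (LINT z|lborel. H z * of_real (sqrt \<bar>fst z - snd z\<bar>) * (\<phi> (fst z) * \<psi> (snd z)))"
proof -
  interpret F': weighted_kernel F' by fact
  have Fm [measurable]: "F' \<in> borel_measurable borel" by (rule F'.H_measurable)
  have [measurable]: "(\<lambda>z. F' (snd z, fst z)) \<in> borel_measurable borel"
    by (rule measurable_compose[OF _ Fm]) (intro borel_measurable_continuous_onI continuous_intros)
  let ?g = "\<lambda>z. cmod (F' z) / \<bar>fst z - snd z\<bar>"
  have gm: "?g \<in> borel_measurable borel" by measurable
  have g: "integrable lborel ?g" by (rule F'.H_integrable)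
  have g': "integrable lborel (\<lambda>z. ?g (snd z, fst z))"
    using lborel_swap(2)[of ?g] g by blast
  have int: "integrable lborel (\<lambda>z. (?g z + ?g (snd z, fst z)) / 2)"
    by (intro integrable_divide Bochner_Integration.integrable_add g g')
  have le: "cmod (H z) / \<bar>fst z - snd z\<bar> \<le> (?g z + ?g (snd z, fst z)) / 2" for z
  proof -
    have "cmod (H z) \<le> (cmod (F' z) + cmod (F' (snd z, fst z))) / 2"
      using norm_triangle_ineq4[of "F' z" "F' (snd z, fst z)"] by (simp add: H_def norm_divide)
    then have "cmod (H z) / \<bar>fst z - snd z\<bar> \<le> (cmod (F' z) + cmod (F' (snd z, fst z))) / 2 / \<bar>fst z - snd z\<bar>"
      by (intro divide_right_mono) auto
    then show ?thesis by (simp add: abs_minus_commute add_divide_distrib)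
  qed
  have Hm [measurable]: "H \<in> borel_measurable borel" unfolding H_def by measurable
  have Hint: "integrable lborel (\<lambda>z. cmod (H z) / \<bar>fst z - snd z\<bar>)"
    by (rule Bochner_Integration.integrable_bound[OF int]) (use le in \<open>auto intro: order_trans[OF le abs_ge_self]\<close>)
  show "weighted_kernel H"
    by unfold_locales (rule Hm Hint)+
  have "(LINT z|lborel. cmod (H z) / \<bar>fst z - snd z\<bar>) \<le> (LINT z|lborel. (?g z + ?g (snd z, fst z)) / 2)"
    by (intro integral_mono Hint int le)
  also have "\<dots> = ((LINT z|lborel. ?g z) + (LINT z|lborel. ?g (snd z, fst z))) / 2"
    unfolding integral_divide_zero
    by (subst Bochner_Integration.integral_add[OF g g']) rule
  also have "\<dots> = (LINT z|lborel. ?g z)"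
    unfolding lborel_swap(1)[OF gm] by simp
  finally show "(LINT z|lborel. cmod (H z) / \<bar>fst z - snd z\<bar>) \<le> (LINT z|lborel. ?g z)" .
  assume \<phi>: "\<phi> \<in> test_functions" and \<psi>: "\<psi> \<in> test_functions"
  have [measurable]: "\<phi> \<in> borel_measurable borel" "\<psi> \<in> borel_measurable borel"
    using \<phi> \<psi> by (auto intro: test_function_measurable)
  let ?k = "\<lambda>F \<phi> \<psi> z. F z * complex_of_real (sqrt \<bar>fst z - snd z\<bar>) * (\<phi> (fst z) * \<psi> (snd z))"
  have int2: "integrable lborel (?k F' \<phi> \<psi>)" if \<phi>: "\<phi> \<in> test_functions" and \<psi>: "\<psi> \<in> test_functions" for \<phi> \<psi>
  proof -
    obtain B R where B: "\<And>x. cmod (\<phi> x) \<le> B" and R: "\<And>x. \<bar>x\<bar> > R \<Longrightarrow> \<phi> x = 0"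
      using test_function_bounded[OF \<phi>] by metis
    show ?thesis
      using F'.kernel_slice_integrable[OF \<psi> test_function_measurable[OF \<phi>] B R]
      by (simp add: F'.pair_kernel_def)
  qed
  have "(LINT z|lborel. F' z * of_real (sqrt \<bar>fst z - snd z\<bar>) * (\<phi> (fst z) * \<psi> (snd z) - \<psi> (fst z) * \<phi> (snd z))) =
      (LINT z|lborel. ?k F' \<phi> \<psi> z) - (LINT z|lborel. ?k F' \<psi> \<phi> z)"
    unfolding right_diff_distrib by (intro Bochner_Integration.integral_diff int2 \<phi> \<psi>)
  also have "(LINT z|lborel. ?k F' \<psi> \<phi> z) = (LINT z|lborel. ?k F' \<psi> \<phi> (snd z, fst z))"
    by (rule lborel_swap(1)[symmetric]) measurable
  also have "(LINT z|lborel. ?k F' \<phi> \<psi> z) - (LINT z|lborel. ?k F' \<psi> \<phi> (snd z, fst z)) =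
      (LINT z|lborel. ?k F' \<phi> \<psi> z - ?k F' \<psi> \<phi> (snd z, fst z))"
    by (intro Bochner_Integration.integral_diff[symmetric] int2 \<phi> \<psi> lborel_swap(2)[THEN iffD2])
  also have "\<dots> = (LINT z|lborel. 2 * ?k H \<phi> \<psi> z)"
    by (intro Bochner_Integration.integral_cong) (auto simp: H_def abs_minus_commute algebra_simps)
  also have "\<dots> = 2 * (LINT z|lborel. ?k H \<phi> \<psi> z)"
    by simp
  finally show "(LINT z|lborel. F' z * of_real (sqrt \<bar>fst z - snd z\<bar>) * (\<phi> (fst z) * \<psi> (snd z) - \<psi> (fst z) * \<phi> (snd z))) =
      2 * (LINT z|lborel. ?k H \<phi> \<psi> z)" .
qed

text \<open>
  This is the embedding theorem: a distribution whose fractional gradient is integrable is a function in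
  \<open>L2\<close> up to a constant. Only the values of \<open>w\<close> on test functions enter.
\<close>
lemma gradient_in_L1_representation:
  assumes F: "F \<in> L1_od"
    and w_linear: "\<And>a b \<phi> \<psi>. \<phi> \<in> test_functions \<Longrightarrow> \<psi> \<in> test_functions \<Longrightarrow>
      w (\<lambda>x. a * \<phi> x + b * \<psi> x) = a * w \<phi> + b * w \<psi>"
    and w_div: "\<And>G. G \<in> schwartz_od \<Longrightarrow> div_half G \<in> test_functions \<Longrightarrow> w (div_half G) = distr_od_of F G"
  obtains f C where "f \<in> L2" "L2_norm f \<le> 32 * bump_bound\<^sup>2 * L1_od_norm F"
    "\<And>\<phi>. \<phi> \<in> test_functions \<Longrightarrow> w \<phi> = (LINT x|lebesgue. (f x + C) * \<phi> x)"
proof -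
  have Fm: "F \<in> borel_measurable lebesgue"
    and Fint: "integrable lebesgue (\<lambda>z. cmod (F z) / \<bar>fst z - snd z\<bar>)"
    using F by (simp_all add: L1_od_def case_prod_beta')
  obtain F' where F'm [measurable]: "F' \<in> borel_measurable borel" and F': "AE z in lborel. F z = F' z"
    using borel_representative_complex[OF Fm] .
  have "fst \<in> borel_measurable lebesgue" "snd \<in> borel_measurable lebesgue"
    by (auto intro!: measurable_completion borel_measurable_continuous_onI continuous_intros)
  note [measurable] = Fm this
  have gm: "(\<lambda>z. cmod (F z) / \<bar>fst z - snd z\<bar>) \<in> borel_measurable lebesgue"
    by measurable
  have ae: "AE z in lborel. cmod (F z) / \<bar>fst z - snd z\<bar> = cmod (F' z) / \<bar>fst z - snd z\<bar>"
    using F' by eventually_elim simp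
  have g'm: "(\<lambda>z. cmod (F' z) / \<bar>fst z - snd z\<bar>) \<in> borel_measurable borel"
    by measurable
  have F'w: "weighted_kernel F'"
    by unfold_locales (use integral_lebesgue_cong_AE(2)[OF gm g'm ae] Fint in auto)
  define H where "H z = (F' z - F' (snd z, fst z)) / 2" for z
  note H = antisymmetrized_kernel[OF F'w, folded H_def]
  interpret H: weighted_kernel H by (rule H(1))
  have "gradient_pairing H w"
  proof
    fix \<phi> \<psi> q r
    assume \<phi>: "\<phi> \<in> test_functions" and \<psi>: "\<psi> \<in> test_functions"
      and sep: "\<And>x. q < x \<Longrightarrow> \<phi> x = 0" "\<And>x. x < r \<Longrightarrow> \<psi> x = 0" "q < r"
    have [measurable]: "\<phi> \<in> borel_measurable borel" "\<psi> \<in> borel_measurable borel"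
      using \<phi> \<psi> by (auto intro: test_function_measurable)
    let ?G = "\<lambda>(x, y). (\<phi> x * \<psi> y - \<psi> x * \<phi> y) * complex_of_real (\<bar>x - y\<bar> powr (3/2))"
    let ?c = "\<lambda>z. \<phi> (fst z) * \<psi> (snd z) - \<psi> (fst z) * \<phi> (snd z)"
    have G: "?G \<in> schwartz_od"
      by (rule off_diagonal_test_function[OF \<phi> \<psi> sep])
    have div: "div_half ?G \<in> test_functions"
      unfolding div_half_off_diagonal[OF \<phi> \<psi>]
      by (intro test_functions_add test_functions_cmult \<phi> \<psi>)
    have m1: "(\<lambda>z. F z * (complex_of_real (sqrt \<bar>fst z - snd z\<bar>) * ?c z)) \<in> borel_measurable lebesgue"
    proof -
      have "(\<lambda>z. complex_of_real (sqrt \<bar>fst z - snd z\<bar>) * ?c z) \<in> borel_measurable (borel :: (real \<times> real) measure)"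
        by measurable
      then have "(\<lambda>z. complex_of_real (sqrt \<bar>fst z - snd z\<bar>) * ?c z) \<in> borel_measurable lebesgue"
        by (intro measurable_completion) simp
      then show ?thesis using Fm by (rule borel_measurable_times[rotated])
    qed
    have "distr_od_of F ?G = (LINT z|lebesgue. F z * (complex_of_real (sqrt \<bar>fst z - snd z\<bar>) * ?c z))"
    proof -
      have "F z * ?G z / complex_of_real \<bar>fst z - snd z\<bar> = F z * (complex_of_real (sqrt \<bar>fst z - snd z\<bar>) * ?c z)" for z
        using od_test_function_quotient[of "F z * ?c z" "fst z" "snd z"]
        by (simp add: case_prod_beta' mult_ac)
      moreover have "distr_od_of F ?G = (LINT z|lebesgue. F z * ?G z / complex_of_real \<bar>fst z - snd z\<bar>)"
        using G by (simp add: distr_od_of_def case_prod_beta')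
      ultimately show ?thesis by simp
    qed
    also have "\<dots> = (LINT z|lborel. F' z * (complex_of_real (sqrt \<bar>fst z - snd z\<bar>) * ?c z))"
    proof (rule integral_lebesgue_cong_AE(1)[OF m1])
      show "AE z in lborel. F z * (complex_of_real (sqrt \<bar>fst z - snd z\<bar>) * ?c z) = F' z * (complex_of_real (sqrt \<bar>fst z - snd z\<bar>) * ?c z)"
        using F' by eventually_elim simp
    qed measurable
    also have "\<dots> = 2 * (LINT z|lborel. H.pair_kernel z * (\<phi> (fst z) * \<psi> (snd z)))"
      using H(3)[OF \<phi> \<psi>] by (simp add: H.pair_kernel_def mult.assoc)
    finally have "distr_od_of F ?G = 2 * (LINT z|lborel. H.pair_kernel z * (\<phi> (fst z) * \<psi> (snd z)))" .
    moreover have "w (div_half ?G) = 2 * (LINT y|lborel. \<psi> y) * w \<phi> + (- 2) * (LINT y|lborel. \<phi> y) * w \<psi>"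
      unfolding div_half_off_diagonal[OF \<phi> \<psi>] by (rule w_linear[OF \<phi> \<psi>])
    ultimately have "2 * (w \<phi> * (LINT x|lborel. \<psi> x) - w \<psi> * (LINT x|lborel. \<phi> x)) =
        2 * (LINT z|lborel. H.pair_kernel z * (\<phi> (fst z) * \<psi> (snd z)))"
      using w_div[OF G div] by (simp add: algebra_simps)
    then show "w \<phi> * (LINT x|lborel. \<psi> x) - w \<psi> * (LINT x|lborel. \<phi> x) =
        (LINT z|lborel. H.pair_kernel z * (\<phi> (fst z) * \<psi> (snd z)))"
      by (simp only: mult_cancel_left) simp
  qed
  then interpret H: gradient_pairing H w .
  obtain f C where f: "f \<in> borel_measurable borel" "integrable lborel (\<lambda>x. (cmod (f x))\<^sup>2)"
    "(LINT x|lborel. (cmod (f x))\<^sup>2) \<le> (32 * bump_bound\<^sup>2 * H.mass UNIV)\<^sup>2"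
    and w: "\<And>\<phi>. \<phi> \<in> test_functions \<Longrightarrow> w \<phi> = (LINT x|lborel. \<phi> x * (f x + C))"
    using H.w_representation by blast
  have f2m: "(\<lambda>x. (cmod (f x))\<^sup>2) \<in> borel_measurable lborel" using f(1) by measurable
  have mass: "H.mass UNIV \<le> L1_od_norm F"
  proof -
    have "H.mass UNIV = (LINT z|lborel. cmod (H z) / \<bar>fst z - snd z\<bar>)"
      by (simp add: H.mass_def H.weight_def)
    also have "\<dots> \<le> (LINT z|lborel. cmod (F' z) / \<bar>fst z - snd z\<bar>)" by (rule H(2))
    also have "\<dots> = L1_od_norm F"
      using integral_lebesgue_cong_AE(1)[OF gm g'm ae] by (simp add: L1_od_norm_def case_prod_beta')
    finally show ?thesis .
  qed
  show thesis
  proof (rule that[of f C])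
    show "f \<in> L2"
      using f(1,2) integrable_completion[OF f2m] by (auto simp: L2_def intro: measurable_completion)
    have "L2_norm f \<le> sqrt ((32 * bump_bound\<^sup>2 * H.mass UNIV)\<^sup>2)"
      unfolding L2_norm_def integral_completion[OF f2m] using f(3) by (rule real_sqrt_le_mono)
    also have "\<dots> = 32 * bump_bound\<^sup>2 * H.mass UNIV"
      using H.mass_nonneg by (simp add: real_sqrt_mult)
    also have "\<dots> \<le> 32 * bump_bound\<^sup>2 * L1_od_norm F"
      using mass by (intro mult_left_mono) auto
    finally show "L2_norm f \<le> 32 * bump_bound\<^sup>2 * L1_od_norm F" .
    fix \<phi> assume \<phi>: "\<phi> \<in> test_functions"
    have [measurable]: "\<phi> \<in> borel_measurable borel" "f \<in> borel_measurable borel"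
      using \<phi> f by (auto intro: test_function_measurable)
    have "(LINT x|lebesgue. (f x + C) * \<phi> x) = (LINT x|lborel. (f x + C) * \<phi> x)"
      by (rule integral_completion) measurable
    then show "w \<phi> = (LINT x|lebesgue. (f x + C) * \<phi> x)"
      using w[OF \<phi>] by (simp add: mult.commute)
  qed
qed

section \<open>Schwartz functions and square-integrable functions\<close>
lemma schwartz_smooth: "\<phi> \<in> schwartz \<Longrightarrow> smooth \<phi>"
  by (simp add: schwartz_def)

lemma schwartz_bound:
  assumes "\<phi> \<in> schwartz" "set bs \<subseteq> Basis"
  obtains C where "C \<ge> 0" "\<And>x. (1 + norm x) ^ k * cmod (partial_derivs bs \<phi> x) \<le> C"
proof -
  have "bdd_above (range (\<lambda>x. (1 + norm x) ^ k * cmod (partial_derivs bs \<phi> x)))"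
    using assms by (simp add: schwartz_def)
  then obtain C where "\<And>x. (1 + norm x) ^ k * cmod (partial_derivs bs \<phi> x) \<le> C"
    by (auto simp: bdd_above_def)
  then show thesis by (intro that[of "max C 0"]) (auto simp: le_max_iff_disj)
qed

lemma partial_derivs_add:
  assumes "smooth f" "smooth g" "set bs \<subseteq> Basis"
  shows "partial_derivs bs (\<lambda>x. f x + g x) = (\<lambda>x. partial_derivs bs f x + partial_derivs bs g x)"
  using assms(3)
proof (induction bs)
  case (Cons b bs)
  have "partial_deriv b (\<lambda>x. partial_derivs bs f x + partial_derivs bs g x) =
      (\<lambda>x. partial_deriv b (partial_derivs bs f) x + partial_deriv b (partial_derivs bs g) x)"
    using Cons.prems by (intro ext partial_deriv_add smooth_imp_differentiable smooth_partial_derivs assms) auto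
  then show ?case using Cons by (simp add: partial_derivs_Cons)
qed simp

lemma partial_derivs_cmult:
  assumes "smooth f" "set bs \<subseteq> Basis"
  shows "partial_derivs bs (\<lambda>x. c * f x) = (\<lambda>x. c * partial_derivs bs f x)"
  using assms(2)
proof (induction bs)
  case (Cons b bs)
  have "partial_deriv b (\<lambda>x. c * partial_derivs bs f x) = (\<lambda>x. c * partial_deriv b (partial_derivs bs f) x)"
  proof
    fix x
    have "partial_derivs bs f differentiable at x"
      using Cons.prems by (intro smooth_imp_differentiable smooth_partial_derivs assms) auto
    then show "partial_deriv b (\<lambda>x. c * partial_derivs bs f x) x = c * partial_deriv b (partial_derivs bs f) x"
      by (subst partial_deriv_mult) auto
  qed
  then show ?case using Cons by (simp add: partial_derivs_Cons)
qed simp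

lemma schwartz_add:
  assumes f: "f \<in> schwartz" and g: "g \<in> schwartz"
  shows "(\<lambda>x. f x + g x) \<in> schwartz"
proof -
  have "bdd_above (range (\<lambda>x. (1 + norm x) ^ k * cmod (partial_derivs bs (\<lambda>x. f x + g x) x)))"
    if bs: "set bs \<subseteq> Basis" for k bs
  proof -
    obtain A B where A: "\<And>x. (1 + norm x) ^ k * cmod (partial_derivs bs f x) \<le> A"
      and B: "\<And>x. (1 + norm x) ^ k * cmod (partial_derivs bs g x) \<le> B"
      using schwartz_bound[OF f bs] schwartz_bound[OF g bs] by metis
    have "(1 + norm x) ^ k * cmod (partial_derivs bs (\<lambda>x. f x + g x) x) \<le> A + B" for x
    proof -
      have "(1 + norm x) ^ k * cmod (partial_derivs bs f x + partial_derivs bs g x) \<le>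
          (1 + norm x) ^ k * (cmod (partial_derivs bs f x) + cmod (partial_derivs bs g x))"
        by (intro mult_left_mono norm_triangle_ineq) auto
      then show ?thesis
        using A[of x] B[of x] by (simp add: partial_derivs_add schwartz_smooth f g bs distrib_left)
    qed
    then show ?thesis by (auto simp: bdd_above_def)
  qed
  then show ?thesis
    using smooth_add f g by (auto simp: schwartz_def)
qed

lemma schwartz_cmult:
  assumes f: "f \<in> schwartz" shows "(\<lambda>x. c * f x) \<in> schwartz"
proof -
  have "bdd_above (range (\<lambda>x. (1 + norm x) ^ k * cmod (partial_derivs bs (\<lambda>x. c * f x) x)))"
    if bs: "set bs \<subseteq> Basis" for k bs
  proof -
    obtain A where A: "\<And>x. (1 + norm x) ^ k * cmod (partial_derivs bs f x) \<le> A"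
      using schwartz_bound[OF f bs] by metis
    have "(1 + norm x) ^ k * cmod (partial_derivs bs (\<lambda>x. c * f x) x) \<le> cmod c * A" for x
      using mult_left_mono[OF A[of x], of "cmod c"]
      by (simp add: partial_derivs_cmult schwartz_smooth f bs norm_mult mult_ac)
    then show ?thesis by (auto simp: bdd_above_def)
  qed
  then show ?thesis
    using smooth_cmult f by (auto simp: schwartz_def)
qed

lemma schwartz_diff: "f \<in> schwartz \<Longrightarrow> g \<in> schwartz \<Longrightarrow> (\<lambda>x. f x - g x) \<in> schwartz"
  using schwartz_add[OF _ schwartz_cmult[of g "-1"], of f] by simp

lemma schwartz_partial_deriv:
  assumes f: "f \<in> schwartz" and b: "b \<in> Basis" shows "partial_deriv b f \<in> schwartz"
proof -
  have "bdd_above (range (\<lambda>x. (1 + norm x) ^ k * cmod (partial_derivs bs (partial_deriv b f) x)))"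
    if "set bs \<subseteq> Basis" for k bs
  proof -
    have "set (bs @ [b]) \<subseteq> Basis" using that b by simp
    then have "bdd_above (range (\<lambda>x. (1 + norm x) ^ k * cmod (partial_derivs (bs @ [b]) f x)))"
      using f by (simp add: schwartz_def)
    then show ?thesis by (simp add: partial_derivs_append partial_derivs_Cons)
  qed
  then show ?thesis
    using smooth_partial_deriv[OF schwartz_smooth[OF f] b] by (auto simp: schwartz_def)
qed

lemma schwartz_measurable [measurable_dest]:
  "\<phi> \<in> schwartz \<Longrightarrow> \<phi> \<in> borel_measurable borel"
  by (intro borel_measurable_continuous_onI smooth_imp_continuous schwartz_smooth)

lemma schwartz_decay:
  fixes \<phi> :: "real \<Rightarrow> complex"
  assumes "\<phi> \<in> schwartz"
  obtains C where "C \<ge> 0" "\<And>x. cmod (\<phi> x) \<le> C * inverse (1 + x\<^sup>2)"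
proof -
  obtain C where C: "C \<ge> 0" "\<And>x. (1 + norm x) ^ 2 * cmod (partial_derivs [] \<phi> x) \<le> C"
    using schwartz_bound[OF assms, of "[]" 2] by auto
  have "cmod (\<phi> x) \<le> C * inverse (1 + x\<^sup>2)" for x
  proof -
    have "(1 + x\<^sup>2) * cmod (\<phi> x) \<le> (1 + norm x) ^ 2 * cmod (\<phi> x)"
      by (intro mult_right_mono) (auto simp: power2_eq_square algebra_simps)
    also have "\<dots> \<le> C" using C(2)[of x] by simp
    finally have "cmod (\<phi> x) * (1 + x\<^sup>2) \<le> C" by (simp add: mult.commute)
    moreover have "1 + x\<^sup>2 > 0" by (simp add: add_pos_nonneg)
    ultimately show ?thesis by (simp add: divide_inverse[symmetric] pos_le_divide_eq)
  qed
  then show thesis using that C(1) by blast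
qed

lemma integrable_inverse_1_plus_square_UNIV: "integrable lborel (\<lambda>x::real. inverse (1 + x\<^sup>2))"
  using integrable_inverse_1_plus_square by (simp add: set_integrable_def einterval_def)

lemma schwartz_integrable:
  fixes \<phi> :: "real \<Rightarrow> complex"
  assumes \<phi>: "\<phi> \<in> schwartz"
  shows "integrable lebesgue \<phi>" "integrable lebesgue (\<lambda>x. (cmod (\<phi> x))\<^sup>2)"
proof -
  obtain C where C: "C \<ge> 0" "\<And>x. cmod (\<phi> x) \<le> C * inverse (1 + x\<^sup>2)"
    using schwartz_decay[OF \<phi>] by metis
  have [measurable]: "\<phi> \<in> borel_measurable borel" using \<phi> by (rule schwartz_measurable)
  have "integrable lborel \<phi>"
    by (rule Bochner_Integration.integrable_bound[OF integrable_mult_right[OF integrable_inverse_1_plus_square_UNIV, of C]])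
      (auto intro: order_trans[OF C(2) abs_ge_self])
  then show "integrable lebesgue \<phi>"
    by (simp add: integrable_completion)
  have le: "(cmod (\<phi> x))\<^sup>2 \<le> C * C * inverse (1 + x\<^sup>2)" for x
  proof -
    have "inverse (1 + x\<^sup>2) \<le> 1" by (simp add: inverse_le_1_iff add_pos_nonneg)
    then have "C * inverse (1 + x\<^sup>2) \<le> C" using C(1) by (simp add: mult_left_le)
    then have "cmod (\<phi> x) * cmod (\<phi> x) \<le> C * (C * inverse (1 + x\<^sup>2))"
      using C by (intro mult_mono) (auto intro: order_trans[OF C(2)])
    then show ?thesis by (simp add: power2_eq_square mult_ac)
  qed
  have "integrable lborel (\<lambda>x. (cmod (\<phi> x))\<^sup>2)"
    by (intro Bochner_Integration.integrable_bound[OF integrable_mult_right[OF integrable_inverse_1_plus_square_UNIV, of "C * C"]])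
      (use le in auto)
  then show "integrable lebesgue (\<lambda>x. (cmod (\<phi> x))\<^sup>2)"
    by (simp add: integrable_completion)
qed

lemma L2_mult_integrable:
  assumes v: "v \<in> L2" and [measurable]: "a \<in> borel_measurable lebesgue"
    and a: "integrable lebesgue (\<lambda>x. (cmod (a x))\<^sup>2)"
  shows "integrable lebesgue (\<lambda>x. v x * a x)"
proof -
  have [measurable]: "v \<in> borel_measurable lebesgue" and v2: "integrable lebesgue (\<lambda>x. (cmod (v x))\<^sup>2)"
    using v by (auto simp: L2_def)
  show ?thesis
  proof (rule Bochner_Integration.integrable_bound[OF Bochner_Integration.integrable_add[OF v2 a]])
    have "cmod (v x) * cmod (a x) \<le> (cmod (v x))\<^sup>2 + (cmod (a x))\<^sup>2" for x
    proof -
      have "0 \<le> cmod (v x) * cmod (a x)" by simp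
      then show ?thesis using sum_squares_bound[of "cmod (v x)" "cmod (a x)"] by linarith
    qed
    then show "AE x in lebesgue. norm (v x * a x) \<le> norm ((cmod (v x))\<^sup>2 + (cmod (a x))\<^sup>2)"
      by (intro AE_I2) (simp add: norm_mult)
  qed measurable
qed

lemma L2_mult_schwartz_integrable:
  fixes \<phi> :: "real \<Rightarrow> complex"
  assumes "v \<in> L2" "\<phi> \<in> schwartz"
  shows "integrable lebesgue (\<lambda>x. v x * \<phi> x)"
  using assms by (intro L2_mult_integrable schwartz_integrable measurable_completion)
    (auto dest: schwartz_measurable)

lemma L2_plus_const_mult_schwartz_integrable:
  fixes \<phi> :: "real \<Rightarrow> complex"
  assumes "v \<in> L2" "\<phi> \<in> schwartz"
  shows "integrable lebesgue (\<lambda>x. (v x + C) * \<phi> x)"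
  unfolding distrib_right
  by (intro Bochner_Integration.integrable_add L2_mult_schwartz_integrable integrable_mult_right
      schwartz_integrable assms)

text \<open>
  The factor \<open>sqrt 2\<close> comes from \<open>(a + b)\<^sup>2 \<le> 2 * a\<^sup>2 + 2 * b\<^sup>2\<close> and is absorbed by the
  constant of the theorem.
\<close>
lemma L2_add:
  assumes f: "f \<in> L2" and g: "g \<in> L2"
  shows "(\<lambda>x. f x + g x) \<in> L2" "L2_norm (\<lambda>x. f x + g x) \<le> sqrt 2 * (L2_norm f + L2_norm g)"
proof -
  have [measurable]: "f \<in> borel_measurable lebesgue" "g \<in> borel_measurable lebesgue"
    and f2: "integrable lebesgue (\<lambda>x. (cmod (f x))\<^sup>2)" and g2: "integrable lebesgue (\<lambda>x. (cmod (g x))\<^sup>2)"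
    using f g by (auto simp: L2_def)
  have le: "(cmod (f x + g x))\<^sup>2 \<le> 2 * (cmod (f x))\<^sup>2 + 2 * (cmod (g x))\<^sup>2" for x
  proof -
    have "(cmod (f x + g x))\<^sup>2 \<le> (cmod (f x) + cmod (g x))\<^sup>2"
      by (intro power_mono norm_triangle_ineq) auto
    then show ?thesis
      using sum_squares_bound[of "cmod (f x)" "cmod (g x)"] by (simp add: power2_sum)
  qed
  have int: "integrable lebesgue (\<lambda>x. 2 * (cmod (f x))\<^sup>2 + 2 * (cmod (g x))\<^sup>2)"
    using f2 g2 by simp
  have int': "integrable lebesgue (\<lambda>x. (cmod (f x + g x))\<^sup>2)"
    by (rule Bochner_Integration.integrable_bound[OF int]) (use le in auto)
  then show "(\<lambda>x. f x + g x) \<in> L2" by (simp add: L2_def)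
  have nonneg: "0 \<le> (LINT x|lebesgue. (cmod (f x))\<^sup>2)" "0 \<le> (LINT x|lebesgue. (cmod (g x))\<^sup>2)"
    by (intro integral_nonneg_AE; simp)+
  have "(LINT x|lebesgue. (cmod (f x + g x))\<^sup>2) \<le> (LINT x|lebesgue. 2 * (cmod (f x))\<^sup>2 + 2 * (cmod (g x))\<^sup>2)"
    by (intro integral_mono int int' le)
  also have "\<dots> = 2 * ((LINT x|lebesgue. (cmod (f x))\<^sup>2) + (LINT x|lebesgue. (cmod (g x))\<^sup>2))"
    using f2 g2 by simp
  finally have "L2_norm (\<lambda>x. f x + g x) \<le> sqrt 2 * sqrt ((LINT x|lebesgue. (cmod (f x))\<^sup>2) + (LINT x|lebesgue. (cmod (g x))\<^sup>2))"
    unfolding L2_norm_def real_sqrt_mult[symmetric] by (rule real_sqrt_le_mono)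
  also have "\<dots> \<le> sqrt 2 * (L2_norm f + L2_norm g)"
    unfolding L2_norm_def by (intro mult_left_mono sqrt_add_le_add_sqrt nonneg) auto
  finally show "L2_norm (\<lambda>x. f x + g x) \<le> sqrt 2 * (L2_norm f + L2_norm g)" .
qed

lemma L2_uminus: "f \<in> L2 \<Longrightarrow> (\<lambda>x. - f x) \<in> L2"
  by (simp add: L2_def)

lemma L2_diff: "f \<in> L2 \<Longrightarrow> g \<in> L2 \<Longrightarrow> (\<lambda>x. f x - g x) \<in> L2"
  using L2_add(1)[OF _ L2_uminus, of f g] by simp

lemma L2_const_eq_0:
  assumes "(\<lambda>x::real. c) \<in> L2" shows "c = 0"
proof (rule ccontr)
  assume "c \<noteq> 0"
  have "integrable lebesgue (\<lambda>x::real. (cmod c)\<^sup>2)" using assms by (simp add: L2_def)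
  then have "integrable lborel (\<lambda>x::real. (cmod c)\<^sup>2)" by (simp add: integrable_completion)
  then have "nn_integral lborel (\<lambda>x::real. ennreal (norm ((cmod c)\<^sup>2))) < \<infinity>"
    by (simp only: integrable_iff_bounded)
  then show False using \<open>c \<noteq> 0\<close> by (simp add: ennreal_mult_top)
qed

text \<open>
  By the fundamental lemma \<open>f - g\<close> equals the constant \<open>D - C\<close> almost everywhere, and the only constant
  in \<open>L2\<close> of the line is \<open>0\<close>.
\<close>
lemma L2_plus_const_unique:
  fixes f g :: "real \<Rightarrow> complex"
  assumes f: "f \<in> L2" and g: "g \<in> L2"
    and eq: "\<And>\<phi>. \<phi> \<in> test_functions \<Longrightarrow> (LINT x|lebesgue. (f x + C) * \<phi> x) = (LINT x|lebesgue. (g x + D) * \<phi> x)"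
  shows "C = D" "AE x in lebesgue. f x = g x"
proof -
  define v where "v x = f x - g x" for x
  have v: "v \<in> L2" unfolding v_def using f g by (rule L2_diff)
  have vm [measurable]: "v \<in> borel_measurable lebesgue" using v by (simp add: L2_def)
  obtain v' where v'm [measurable]: "v' \<in> borel_measurable borel" and v': "AE x in lborel. v x = v' x"
    using borel_representative_complex[OF vm] .
  have "AE x in lborel. v' x + (C - D) = 0"
  proof (rule fundamental_lemma)
    fix a b :: real
    let ?i = "\<lambda>x. indicator {a..b} x :: complex"
    have im: "?i \<in> borel_measurable lebesgue" by (intro measurable_completion) auto
    have i1: "integrable lborel ?i"
      by (rule bounded_support_integrable[where B = 1 and R = "max \<bar>a\<bar> \<bar>b\<bar>"]) (auto simp: indicator_def)
    have "(\<lambda>x. (cmod (?i x))\<^sup>2) = (\<lambda>x. cmod (?i x))" by (auto simp: indicator_def)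
    then have "integrable lebesgue (\<lambda>x. (cmod (?i x))\<^sup>2)"
      using integrable_norm[OF i1] by (simp add: integrable_completion)
    then have "integrable lebesgue (\<lambda>x. v x * ?i x)"
      by (intro L2_mult_integrable v im)
    moreover have "AE x in lborel. v x * ?i x = v' x * ?i x"
      using v' by eventually_elim simp
    moreover have "(\<lambda>x. v x * ?i x) \<in> borel_measurable lebesgue"
      using vm im by (rule borel_measurable_times)
    moreover have "(\<lambda>x. v' x * ?i x) \<in> borel_measurable borel"
      by measurable
    ultimately have "integrable lborel (\<lambda>x. v' x * ?i x)"
      using integral_lebesgue_cong_AE(2)[of "\<lambda>x. v x * ?i x" "\<lambda>x. v' x * ?i x"] by blast
    then have "integrable lborel (\<lambda>x. v' x * ?i x + (C - D) * ?i x)"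
      using i1 by simp
    moreover have "(\<lambda>x. v' x * ?i x + (C - D) * ?i x) = (\<lambda>x. indicator {a..b} x *\<^sub>R (v' x + (C - D)))"
      by (auto simp: indicator_def)
    ultimately show "set_integrable lborel {a..b} (\<lambda>x. v' x + (C - D))"
      by (simp add: set_integrable_def)
  next
    fix \<phi> :: "real \<Rightarrow> complex" assume \<phi>: "\<phi> \<in> test_functions"
    then have \<phi>s: "\<phi> \<in> schwartz" using test_functions_subset_schwartz by blast
    have \<phi>m [measurable]: "\<phi> \<in> borel_measurable borel" using \<phi> by (rule test_function_measurable)
    have \<phi>l: "\<phi> \<in> borel_measurable lebesgue" by (intro measurable_completion) (simp add: \<phi>m)
    have "(LINT x|lborel. \<phi> x * (v' x + (C - D))) = (LINT x|lebesgue. (v x + (C - D)) * \<phi> x)"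
    proof (rule integral_lebesgue_cong_AE(1)[symmetric])
      show "AE x in lborel. (v x + (C - D)) * \<phi> x = \<phi> x * (v' x + (C - D))"
        using v' by eventually_elim (simp add: mult.commute)
      show "(\<lambda>x. (v x + (C - D)) * \<phi> x) \<in> borel_measurable lebesgue"
        using \<phi>l by measurable
    qed measurable
    also have "\<dots> = (LINT x|lebesgue. (f x + C) * \<phi> x - (g x + D) * \<phi> x)"
      by (simp add: v_def algebra_simps)
    also have "\<dots> = 0"
      using eq[OF \<phi>] L2_plus_const_mult_schwartz_integrable[OF f \<phi>s] L2_plus_const_mult_schwartz_integrable[OF g \<phi>s]
      by (subst Bochner_Integration.integral_diff) auto
    finally show "(LINT x|lborel. \<phi> x * (v' x + (C - D))) = 0" .
  qed
  with v' have "AE x in lborel. v x = D - C"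
  proof eventually_elim
    case (elim x)
    then show ?case using add_eq_0_iff2[of "v' x" "C - D"] by simp
  qed
  then have ae: "AE x in lebesgue. v x = D - C" by (rule AE_completion)
  have "integrable lebesgue (\<lambda>x. (cmod (v x))\<^sup>2)" using v by (simp add: L2_def)
  moreover have "AE x in lebesgue. (cmod (v x))\<^sup>2 = (cmod (D - C))\<^sup>2"
    using ae by eventually_elim simp
  moreover have "(\<lambda>x. (cmod (v x))\<^sup>2) \<in> borel_measurable lebesgue"
    by measurable
  ultimately have "integrable lebesgue (\<lambda>x::real. (cmod (D - C))\<^sup>2)"
    using integrable_cong_AE[of "\<lambda>x. (cmod (v x))\<^sup>2" lebesgue "\<lambda>x. (cmod (D - C))\<^sup>2"] by simp
  then have "D - C = 0"
    by (intro L2_const_eq_0) (simp add: L2_def)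
  then show "C = D" by simp
  show "AE x in lebesgue. f x = g x"
    using ae by eventually_elim (use \<open>C = D\<close> in \<open>simp add: v_def\<close>)
qed

lemma L2_norm_cong_AE:
  assumes "f \<in> L2" "g \<in> L2" "AE x in lebesgue. f x = g x"
  shows "L2_norm f = L2_norm g"
proof -
  have [measurable]: "f \<in> borel_measurable lebesgue" "g \<in> borel_measurable lebesgue"
    using assms by (auto simp: L2_def)
  have "AE x in lebesgue. (cmod (f x))\<^sup>2 = (cmod (g x))\<^sup>2"
    using assms(3) by eventually_elim simp
  then show ?thesis
    unfolding L2_norm_def by (subst integral_cong_AE[of _ _ "\<lambda>x. (cmod (g x))\<^sup>2"]) auto
qed

section \<open>Density of test functions\<close>

text \<open>
  The function \<open>1 - cutoff\<close> belongs to this class, which is stable under differentiation. A dilate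
  \<open>\<theta> (x / m)\<close> vanishes for \<open>\<bar>x\<bar> < m\<close>.
\<close>
definition tail_multipliers :: "(real \<Rightarrow> complex) set" where
  "tail_multipliers = {\<theta>. smooth \<theta> \<and> (\<forall>x. \<bar>x\<bar> < 1 \<longrightarrow> \<theta> x = 0) \<and>
     (\<forall>n. \<exists>B. \<forall>x. cmod (partial_derivs (replicate n 1) \<theta> x) \<le> B)}"

lemma partial_derivs_replicate_Suc:
  "partial_derivs (replicate (Suc n) b) f = partial_derivs (replicate n b) (partial_deriv b f)"
  unfolding replicate_Suc replicate_append_same[symmetric] partial_derivs_append
  by (simp add: partial_derivs_Cons)

lemma tail_multipliers_deriv:
  assumes \<theta>: "\<theta> \<in> tail_multipliers" shows "partial_deriv 1 \<theta> \<in> tail_multipliers"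
proof -
  have "partial_derivs [1] \<theta> x = 0" if "\<bar>x\<bar> < 1" for x
    by (rule partial_derivs_eq_0_open[of "{-1<..<1}"]) (use that \<theta> in \<open>auto simp: tail_multipliers_def\<close>)
  then have "partial_deriv 1 \<theta> x = 0" if "\<bar>x\<bar> < 1" for x
    using that by (simp add: partial_derivs_Cons)
  moreover have "\<exists>B. \<forall>x. cmod (partial_derivs (replicate n 1) (partial_deriv 1 \<theta>) x) \<le> B" for n
    unfolding partial_derivs_replicate_Suc[symmetric] using \<theta> unfolding tail_multipliers_def by blast
  moreover have "smooth (partial_deriv 1 \<theta>)"
    using \<theta> by (intro smooth_partial_deriv) (auto simp: tail_multipliers_def)
  ultimately show ?thesis by (simp add: tail_multipliers_def)
qed

lemma partial_deriv_dilated_mult: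
  fixes \<theta> \<phi> :: "real \<Rightarrow> complex"
  assumes "smooth \<theta>" "smooth \<phi>"
  shows "partial_deriv 1 (\<lambda>x. \<theta> (x / m) * \<phi> x) =
    (\<lambda>x. of_real (1 / m) * (partial_deriv 1 \<theta> (x / m) * \<phi> x) + \<theta> (x / m) * partial_deriv 1 \<phi> x)"
proof
  fix x
  have "((\<lambda>x. \<theta> (x / m)) has_vector_derivative (1 / m) *\<^sub>R partial_deriv 1 \<theta> (x / m)) (at x)"
  proof -
    have "((\<lambda>x. x / m) has_vector_derivative 1 / m) (at x)"
      using bounded_linear_imp_has_derivative[OF bounded_linear_divide] by (simp add: has_vector_derivative_def)
    then show ?thesis
      using vector_diff_chain_at[of "\<lambda>x. x / m" "1 / m" x \<theta> "partial_deriv 1 \<theta> (x / m)"]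
        smooth_real_has_vector_derivative[OF assms(1), of "x / m"]
      by (simp add: o_def)
  qed
  from has_vector_derivative_mult[OF this smooth_real_has_vector_derivative[OF assms(2)]]
  have "partial_deriv 1 (\<lambda>x. \<theta> (x / m) * \<phi> x) x =
      \<theta> (x / m) * partial_deriv 1 \<phi> x + (1 / m) *\<^sub>R partial_deriv 1 \<theta> (x / m) * \<phi> x"
    by (rule partial_deriv_real)
  then show "partial_deriv 1 (\<lambda>x. \<theta> (x / m) * \<phi> x) x =
      of_real (1 / m) * (partial_deriv 1 \<theta> (x / m) * \<phi> x) + \<theta> (x / m) * partial_deriv 1 \<phi> x"
    by (simp add: scaleR_conv_of_real)
qed

text \<open>
  A Schwartz function is small where \<open>\<theta> (x / m)\<close> does not vanish: there \<open>m \<le> 1 + \<bar>x\<bar>\<close>, so that one more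
  power of \<open>1 + \<bar>x\<bar>\<close> in the seminorm gains the factor \<open>1 / m\<close>. The induction on the number of derivatives
  runs over all pairs \<open>\<theta>\<close>, \<open>\<phi>\<close> because the Leibniz rule moves the derivative to either factor.
\<close>
lemma dilated_tail_bound:
  assumes "\<theta> \<in> tail_multipliers" "\<phi> \<in> schwartz"
  shows "\<exists>C. \<forall>m\<ge>1. \<forall>x. (1 + \<bar>x\<bar>) ^ k * cmod (partial_derivs (replicate n 1) (\<lambda>x. \<theta> (x / m) * \<phi> x) x) \<le> C / m"
  using assms
proof (induction n arbitrary: \<theta> \<phi>)
  case 0
  obtain B where B: "\<And>x. cmod (partial_derivs (replicate 0 1) \<theta> x) \<le> B"
    using 0 unfolding tail_multipliers_def by blast
  have \<theta>B: "cmod (\<theta> x) \<le> B" for x using B[of x] by simp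
  obtain A where A: "A \<ge> 0" "\<And>x. (1 + norm x) ^ Suc k * cmod (partial_derivs [] \<phi> x) \<le> A"
    using schwartz_bound[OF 0(2), of "[]" "Suc k"] by auto
  have "(1 + \<bar>x\<bar>) ^ k * cmod (\<theta> (x / m) * \<phi> x) \<le> B * A / m" if m: "m \<ge> 1" for m x :: real
  proof (cases "\<theta> (x / m) = 0")
    case True
    have "0 \<le> B" using \<theta>B[of 0] norm_ge_zero order_trans by blast
    then show ?thesis using True A m by simp
  next
    case False
    then have "\<not> \<bar>x / m\<bar> < 1" using 0 by (auto simp: tail_multipliers_def)
    then have "m \<le> 1 + \<bar>x\<bar>" using m by (simp add: field_simps)
    then have "m * ((1 + \<bar>x\<bar>) ^ k * cmod (\<phi> x)) \<le> (1 + \<bar>x\<bar>) * ((1 + \<bar>x\<bar>) ^ k * cmod (\<phi> x))"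
      by (intro mult_right_mono) auto
    also have "\<dots> \<le> A" using A(2)[of x] by (simp add: mult_ac)
    finally have "(1 + \<bar>x\<bar>) ^ k * cmod (\<phi> x) \<le> A / m"
      using m by (simp add: field_simps)
    then have "cmod (\<theta> (x / m)) * ((1 + \<bar>x\<bar>) ^ k * cmod (\<phi> x)) \<le> B * (A / m)"
      using \<theta>B order_trans[OF norm_ge_zero \<theta>B] by (intro mult_mono) auto
    then show ?thesis by (simp add: norm_mult mult_ac)
  qed
  then show ?case by auto
next
  case (Suc n)
  have \<theta>: "smooth \<theta>" and \<phi>: "smooth \<phi>"
    using Suc.prems by (auto simp: tail_multipliers_def schwartz_def)
  obtain C1 where C1: "\<And>m x. m \<ge> 1 \<Longrightarrow> (1 + \<bar>x\<bar>) ^ k * cmod (partial_derivs (replicate n 1) (\<lambda>x. partial_deriv 1 \<theta> (x / m) * \<phi> x) x) \<le> C1 / m"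
    using Suc.IH[OF tail_multipliers_deriv[OF Suc.prems(1)] Suc.prems(2)] by blast
  obtain C2 where C2: "\<And>m x. m \<ge> 1 \<Longrightarrow> (1 + \<bar>x\<bar>) ^ k * cmod (partial_derivs (replicate n 1) (\<lambda>x. \<theta> (x / m) * partial_deriv 1 \<phi> x) x) \<le> C2 / m"
    using Suc.IH[OF Suc.prems(1) schwartz_partial_deriv[OF Suc.prems(2), of 1]] by auto
  have "(1 + \<bar>x\<bar>) ^ k * cmod (partial_derivs (replicate (Suc n) 1) (\<lambda>x. \<theta> (x / m) * \<phi> x) x) \<le> (C1 + C2) / m"
    if m: "m \<ge> 1" for m x :: real
  proof -
    let ?p = "\<lambda>x. partial_deriv 1 \<theta> (x / m) * \<phi> x" and ?q = "\<lambda>x. \<theta> (x / m) * partial_deriv 1 \<phi> x"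
    have dil: "smooth (\<lambda>x. f (x / m))" if "smooth f" for f :: "real \<Rightarrow> complex"
      using smooth_affine_real[OF that, of "1 / m" 0] by simp
    have pq: "smooth ?p" "smooth ?q"
      using \<theta> \<phi> by (auto intro!: smooth_mult dil smooth_partial_deriv)
    have 1: "set (replicate n (1::real)) \<subseteq> Basis" by auto
    let ?P = "partial_derivs (replicate n 1) ?p x" and ?Q = "partial_derivs (replicate n 1) ?q x"
    have split: "partial_derivs (replicate (Suc n) 1) (\<lambda>x. \<theta> (x / m) * \<phi> x) x = of_real (1 / m) * ?P + ?Q"
      unfolding partial_derivs_replicate_Suc partial_deriv_dilated_mult[OF \<theta> \<phi>]
      by (simp only: partial_derivs_add[OF smooth_cmult[OF pq(1)] pq(2) 1] partial_derivs_cmult[OF pq(1) 1])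
    have "cmod (of_real (1 / m) * ?P + ?Q) \<le> cmod ?P + cmod ?Q"
    proof -
      have "cmod (of_real (1 / m) * ?P) \<le> cmod ?P"
        unfolding norm_mult using m by (intro mult_left_le_one_le) (auto simp: norm_divide)
      then show ?thesis using norm_triangle_ineq[of "of_real (1 / m) * ?P" ?Q] by linarith
    qed
    then have "(1 + \<bar>x\<bar>) ^ k * cmod (partial_derivs (replicate (Suc n) 1) (\<lambda>x. \<theta> (x / m) * \<phi> x) x)
        \<le> (1 + \<bar>x\<bar>) ^ k * (cmod ?P + cmod ?Q)"
      unfolding split by (intro mult_left_mono) auto
    also have "\<dots> \<le> C1 / m + C2 / m"
      using C1[OF m, of x] C2[OF m, of x] by (simp add: distrib_left)
    finally show ?thesis by (simp add: add_divide_distrib)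
  qed
  then show ?case by blast
qed

definition cutoff :: "real \<Rightarrow> real" where
  "cutoff x = smooth_step (2 + x) * smooth_step (2 - x)"

lemma cutoff_bounds: "0 \<le> cutoff x" "cutoff x \<le> 1"
  by (auto simp: cutoff_def smooth_step_nonneg intro!: mult_le_one smooth_step_le_1)

lemma cutoff_eq_1: "\<bar>x\<bar> \<le> 1 \<Longrightarrow> cutoff x = 1"
  by (auto simp: cutoff_def smooth_step_eq_1)

lemma cutoff_eq_0: "\<bar>x\<bar> > 2 \<Longrightarrow> cutoff x = 0"
  by (cases "x > 0") (auto simp: cutoff_def smooth_step_eq_0)

lemma smooth_cutoff: "smooth (\<lambda>x. complex_of_real (cutoff x))"
proof -
  have "smooth (\<lambda>x. complex_of_real (smooth_step (1 * x + 2)) * complex_of_real (smooth_step ((- 1) * x + 2)))"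
    by (intro smooth_mult smooth_affine_real smooth_smooth_step)
  then show ?thesis by (simp add: cutoff_def add.commute)
qed

lemma one_minus_cutoff_tail_multipliers: "(\<lambda>x. 1 + (- 1) * complex_of_real (cutoff x)) \<in> tail_multipliers"
proof -
  have "(\<lambda>x. complex_of_real (cutoff x)) \<in> test_functions"
    unfolding test_functions_def using smooth_cutoff cutoff_eq_0 by auto
  then have s: "(\<lambda>x. complex_of_real (cutoff x)) \<in> schwartz"
    using test_functions_subset_schwartz by blast
  have "\<exists>B. \<forall>x. cmod (partial_derivs (replicate n 1) (\<lambda>x. 1 + (- 1) * complex_of_real (cutoff x)) x) \<le> B" for n
  proof -
    have 1: "set (replicate n (1::real)) \<subseteq> Basis" by auto
    obtain C where C: "\<And>x. (1 + norm x) ^ 0 * cmod (partial_derivs (replicate n 1) (\<lambda>x. complex_of_real (cutoff x)) x) \<le> C"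
      using schwartz_bound[OF s 1] by metis
    have one: "cmod (partial_derivs (replicate n 1) (\<lambda>x::real. 1) x) \<le> 1" for x
    proof (cases n)
      case (Suc n')
      have "partial_derivs (replicate n' 1) (\<lambda>x::real. 0) = (\<lambda>x. 0)" by (rule partial_derivs_zero)
      then show ?thesis unfolding Suc partial_derivs_replicate_Suc by simp
    qed simp
    have "cmod (partial_derivs (replicate n 1) (\<lambda>x. 1 + (- 1) * complex_of_real (cutoff x)) x) \<le> 1 + C" for x
      unfolding partial_derivs_add[OF smooth_const smooth_cmult[OF smooth_cutoff] 1] partial_derivs_cmult[OF smooth_cutoff 1]
      using C[of x] one[of x] by (intro norm_triangle_le) simp
    then show ?thesis by blast
  qed
  then show ?thesis
    unfolding tail_multipliers_def
    by (intro CollectI conjI smooth_add smooth_const smooth_cmult smooth_cutoff) (auto simp: cutoff_eq_1)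
qed

lemma schwartz_seminorm_triangle:
  assumes f: "f \<in> schwartz" and g: "g \<in> schwartz" and bs: "set bs \<subseteq> Basis"
  shows "schwartz_seminorm k bs (\<lambda>x. f x + g x) \<le> schwartz_seminorm k bs f + schwartz_seminorm k bs g"
proof -
  have bdd: "bdd_above (range (\<lambda>x. (1 + norm x) ^ k * cmod (partial_derivs bs f x)))"
    "bdd_above (range (\<lambda>x. (1 + norm x) ^ k * cmod (partial_derivs bs g x)))"
    using f g bs by (auto simp: schwartz_def)
  show ?thesis
    unfolding schwartz_seminorm_def[of k bs "\<lambda>x. f x + g x"]
  proof (rule cSUP_least)
    fix x
    have "(1 + norm x) ^ k * cmod (partial_derivs bs (\<lambda>x. f x + g x) x) \<le>
        (1 + norm x) ^ k * (cmod (partial_derivs bs f x) + cmod (partial_derivs bs g x))"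
      unfolding partial_derivs_add[OF schwartz_smooth[OF f] schwartz_smooth[OF g] bs]
      by (intro mult_left_mono norm_triangle_ineq) auto
    also have "\<dots> \<le> schwartz_seminorm k bs f + schwartz_seminorm k bs g"
      unfolding distrib_left schwartz_seminorm_def
      by (intro add_mono cSUP_upper bdd) auto
    finally show "(1 + norm x) ^ k * cmod (partial_derivs bs (\<lambda>x. f x + g x) x) \<le>
        schwartz_seminorm k bs f + schwartz_seminorm k bs g" .
  qed simp
qed

text \<open>
  Convergence in every seminorm entails convergence in the topology generated by the seminorm balls; it is
  enough to look at the balls, whatever their centre.
\<close>
lemma tempered_distribution_tendsto:
  assumes u: "u \<in> tempered_distributions" and \<phi>: "\<phi> \<in> schwartz" and f: "\<And>i. f i \<in> schwartz"
    and lim: "\<And>k bs. set bs \<subseteq> Basis \<Longrightarrow> (\<lambda>i. schwartz_seminorm k bs (\<lambda>x. f i x - \<phi> x)) \<longlonglongrightarrow> 0"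
  shows "(\<lambda>i. u (f i)) \<longlonglongrightarrow> u \<phi>"
proof (rule topological_tendstoI)
  fix S assume S: "open S" "u \<phi> \<in> S"
  have "continuous_map schwartz_topology euclidean u"
    using u by (simp add: tempered_distributions_def topological_dual_def)
  then have "openin schwartz_topology {x \<in> topspace schwartz_topology. u x \<in> S}"
    using S(1) by (intro openin_continuous_map_preimage[where Y = euclidean]) auto
  then have gen: "generate_topology_on {{g \<in> schwartz. schwartz_seminorm k bs (\<lambda>x. g x - f x) < e} | f k bs e.
      f \<in> schwartz \<and> set bs \<subseteq> Basis \<and> e > 0} {x \<in> schwartz. u x \<in> S}"
    by (simp add: schwartz_topology_def[symmetric] openin_topology_generated_by_iff[symmetric] flip: schwartz_topology_def)
  have "\<forall>\<^sub>F i in sequentially. f i \<in> U"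
    if "generate_topology_on {{g \<in> schwartz. schwartz_seminorm k bs (\<lambda>x. g x - f x) < e} | f k bs e.
      f \<in> schwartz \<and> set bs \<subseteq> Basis \<and> e > 0} U" "\<phi> \<in> U" for U
    using that
  proof induction
    case Empty
    then show ?case by simp
  next
    case (Int a b)
    then show ?case by (auto intro: eventually_conj)
  next
    case (UN K)
    then obtain k where k: "k \<in> K" "\<phi> \<in> k" by blast
    then have "\<forall>\<^sub>F i in sequentially. f i \<in> k" using UN by blast
    then show ?case by eventually_elim (use k in blast)
  next
    case (Basis s)
    then obtain f0 k bs e where s: "s = {g \<in> schwartz. schwartz_seminorm k bs (\<lambda>x. g x - f0 x) < e}"
      and f0: "f0 \<in> schwartz" and bs: "set bs \<subseteq> Basis" by blast
    have less: "schwartz_seminorm k bs (\<lambda>x. \<phi> x - f0 x) < e" using Basis s by blast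
    have "\<forall>\<^sub>F i in sequentially. schwartz_seminorm k bs (\<lambda>x. f i x - \<phi> x) < e - schwartz_seminorm k bs (\<lambda>x. \<phi> x - f0 x)"
      using lim[OF bs, of k] less by (intro order_tendstoD(2)[where y = 0]) auto
    then show ?case
    proof eventually_elim
      case (elim i)
      have "schwartz_seminorm k bs (\<lambda>x. (f i x - \<phi> x) + (\<phi> x - f0 x)) \<le>
          schwartz_seminorm k bs (\<lambda>x. f i x - \<phi> x) + schwartz_seminorm k bs (\<lambda>x. \<phi> x - f0 x)"
        by (intro schwartz_seminorm_triangle schwartz_diff f \<phi> f0 bs)
      then show ?case using elim f by (simp add: s)
    qed
  qed
  from this[OF gen] show "\<forall>\<^sub>F i in sequentially. u (f i) \<in> S"
    using \<phi> S by (auto elim: eventually_mono)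
qed

text \<open>
  The approximations are \<open>cutoff (x / m) * \<phi> x\<close>. The pointwise domination is recorded for passing to the
  limit under the integral.
\<close>
lemma test_functions_dense:
  assumes \<phi>: "\<phi> \<in> schwartz"
  obtains f where "\<And>i. f i \<in> test_functions" "\<And>i x. cmod (f i x) \<le> cmod (\<phi> x)" "\<And>x. (\<lambda>i. f i x) \<longlonglongrightarrow> \<phi> x"
    "\<And>u. u \<in> tempered_distributions \<Longrightarrow> (\<lambda>i. u (f i)) \<longlonglongrightarrow> u \<phi>"
proof -
  define f where "f i x = complex_of_real (cutoff (x / real (Suc i))) * \<phi> x" for i x
  have f_test: "f i \<in> test_functions" for i
  proof -
    have "smooth (f i)"
      unfolding f_def using smooth_affine_real[OF smooth_cutoff, of "1 / real (Suc i)" 0] \<phi>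
      by (intro smooth_mult schwartz_smooth[OF \<phi>]) simp_all
    moreover have "f i x = 0" if "\<bar>x\<bar> > 2 * real (Suc i)" for x
    proof -
      have "\<bar>x / real (Suc i)\<bar> > 2" using that by (simp add: field_simps)
      then show ?thesis by (simp add: f_def cutoff_eq_0)
    qed
    ultimately show ?thesis by (auto simp: test_functions_def)
  qed
  then have f_schwartz: "f i \<in> schwartz" for i using test_functions_subset_schwartz by blast
  have f_le: "cmod (f i x) \<le> cmod (\<phi> x)" for i x
    using cutoff_bounds[of "x / real (Suc i)"] by (simp add: f_def norm_mult mult_left_le_one_le)
  have f_lim: "(\<lambda>i. f i x) \<longlonglongrightarrow> \<phi> x" for x
  proof (rule tendsto_eventually)
    show "\<forall>\<^sub>F i in sequentially. f i x = \<phi> x"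
      using eventually_ge_at_top[of "nat \<lceil>\<bar>x\<bar>\<rceil>"]
    proof eventually_elim
      case (elim i)
      then have "\<bar>x\<bar> \<le> real (Suc i)" by linarith
      then have "\<bar>x / real (Suc i)\<bar> \<le> 1" by (simp add: field_simps)
      then show ?case by (simp add: f_def cutoff_eq_1)
    qed
  qed
  have f_u: "(\<lambda>i. u (f i)) \<longlonglongrightarrow> u \<phi>" if u: "u \<in> tempered_distributions" for u
  proof (rule tempered_distribution_tendsto[OF u \<phi> f_schwartz])
    fix k and bs :: "real list" assume bs: "set bs \<subseteq> Basis"
    then have bs': "bs = replicate (length bs) 1"
      by (intro replicate_length_same[symmetric]) auto
    let ?\<theta> = "\<lambda>x. 1 + (- 1) * complex_of_real (cutoff x)"
    obtain C where C: "\<And>m x. m \<ge> 1 \<Longrightarrow> (1 + \<bar>x\<bar>) ^ k * cmod (partial_derivs bs (\<lambda>x. ?\<theta> (x / m) * ((- 1) * \<phi> x)) x) \<le> C / m"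
      using dilated_tail_bound[OF one_minus_cutoff_tail_multipliers schwartz_cmult[OF \<phi>, of "-1"], of k "length bs"]
      unfolding bs'[symmetric] by blast
    have eq: "(\<lambda>x. f i x - \<phi> x) = (\<lambda>x. ?\<theta> (x / real (Suc i)) * ((- 1) * \<phi> x))" for i
      by (auto simp: f_def algebra_simps)
    have le: "schwartz_seminorm k bs (\<lambda>x. f i x - \<phi> x) \<le> C / real (Suc i)" for i
      unfolding schwartz_seminorm_def eq using C[of "real (Suc i)"] by (intro cSUP_least) auto
    have ge: "0 \<le> schwartz_seminorm k bs (\<lambda>x. f i x - \<phi> x)" for i
    proof -
      have "bdd_above (range (\<lambda>x. (1 + norm x) ^ k * cmod (partial_derivs bs (\<lambda>x. f i x - \<phi> x) x)))"
        using schwartz_diff[OF f_schwartz[of i] \<phi>] bs by (simp add: schwartz_def)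
      then have "(1 + norm (0::real)) ^ k * cmod (partial_derivs bs (\<lambda>x. f i x - \<phi> x) 0) \<le> schwartz_seminorm k bs (\<lambda>x. f i x - \<phi> x)"
        unfolding schwartz_seminorm_def by (intro cSUP_upper) auto
      moreover have "0 \<le> (1 + norm (0::real)) ^ k * cmod (partial_derivs bs (\<lambda>x. f i x - \<phi> x) 0)" by simp
      ultimately show ?thesis by linarith
    qed
    have "(\<lambda>i. C * inverse (real (Suc i))) \<longlonglongrightarrow> C * 0"
      by (intro tendsto_mult_left LIMSEQ_inverse_real_of_nat)
    then have "(\<lambda>i. C / real (Suc i)) \<longlonglongrightarrow> 0" by (simp add: divide_inverse)
    then show "(\<lambda>i. schwartz_seminorm k bs (\<lambda>x. f i x - \<phi> x)) \<longlonglongrightarrow> 0"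
      by (rule tendsto_sandwich[OF always_eventually[OF allI[OF ge]] always_eventually[OF allI[OF le]]
            tendsto_const])
  qed
  show thesis
    by (rule that[of f, OF f_test f_le f_lim f_u])
qed

section \<open>The estimate for tempered distributions\<close>

text \<open>
  The embedding theorem is applied to \<open>u - v\<close>. Its conclusion on test functions extends to Schwartz functions by
  continuity of \<open>u\<close> on one side and dominated convergence on the other.
\<close>
lemma tempered_decomposition:
  assumes u: "u \<in> tempered_distributions" and F: "F \<in> L1_od" and v: "v \<in> L2"
    and eq: "\<And>G. G \<in> schwartz_od \<Longrightarrow> u (div_half G) = distr_od_of F G + distr_of v (div_half G)"
  obtains g C where "g \<in> L2" "\<And>\<phi>. \<phi> \<in> schwartz \<Longrightarrow> u \<phi> = (LINT x|lebesgue. (g x + C) * \<phi> x)"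
    "L2_norm g \<le> sqrt 2 * max 1 (32 * bump_bound\<^sup>2) * (L1_od_norm F + L2_norm v)"
proof -
  have test: "\<phi> \<in> schwartz" if "\<phi> \<in> test_functions" for \<phi>
    using that test_functions_subset_schwartz by blast
  have u_add: "u (\<lambda>x. f x + g x) = u f + u g" if "f \<in> schwartz" "g \<in> schwartz" for f g
    using u that by (simp add: tempered_distributions_def topological_dual_def)
  have u_cmult: "u (\<lambda>x. c * f x) = c * u f" if "f \<in> schwartz" for c f
    using u that by (simp add: tempered_distributions_def topological_dual_def)
  define w where "w \<phi> = u \<phi> - (LINT x|lebesgue. v x * \<phi> x)" for \<phi>
  have w_linear: "w (\<lambda>x. a * \<phi> x + b * \<psi> x) = a * w \<phi> + b * w \<psi>"
    if \<phi>: "\<phi> \<in> test_functions" and \<psi>: "\<psi> \<in> test_functions" for a b \<phi> \<psi>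
  proof -
    have "(LINT x|lebesgue. v x * (a * \<phi> x + b * \<psi> x)) = (LINT x|lebesgue. a * (v x * \<phi> x) + b * (v x * \<psi> x))"
      by (simp add: algebra_simps)
    also have "\<dots> = a * (LINT x|lebesgue. v x * \<phi> x) + b * (LINT x|lebesgue. v x * \<psi> x)"
      using L2_mult_schwartz_integrable[OF v test[OF \<phi>]] L2_mult_schwartz_integrable[OF v test[OF \<psi>]] by simp
    finally show ?thesis
      by (simp add: w_def u_add u_cmult schwartz_cmult test \<phi> \<psi> algebra_simps)
  qed
  have w_div: "w (div_half G) = distr_od_of F G" if "G \<in> schwartz_od" "div_half G \<in> test_functions" for G
    using eq[OF that(1)] test[OF that(2)] by (simp add: w_def distr_of_def)
  obtain f C where f: "f \<in> L2" "L2_norm f \<le> 32 * bump_bound\<^sup>2 * L1_od_norm F"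
    and w: "\<And>\<phi>. \<phi> \<in> test_functions \<Longrightarrow> w \<phi> = (LINT x|lebesgue. (f x + C) * \<phi> x)"
    using gradient_in_L1_representation[OF F w_linear w_div] by blast
  define g where "g x = f x + v x" for x
  have g: "g \<in> L2" "L2_norm g \<le> sqrt 2 * (L2_norm f + L2_norm v)"
    unfolding g_def using L2_add[OF f(1) v] by auto
  have L1_nonneg: "0 \<le> L1_od_norm F"
    unfolding L1_od_norm_def by (intro integral_nonneg_AE) auto
  have L2_nonneg: "0 \<le> L2_norm v"
    unfolding L2_norm_def by (intro real_sqrt_ge_zero integral_nonneg_AE) auto
  have "L2_norm f + L2_norm v \<le> max 1 (32 * bump_bound\<^sup>2) * L1_od_norm F + max 1 (32 * bump_bound\<^sup>2) * L2_norm v"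
  proof (intro add_mono)
    show "L2_norm f \<le> max 1 (32 * bump_bound\<^sup>2) * L1_od_norm F"
      using f(2) L1_nonneg by (elim order_trans) (intro mult_right_mono; simp)
    show "L2_norm v \<le> max 1 (32 * bump_bound\<^sup>2) * L2_norm v"
      using mult_right_mono[OF max.cobounded1 L2_nonneg, of 1 "32 * bump_bound\<^sup>2"] by simp
  qed
  then have le: "sqrt 2 * (L2_norm f + L2_norm v) \<le> sqrt 2 * (max 1 (32 * bump_bound\<^sup>2) * (L1_od_norm F + L2_norm v))"
    by (intro mult_left_mono) (auto simp: distrib_left)
  have g_norm: "L2_norm g \<le> sqrt 2 * max 1 (32 * bump_bound\<^sup>2) * (L1_od_norm F + L2_norm v)"
    using order_trans[OF g(2) le] by (simp only: mult.assoc)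
  have u_test: "u \<phi> = (LINT x|lebesgue. (g x + C) * \<phi> x)" if \<phi>: "\<phi> \<in> test_functions" for \<phi>
  proof -
    have "u \<phi> = (LINT x|lebesgue. (f x + C) * \<phi> x) + (LINT x|lebesgue. v x * \<phi> x)"
      using w[OF \<phi>] by (simp add: w_def algebra_simps)
    also have "\<dots> = (LINT x|lebesgue. (f x + C) * \<phi> x + v x * \<phi> x)"
      by (intro Bochner_Integration.integral_add[symmetric] L2_mult_schwartz_integrable
          L2_plus_const_mult_schwartz_integrable f v test \<phi>)
    also have "\<dots> = (LINT x|lebesgue. (g x + C) * \<phi> x)"
      by (intro Bochner_Integration.integral_cong) (auto simp: g_def algebra_simps)
    finally show ?thesis .
  qed
  show thesis
  proof (rule that[OF g(1) _ g_norm])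
    fix \<phi> :: "real \<Rightarrow> complex" assume \<phi>: "\<phi> \<in> schwartz"
    obtain h where h: "\<And>i. h i \<in> test_functions" "\<And>i x. cmod (h i x) \<le> cmod (\<phi> x)"
      "\<And>x. (\<lambda>i. h i x) \<longlonglongrightarrow> \<phi> x" "(\<lambda>i. u (h i)) \<longlonglongrightarrow> u \<phi>"
      using test_functions_dense[OF \<phi>] u by metis
    have int: "integrable lebesgue (\<lambda>x. (g x + C) * \<phi> x)"
      by (rule L2_plus_const_mult_schwartz_integrable[OF g(1) \<phi>])
    have int_h: "integrable lebesgue (\<lambda>x. (g x + C) * h i x)" for i
      by (rule L2_plus_const_mult_schwartz_integrable[OF g(1) test[OF h(1)]])
    have "(\<lambda>i. LINT x|lebesgue. (g x + C) * h i x) \<longlonglongrightarrow> (LINT x|lebesgue. (g x + C) * \<phi> x)"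
    proof (rule integral_dominated_convergence[OF _ _ integrable_norm[OF int]])
      show "(\<lambda>x. (g x + C) * \<phi> x) \<in> borel_measurable lebesgue"
        using int by (rule borel_measurable_integrable)
      show "(\<lambda>x. (g x + C) * h i x) \<in> borel_measurable lebesgue" for i
        using int_h by (rule borel_measurable_integrable)
      show "AE x in lebesgue. (\<lambda>i. (g x + C) * h i x) \<longlonglongrightarrow> (g x + C) * \<phi> x"
        by (intro AE_I2 tendsto_mult_left h)
      show "AE x in lebesgue. norm ((g x + C) * h i x) \<le> norm ((g x + C) * \<phi> x)" for i
        unfolding norm_mult by (intro AE_I2 mult_left_mono h) auto
    qed
    then have "(\<lambda>i. u (h i)) \<longlonglongrightarrow> (LINT x|lebesgue. (g x + C) * \<phi> x)"
      by (simp add: u_test h(1))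
    then show "u \<phi> = (LINT x|lebesgue. (g x + C) * \<phi> x)"
      using h(4) LIMSEQ_unique by blast
  qed
qed

text \<open>
  The embedding theorem with \<open>F = 0\<close>: the difference \<open>v' - v\<close> has vanishing fractional gradient, so it is
  a function of norm \<open>0\<close> up to a constant.
\<close>
lemma L2_norm_unique:
  assumes v: "v \<in> L2" and v': "v' \<in> L2" and eq: "d_half (distr_of v) = d_half (distr_of v')"
  shows "L2_norm v' = L2_norm v"
proof -
  define d where "d x = v' x - v x" for x
  have d: "d \<in> L2" unfolding d_def using v' v by (rule L2_diff)
  define w where "w \<phi> = (LINT x|lebesgue. d x * \<phi> x)" for \<phi> :: "real \<Rightarrow> complex"
  have int: "integrable lebesgue (\<lambda>x. a x * \<phi> x)" if "a \<in> L2" "\<phi> \<in> test_functions" for a and \<phi> :: "real \<Rightarrow> complex"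
    using that test_functions_subset_schwartz by (intro L2_mult_schwartz_integrable) auto
  have zero: "(\<lambda>z. 0) \<in> L1_od" "L1_od_norm (\<lambda>z. 0) = 0"
    by (simp_all add: L1_od_def L1_od_norm_def case_prod_beta')
  have w_linear: "w (\<lambda>x. a * \<phi> x + b * \<psi> x) = a * w \<phi> + b * w \<psi>"
    if \<phi>: "\<phi> \<in> test_functions" and \<psi>: "\<psi> \<in> test_functions" for a b \<phi> \<psi>
  proof -
    have "w (\<lambda>x. a * \<phi> x + b * \<psi> x) = (LINT x|lebesgue. a * (d x * \<phi> x) + b * (d x * \<psi> x))"
      by (simp add: w_def algebra_simps)
    also have "\<dots> = a * w \<phi> + b * w \<psi>"
      unfolding w_def using int[OF d \<phi>] int[OF d \<psi>] by simp
    finally show ?thesis .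
  qed
  have w_div: "w (div_half G) = distr_od_of (\<lambda>z. 0) G" if G: "G \<in> schwartz_od" and div: "div_half G \<in> test_functions" for G
  proof -
    have "d_half (distr_of v) G = d_half (distr_of v') G" using eq by simp
    moreover have "div_half G \<in> schwartz" using div test_functions_subset_schwartz by blast
    ultimately have "(LINT x|lebesgue. v x * div_half G x) = (LINT x|lebesgue. v' x * div_half G x)"
      using G by (simp add: d_half_def distr_of_def)
    moreover have "w (div_half G) = (LINT x|lebesgue. v' x * div_half G x) - (LINT x|lebesgue. v x * div_half G x)"
      unfolding w_def d_def left_diff_distrib
      by (intro Bochner_Integration.integral_diff int v v' div)
    ultimately show ?thesis
      using G by (simp add: distr_od_of_def case_prod_beta')
  qed
  obtain f C where f: "f \<in> L2" "L2_norm f \<le> 32 * bump_bound\<^sup>2 * L1_od_norm (\<lambda>z. 0)"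
    and w: "\<And>\<phi>. \<phi> \<in> test_functions \<Longrightarrow> w \<phi> = (LINT x|lebesgue. (f x + C) * \<phi> x)"
    using gradient_in_L1_representation[OF zero(1) w_linear w_div] by blast
  have df: "AE x in lebesgue. d x = f x"
    by (rule L2_plus_const_unique(2)[OF d f(1), of 0 C]) (use w in \<open>simp add: w_def\<close>)
  have f2: "integrable lebesgue (\<lambda>x. (cmod (f x))\<^sup>2)" using f(1) by (simp add: L2_def)
  have "(LINT x|lebesgue. (cmod (f x))\<^sup>2) \<le> 0"
    using f(2) zero(2) by (simp add: L2_norm_def)
  moreover have "0 \<le> (LINT x|lebesgue. (cmod (f x))\<^sup>2)"
    by (intro integral_nonneg_AE) auto
  ultimately have "AE x in lebesgue. (cmod (f x))\<^sup>2 = 0"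
    using integral_nonneg_eq_0_iff_AE[OF f2] by auto
  with df have "AE x in lebesgue. v' x = v x"
    by eventually_elim (simp add: d_def)
  then show ?thesis
    by (rule L2_norm_cong_AE[OF v' v])
qed

lemma H_od_norm_d_half:
  assumes "v \<in> L2"
  shows "H_od_norm (d_half (distr_of v)) = L2_norm v"
  unfolding H_od_norm_def
proof (rule the_equality)
  show "\<exists>v'\<in>L2. d_half (distr_of v) = d_half (distr_of v') \<and> L2_norm v = L2_norm v'"
    using assms by blast
  show "r = L2_norm v" if "\<exists>v'\<in>L2. d_half (distr_of v) = d_half (distr_of v') \<and> r = L2_norm v'" for r
    using that L2_norm_unique[OF assms] by blast
qed

theorem theorem4p6:
  "\<exists>K::real. K > 0 \<and>
     (\<forall>u :: (real \<Rightarrow> complex) \<Rightarrow> complex. u \<in> tempered_distributions \<longrightarrow>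
        d_half u \<in> L1_plus_H_od \<longrightarrow>
        (\<exists>C::complex. \<exists>f\<in>L2.
           (\<lambda>\<phi>\<in>schwartz. u \<phi> - distr_of (\<lambda>_. C) \<phi>) = distr_of f \<and>
           L2_norm f \<le> K * L1_plus_H_od_norm (d_half u)))"
proof -
  define K where "K = sqrt 2 * max 1 (32 * bump_bound\<^sup>2)"
  have K: "K > 0" by (simp add: K_def less_max_iff_disj)
  have "\<exists>C::complex. \<exists>f\<in>L2. (\<lambda>\<phi>\<in>schwartz. u \<phi> - distr_of (\<lambda>_. C) \<phi>) = distr_of f \<and>
      L2_norm f \<le> K * L1_plus_H_od_norm (d_half u)"
    if u: "u \<in> tempered_distributions" and du: "d_half u \<in> L1_plus_H_od" for u
  proof -
    have bound: "\<exists>g C. g \<in> L2 \<and> (\<forall>\<phi>\<in>schwartz. u \<phi> = (LINT x|lebesgue. (g x + C) * \<phi> x)) \<and>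
        L2_norm g \<le> K * (L1_od_norm F + H_od_norm V)" if dec: "L1_H_decomp (d_half u) F V" for F V
    proof -
      have F: "F \<in> L1_od" and V: "V \<in> H_od"
        and eq: "d_half u = (\<lambda>G\<in>schwartz_od. distr_od_of F G + V G)"
        using dec by (auto simp: L1_H_decomp_def)
      obtain v where v: "v \<in> L2" "V = d_half (distr_of v)" using V by (auto simp: H_od_def)
      have eq': "u (div_half G) = distr_od_of F G + distr_of v (div_half G)" if "G \<in> schwartz_od" for G
        using fun_cong[OF eq, of G] that v(2) by (simp add: d_half_def)
      obtain g C where "g \<in> L2" "\<And>\<phi>. \<phi> \<in> schwartz \<Longrightarrow> u \<phi> = (LINT x|lebesgue. (g x + C) * \<phi> x)"
        "L2_norm g \<le> K * (L1_od_norm F + L2_norm v)"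
        unfolding K_def using tempered_decomposition[OF u F v(1) eq'] by blast
      moreover have "H_od_norm V = L2_norm v"
        unfolding v(2) by (rule H_od_norm_d_half[OF v(1)])
      ultimately show ?thesis by metis
    qed
    obtain F0 V0 where dec0: "L1_H_decomp (d_half u) F0 V0"
      using du by (auto simp: L1_plus_H_od_def)
    obtain f C where f: "f \<in> L2" and u_eq: "\<And>\<phi>. \<phi> \<in> schwartz \<Longrightarrow> u \<phi> = (LINT x|lebesgue. (f x + C) * \<phi> x)"
      using bound[OF dec0] by blast
    \<comment> \<open>The function \<open>f\<close> comes from one decomposition but obeys the bounds of all of them.\<close>
    have le: "L2_norm f \<le> K * (L1_od_norm F + H_od_norm V)" if dec: "L1_H_decomp (d_half u) F V" for F V
    proof -
      obtain g D where g: "g \<in> L2" "\<And>\<phi>. \<phi> \<in> schwartz \<Longrightarrow> u \<phi> = (LINT x|lebesgue. (g x + D) * \<phi> x)"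
        "L2_norm g \<le> K * (L1_od_norm F + H_od_norm V)"
        using bound[OF dec] by blast
      have "AE x in lebesgue. f x = g x"
      proof (rule L2_plus_const_unique(2)[OF f g(1)])
        fix \<phi> :: "real \<Rightarrow> complex" assume "\<phi> \<in> test_functions"
        then have "\<phi> \<in> schwartz" using test_functions_subset_schwartz by blast
        then show "(LINT x|lebesgue. (f x + C) * \<phi> x) = (LINT x|lebesgue. (g x + D) * \<phi> x)"
          using u_eq g(2) by simp
      qed
      then show ?thesis using L2_norm_cong_AE[OF f g(1)] g(3) by simp
    qed
    have "L2_norm f / K \<le> L1_plus_H_od_norm (d_half u)"
      unfolding L1_plus_H_od_norm_def
    proof (rule cInf_greatest)
      show "{L1_od_norm F + H_od_norm V | F V. L1_H_decomp (d_half u) F V} \<noteq> {}"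
        using dec0 by blast
      fix t assume "t \<in> {L1_od_norm F + H_od_norm V | F V. L1_H_decomp (d_half u) F V}"
      then show "L2_norm f / K \<le> t"
        using le K by (auto simp: pos_divide_le_eq mult.commute)
    qed
    then have norm: "L2_norm f \<le> K * L1_plus_H_od_norm (d_half u)"
      using K by (simp add: pos_divide_le_eq mult.commute)
    have "(\<lambda>\<phi>\<in>schwartz. u \<phi> - distr_of (\<lambda>_. C) \<phi>) = distr_of f"
      unfolding distr_of_def[of f]
    proof (rule restrict_ext)
      fix \<phi> :: "real \<Rightarrow> complex" assume \<phi>: "\<phi> \<in> schwartz"
      have "u \<phi> = (LINT x|lebesgue. f x * \<phi> x) + (LINT x|lebesgue. C * \<phi> x)"
        unfolding u_eq[OF \<phi>] distrib_right
        by (intro Bochner_Integration.integral_add L2_mult_schwartz_integrable integrable_mult_right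
            schwartz_integrable f \<phi>)
      then show "u \<phi> - distr_of (\<lambda>_. C) \<phi> = (LINT x|lebesgue. f x * \<phi> x)"
        using \<phi> by (simp add: distr_of_def)
    qed
    then show ?thesis using f norm by blast
  qed
  then show ?thesis using K by blast
qed

end
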